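(* Let $\Omega\subseteq\mathbb{R}^n$ be an open convex set and $\varphi:\Omega\to(0,\infty)$ a $C^2$ convex function with $D^2\varphi(x)\ge C\,I_n$ for all $x\in\Omega$, for some constant $C>0$. For $\beta$ with $\int_\Omega\varphi^{-\beta}<\infty$ let $d\mu_\beta=\frac{\varphi(x)^{-\beta}}{\int_\Omega\varphi^{-\beta}dx}dx$. Then: (i) if $\beta\ge n+1$, for every locally Lipschitz $f\in L^2(\mu_\beta)$, $$\mathrm{Var}_{\mu_\beta}(f)\le\frac1{C(\beta-1)}\int_\Omega|\nabla f|^2\varphi\,d\mu_\beta;$$ (ii) if $\beta\ge n$ and also $\int_\Omega\varphi^{-\beta-1}dx<\infty$, for every smooth bounded $f$ on $\Omega$, $$\inf_{c\in\mathbb{R}}\int_\Omega\frac{|f(x)-c|^2}{\varphi(x)}\,d\mu_\beta\le\frac1{C\beta}\int_\Omega|\nabla f|^2d\mu_\beta.$$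
   Context: $I_n$ is the $n\times n$ identity matrix; $D^2\varphi\ge CI_n$ is in the sense of symmetric matrices. $\mathrm{Var}_\mu(f)=\int f^2d\mu-(\int f\,d\mu)^2$. *)

theory Defs
  imports "HOL-Analysis.Analysis"
begin

definition grad :: "('a::euclidean_space \<Rightarrow> real) \<Rightarrow> 'a \<Rightarrow> 'a" where
  "grad f x = (if f differentiable (at x)
               then (THE g. (f has_derivative (\<lambda>h. g \<bullet> h)) (at x)) else 0)"

definition mu_beta :: "'a::euclidean_space set \<Rightarrow> ('a \<Rightarrow> real) \<Rightarrow> real \<Rightarrow> 'a measure" where
  "mu_beta \<Omega> \<phi> \<beta> = density (restrict_space lebesgue \<Omega>)
     (\<lambda>x. ennreal (\<phi> x powr (-\<beta>) / (\<integral>y\<in>\<Omega>. \<phi> y powr (-\<beta>) \<partial>lebesgue)))"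

definition Var :: "'a measure \<Rightarrow> ('a \<Rightarrow> real) \<Rightarrow> real" where
  "Var M f = (\<integral>x. (f x)\<^sup>2 \<partial>M) - (\<integral>x. f x \<partial>M)\<^sup>2"

definition locally_lipschitz_on :: "'a::metric_space set \<Rightarrow> ('a \<Rightarrow> real) \<Rightarrow> bool" where
  "locally_lipschitz_on S f \<longleftrightarrow>
     (\<forall>x\<in>S. \<exists>e>0. \<exists>L. L-lipschitz_on (ball x e \<inter> S) f)"

coinductive smooth_on :: "'a::euclidean_space set \<Rightarrow> ('a \<Rightarrow> real) \<Rightarrow> bool" where
  "\<lbrakk>\<forall>x\<in>S. (f has_derivative (\<lambda>h. \<Sum>i\<in>Basis. (h \<bullet> i) * d i x)) (at x);
    \<forall>i\<in>Basis. smooth_on S (d i)\<rbrakk> \<Longrightarrow> smooth_on S f"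

end

theory Submission
  imports Defs
begin

text \<open>
  The density \<open>\<phi>\<^sup>-\<^sup>\<beta>\<close> is, up to the factor \<open>\<Gamma>(\<beta>)\<close>, the marginal in \<open>x = y / t\<close> of
  \<open>t\<^sup>\<alpha> exp (- t \<phi>(y / t)) dy dt\<close> on the cone over \<open>\<Omega>\<close>, where \<open>\<alpha> = \<beta> - 1 - n\<close>. The perspective
  \<open>t \<phi>(y / t)\<close> is jointly convex, so for \<open>\<beta> \<ge> n + 1\<close> this measure is log-concave, and linearizing the
  midpoint Prekopa--Leindler inequality at the perturbations \<open>\<plusminus> s f - s\<^sup>2 \<bar>\<nabla>f\<bar>\<^sup>2 / (2 C t)\<close> bounds the
  variance of \<open>f\<close> by the mean of \<open>\<bar>\<nabla>f\<bar>\<^sup>2 / (C t)\<close>. Since \<open>\<Gamma>(\<beta> - 1) / \<Gamma>(\<beta>) = 1 / (\<beta> - 1)\<close>, integrating out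
  \<open>t\<close> gives (i) on compact convex subsets of \<open>\<Omega>\<close>, which exhaust \<open>\<Omega>\<close>. That the points where \<open>f\<close> is not
  differentiable contribute nothing is Rademacher's theorem. Part (ii) is the inequality of (i) for
  the exponent \<open>\<beta> + 1\<close>, with \<open>c\<close> the mean of \<open>f\<close>.
\<close>

section \<open>The Prekopa--Leindler inequality\<close>

text \<open>The perturbation comes from the convexity defect of the perspective. At the midpoint of
  \<open>(t0 x0, t0)\<close> and \<open>(t1 x1, t1)\<close> strong convexity of \<phi> gains
  \<open>C T d^2 / 2\<close>, where \<open>T = t0 t1 / (t0 + t1)\<close> and d is the distance of x0
  and x1. An increment \<open>s l d\<close> of \<open>s f\<close> is at most
  \<open>C T d^2 / 2 + s^2 l^2 / (2 C T)\<close>, and since \<open>1/T = 1/t0 + 1/t1\<close> the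
  last term splits into one term per endpoint, \<open>s^2 l^2 / (2 C t)\<close>. Two obstacles shape
  the rest. This correction is unbounded near \<open>t = 0\<close>, so the expansion in s is carried
  out for \<open>t \<ge> \<rho>\<close> and \<rho> is sent to 0 afterwards. The midpoint inequality
  concerns pairs at positive distance while a gradient is a limit, so l has to be a Lipschitz
  constant at some scale \<eta>; pairs farther apart are absorbed by taking s small in terms of
  \<rho> and \<eta>. Energies are extended nonnegative integrals. In the passage to the whole domain
  they need only be monotone in the set, whereas the moments of f converge by domination.\<close>

lemma brunn_minkowski_real_bounded:
  fixes A B D :: "real set"
  assumes [measurable]: "A \<in> sets borel" "B \<in> sets borel" "D \<in> sets borel"
    and ne: "A \<noteq> {}" "B \<noteq> {}" and bdd: "bounded A" "bounded B"
    and mid: "\<And>x y. x \<in> A \<Longrightarrow> y \<in> B \<Longrightarrow> (x + y) / 2 \<in> D"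
  shows "emeasure lborel A + emeasure lborel B \<le> 2 * emeasure lborel D"
proof (rule ennreal_le_epsilon)
  fix e :: real assume e: "e > 0"
  from bdd have bA: "bdd_above A" and bB: "bdd_below B" 
    by (auto intro: bounded_imp_bdd_above bounded_imp_bdd_below)
  \<comment> \<open>With a near the supremum of A and b near the infimum of B, the halved translates
    \<open>(A + b) / 2\<close> and \<open>(B + a) / 2\<close> lie almost side by side in D: their
    overlap is confined to an interval of length at most \<open>e / 2\<close>.\<close>
  obtain a where a: "a \<in> A" "Sup A - e/2 < a"
    using less_cSup_iff[OF ne(1) bA, of "Sup A - e/2"] e by auto
  obtain b where b: "b \<in> B" "b < Inf B + e/2"
    using cInf_less_iff[OF ne(2) bB, of "Inf B + e/2"] e by auto
  define A' where "A' = {z. -b + 2 * z \<in> A}"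
  define B' where "B' = {z. -a + 2 * z \<in> B}"
  have [measurable]: "A' \<in> sets borel" "B' \<in> sets borel"
    unfolding A'_def B'_def by measurable
  have half: "emeasure lborel S = 2 * emeasure lborel {z. t + 2 * z \<in> S}"
    if [measurable]: "S \<in> sets borel" for S :: "real set" and t
  proof -
    have "emeasure lborel S = (\<integral>\<^sup>+x. indicator S x \<partial>lborel)" by simp
    also have "\<dots> = 2 * (\<integral>\<^sup>+x. indicator S (t + 2 * x) \<partial>lborel)"
      by (subst nn_integral_real_affine[where c=2 and t=t]) auto
    also have "(\<integral>\<^sup>+x. indicator S (t + 2 * x) \<partial>lborel) = (\<integral>\<^sup>+x. indicator {z. t + 2 * z \<in> S} x \<partial>lborel)"
      by (intro nn_integral_cong) (auto simp: indicator_def)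
    finally show ?thesis by simp
  qed
  have AD: "A' \<subseteq> D"
  proof
    fix z assume "z \<in> A'"
    then show "z \<in> D" using mid[of "-b + 2 * z" b] b by (auto simp: A'_def)
  qed
  have BD: "B' \<subseteq> D"
  proof
    fix z assume "z \<in> B'"
    then show "z \<in> D" using mid[of a "-a + 2 * z"] a by (auto simp: B'_def)
  qed
  have ov: "A' \<inter> B' \<subseteq> {(a + Inf B)/2 .. (Sup A + b)/2}"
  proof
    fix z assume z: "z \<in> A' \<inter> B'"
    have "-b + 2*z \<le> Sup A" using z bA by (auto simp: A'_def intro: cSup_upper)
    moreover have "Inf B \<le> -a + 2*z" using z bB by (auto simp: B'_def intro: cInf_lower)
    ultimately show "z \<in> {(a + Inf B)/2 .. (Sup A + b)/2}" by (auto simp: field_simps)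
  qed
  have "emeasure lborel (A' \<inter> B') \<le> emeasure lborel {(a + Inf B)/2 .. (Sup A + b)/2}"
    by (intro emeasure_mono ov) auto
  also have "\<dots> \<le> ennreal (e/2)"
    using a b unfolding emeasure_lborel_Icc_eq by (auto intro!: ennreal_leI simp: field_simps)
  finally have ov2: "emeasure lborel (A' \<inter> B') \<le> ennreal (e/2)" .
  have "emeasure lborel A' + emeasure lborel B'
      = emeasure lborel (A' \<union> B') + emeasure lborel (A' \<inter> B')"
    by (rule emeasure_Un_Int) auto
  also have "\<dots> \<le> emeasure lborel D + ennreal (e/2)"
    using AD BD by (intro add_mono ov2 emeasure_mono) auto
  finally have "2 * (emeasure lborel A' + emeasure lborel B') \<le> 2 * (emeasure lborel D + ennreal (e/2))"
    by (rule mult_left_mono) auto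
  also have "\<dots> = 2 * emeasure lborel D + ennreal e"
    using e by (simp add: distrib_left flip: ennreal_mult' ennreal_numeral)
  finally show "emeasure lborel A + emeasure lborel B \<le> 2 * emeasure lborel D + ennreal e"
    using half[of A "-b"] half[of B "-a"] by (simp add: A'_def B'_def distrib_left)
qed

text \<open>Reduced to the bounded case by intersecting with growing intervals. D is any Borel set
  containing the midpoints, since the Minkowski sum of Borel sets need not be Borel.\<close>

lemma brunn_minkowski_real:
  fixes A B D :: "real set"
  assumes [measurable]: "A \<in> sets borel" "B \<in> sets borel" "D \<in> sets borel"
    and ne: "A \<noteq> {}" "B \<noteq> {}"
    and mid: "\<And>x y. x \<in> A \<Longrightarrow> y \<in> B \<Longrightarrow> (x + y) / 2 \<in> D"
  shows "emeasure lborel A + emeasure lborel B \<le> 2 * emeasure lborel D"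
proof -
  obtain a b where ab: "a \<in> A" "b \<in> B" using ne by auto
  \<comment> \<open>Every window contains the fixed points a and b, so the truncated sets are
    nonempty from \<open>n = 0\<close> on.\<close>
  define I where "I n = {- real n - \<bar>a\<bar> - \<bar>b\<bar> .. real n + \<bar>a\<bar> + \<bar>b\<bar>}" for n :: nat
  have lim: "(\<lambda>n. emeasure lborel (S \<inter> I n)) \<longlonglongrightarrow> emeasure lborel S"
    if [measurable]: "S \<in> sets borel" for S
  proof -
    have "(\<Union>n. S \<inter> I n) = S"
    proof safe
      fix x assume "x \<in> S"
      obtain n :: nat where "\<bar>x\<bar> \<le> real n" using real_arch_simple by blast
      then show "x \<in> (\<Union>n. S \<inter> I n)" using \<open>x \<in> S\<close> by (auto simp: I_def intro!: exI[of _ n])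
    qed
    moreover have "(\<lambda>n. emeasure lborel (S \<inter> I n)) \<longlonglongrightarrow> emeasure lborel (\<Union>n. S \<inter> I n)"
      by (rule Lim_emeasure_incseq) (auto simp: I_def incseq_def)
    ultimately show ?thesis by simp
  qed
  have "emeasure lborel (A \<inter> I n) + emeasure lborel (B \<inter> I n) \<le> 2 * emeasure lborel D" for n
  proof (rule brunn_minkowski_real_bounded)
    have "a \<in> I n" "b \<in> I n" by (auto simp: I_def)
    then show "A \<inter> I n \<noteq> {}" "B \<inter> I n \<noteq> {}" using ab by auto
  qed (use mid in \<open>auto simp: I_def\<close>)
  moreover have "(\<lambda>n. emeasure lborel (A \<inter> I n) + emeasure lborel (B \<inter> I n))
      \<longlonglongrightarrow> emeasure lborel A + emeasure lborel B"
    by (intro tendsto_add lim) auto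
  ultimately show ?thesis
    by (intro LIMSEQ_le_const2) auto
qed

text \<open>The free scale a in the layer-cake formula allows functions with different suprema to be
  compared at the same fraction t of their suprema.\<close>

lemma nn_integral_layer_cake:
  fixes f :: "real \<Rightarrow> ennreal" and a :: real
  assumes [measurable]: "f \<in> borel_measurable borel" and a: "a > 0"
  shows "(\<integral>\<^sup>+x. f x \<partial>lborel)
    = ennreal a * (\<integral>\<^sup>+t. indicator {0<..} t * emeasure lborel {x. ennreal (a * t) < f x} \<partial>lborel)"
proof -
  have lev: "ennreal a * (\<integral>\<^sup>+t. indicator {t. 0 < t \<and> ennreal (a * t) < y} t \<partial>lborel) = y" for y :: ennreal
  proof (cases y)
    case (real r)
    have eq: "{t. 0 < t \<and> ennreal (a * t) < y} = {0<..<r/a}"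
      using a real by (auto simp: ennreal_less_iff field_simps)
    show ?thesis
      using a real unfolding eq by (simp flip: ennreal_mult')
  next
    case top
    have eq: "{t. 0 < t \<and> ennreal (a * t) < y} = {0<..}"
      using a top by (auto)
    have "emeasure lborel {0::real<..} = \<infinity>"
    proof (rule ccontr)
      assume "emeasure lborel {0::real<..} \<noteq> \<infinity>"
      then obtain r where r: "emeasure lborel {0::real<..} = ennreal r" "r \<ge> 0"
        by (cases "emeasure lborel {0::real<..}") auto
      have "emeasure lborel {0::real<..r+1} \<le> emeasure lborel {0::real<..}"
        by (rule emeasure_mono) auto
      then show False using r by (simp del: ennreal_plus)
    qed
    then show ?thesis using a top unfolding eq by (simp add: ennreal_mult_top)
  qed
  have [measurable]: "Measurable.pred (borel \<Otimes>\<^sub>M borel) (\<lambda>p. 0 < snd p \<and> ennreal (a * snd p) < f (fst p))"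
    by measurable
  have "(\<integral>\<^sup>+x. f x \<partial>lborel) = (\<integral>\<^sup>+x. ennreal a * (\<integral>\<^sup>+t. indicator {t. 0 < t \<and> ennreal (a * t) < f x} t \<partial>lborel) \<partial>lborel)"
    by (simp only: lev)
  also have "\<dots> = (\<integral>\<^sup>+x. ennreal a * (\<integral>\<^sup>+t. indicator {p. 0 < snd p \<and> ennreal (a * snd p) < f (fst p)} (x, t) \<partial>lborel) \<partial>lborel)"
    by (simp add: indicator_def)
  also have "\<dots> = ennreal a * (\<integral>\<^sup>+x. \<integral>\<^sup>+t. indicator {p. 0 < snd p \<and> ennreal (a * snd p) < f (fst p)} (x, t) \<partial>lborel \<partial>lborel)"
    by (rule nn_integral_cmult) measurable
  also have "\<dots> = ennreal a * (\<integral>\<^sup>+t. \<integral>\<^sup>+x. indicator {p. 0 < snd p \<and> ennreal (a * snd p) < f (fst p)} (x, t) \<partial>lborel \<partial>lborel)"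
    by (subst lborel_pair.Fubini') auto
  also have "(\<integral>\<^sup>+t. \<integral>\<^sup>+x. indicator {p. 0 < snd p \<and> ennreal (a * snd p) < f (fst p)} (x, t) \<partial>lborel \<partial>lborel)
     = (\<integral>\<^sup>+t. indicator {0<..} t * emeasure lborel {x. ennreal (a * t) < f x} \<partial>lborel)"
    apply (intro nn_integral_cong)
    apply (subst nn_integral_indicator[symmetric])
     apply measurable
    apply (subst nn_integral_cmult[symmetric])
     apply measurable
    apply (intro nn_integral_cong)
    apply (auto simp: indicator_def)
    done
  finally show ?thesis .
qed

text \<open>Brunn-Minkowski on the line needs nonempty sets. With levels measured as fractions t of
  the suprema a and b, the superlevel sets of f and g are both nonempty for \<open>0 < t < 1\<close>
  and both empty for \<open>t \<ge> 1\<close>, so the set inequality can be integrated over all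
  t.\<close>

lemma prekopa_leindler_real_bounded:
  fixes f g h :: "real \<Rightarrow> ennreal" and N :: real
  assumes [measurable]: "f \<in> borel_measurable borel" "g \<in> borel_measurable borel" "h \<in> borel_measurable borel"
    and bdd: "\<And>x. f x \<le> ennreal N" "\<And>x. g x \<le> ennreal N"
    and mid: "\<And>x y. f x * g y \<le> (h ((x + y) / 2))\<^sup>2"
  shows "(\<integral>\<^sup>+x. f x \<partial>lborel) * (\<integral>\<^sup>+x. g x \<partial>lborel) \<le> (\<integral>\<^sup>+x. h x \<partial>lborel)\<^sup>2"
proof -
  let ?m = "\<lambda>u k t. emeasure lborel {x. ennreal (k * t) < (u x :: ennreal)}"
  have sup: "\<exists>a. (SUP x. u x) = ennreal a \<and> a \<ge> 0" if "\<And>x. u x \<le> ennreal N" for u :: "real \<Rightarrow> ennreal"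
  proof -
    have "(SUP x. u x) \<le> ennreal N" using that by (simp add: SUP_le_iff)
    then have "(SUP x. u x) < top" by (rule le_less_trans) simp
    then show ?thesis by (cases "SUP x. u x") auto
  qed
  obtain a where a: "(SUP x. f x) = ennreal a" "a \<ge> 0" using sup[of f, OF bdd(1)] by auto
  obtain b where b: "(SUP x. g x) = ennreal b" "b \<ge> 0" using sup[of g, OF bdd(2)] by auto
  have fa: "f x \<le> ennreal a" for x using a(1) by (metis SUP_upper UNIV_I)
  have gb: "g x \<le> ennreal b" for x using b(1) by (metis SUP_upper UNIV_I)
  show ?thesis
  proof (cases "a = 0 \<or> b = 0")
    case True
    then have "(\<forall>x. f x = 0) \<or> (\<forall>x. g x = 0)" using fa gb by force
    then show ?thesis by auto
  next
    case False
    with a b have pos: "a > 0" "b > 0" by auto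
    \<comment> \<open>The geometric mean is the matching scale for h: \<open>f x > a t\<close> and
      \<open>g y > b t\<close> force \<open>h > c t\<close> at the midpoint.\<close>
    define c where "c = sqrt (a * b)"
    have c: "c > 0" "c * c = a * b" using pos by (auto simp: c_def)
    define F where "F = (\<integral>\<^sup>+t. indicator {0<..} t * ?m f a t \<partial>lborel)"
    define G where "G = (\<integral>\<^sup>+t. indicator {0<..} t * ?m g b t \<partial>lborel)"
    define H where "H = (\<integral>\<^sup>+t. indicator {0<..} t * ?m h c t \<partial>lborel)"
    have FGH: "(\<integral>\<^sup>+x. f x \<partial>lborel) = ennreal a * F" "(\<integral>\<^sup>+x. g x \<partial>lborel) = ennreal b * G"
       "(\<integral>\<^sup>+x. h x \<partial>lborel) = ennreal c * H"
      unfolding F_def G_def H_def using pos c by (auto intro!: nn_integral_layer_cake)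
    have lv: "indicator {0<..} t * ?m f a t +
        indicator {0<..} t * ?m g b t
        \<le> 2 * (indicator {0<..} t * ?m h c t)" for t :: real
    proof (cases "0 < t \<and> t < 1")
      case True
      have 1: "{x. ennreal (a * t) < f x} \<noteq> {}"
        using less_SUP_iff[of "ennreal (a*t)" f UNIV] a pos True by (auto simp: ennreal_less_iff)
      have 2: "{x. ennreal (b * t) < g x} \<noteq> {}"
        using less_SUP_iff[of "ennreal (b*t)" g UNIV] b pos True by (auto simp: ennreal_less_iff)
      have "?m f a t + ?m g b t
        \<le> 2 * ?m h c t"
      proof (rule brunn_minkowski_real[OF _ _ _ 1 2])
        fix x y assume x: "x \<in> {x. ennreal (a * t) < f x}" and y: "y \<in> {x. ennreal (b * t) < g x}"
        obtain p where p: "f x = ennreal p" "p \<ge> 0" using fa[of x] by (cases "f x") (auto simp: top_unique)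
        obtain q where q: "g y = ennreal q" "q \<ge> 0" using gb[of y] by (cases "g y") (auto simp: top_unique)
        have "a * t < p" "b * t < q" using x y p q pos True by (auto simp: ennreal_less_iff)
        then have "(a * t) * (b * t) < p * q" using pos True by (intro mult_strict_mono') auto
        then have "ennreal (a * t) * ennreal (b * t) < f x * g y"
          using p q pos True by (simp add: ennreal_less_iff flip: ennreal_mult')
        also have "\<dots> \<le> (h ((x + y) / 2))\<^sup>2" by (rule mid)
        finally have "ennreal ((a * t) * (b * t)) < (h ((x + y) / 2))\<^sup>2"
          using True pos by (simp add: ennreal_mult')
        moreover have "(a * t) * (b * t) = (c * t) * (c * t)" using c(2) by (simp add: algebra_simps)
        ultimately have "(ennreal (c * t))\<^sup>2 < (h ((x + y) / 2))\<^sup>2"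
          using True c(1) by (simp add: power2_eq_square flip: ennreal_mult')
        then show "(x + y) / 2 \<in> {x. ennreal (c * t) < h x}"
          by (metis mem_Collect_eq not_less power_mono zero_le)
      qed measurable
      then show ?thesis using True by simp
    next
      case F: False
      show ?thesis
      proof (cases "t > 0")
        case True
        with F have t: "t \<ge> 1" by auto
        have "{x. ennreal (a * t) < f x} = {}" 
        proof -
          have "f x \<le> ennreal (a * t)" for x
            by (rule order_trans[OF fa]) (use t pos in \<open>auto intro!: ennreal_leI\<close>)
          then show ?thesis by (auto simp: not_less)
        qed
        moreover have "{x. ennreal (b * t) < g x} = {}" 
        proof -
          have "g x \<le> ennreal (b * t)" for x
            by (rule order_trans[OF gb]) (use t pos in \<open>auto intro!: ennreal_leI\<close>)
          then show ?thesis by (auto simp: not_less)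
        qed
        ultimately show ?thesis by simp
      qed simp
    qed
    have [measurable]: "(\<lambda>t. ?m u k t) \<in> borel_measurable borel"
      if [measurable]: "u \<in> borel_measurable borel" for u :: "real \<Rightarrow> ennreal" and k :: real
    proof -
      have [measurable]: "Measurable.pred (borel \<Otimes>\<^sub>M borel) (\<lambda>p::real\<times>real. ennreal (k * fst p) < u (snd p))"
        by measurable
      have "(\<lambda>t. ?m u k t)
         = (\<lambda>t. \<integral>\<^sup>+x. indicator {p::real\<times>real. ennreal (k * fst p) < u (snd p)} (t, x) \<partial>lborel)"
      proof
        fix t
        have "?m u k t = (\<integral>\<^sup>+x. indicator {x. ennreal (k * t) < u x} x \<partial>lborel)"
          by (subst nn_integral_indicator) measurable
        then show "?m u k t = (\<integral>\<^sup>+x. indicator {p::real\<times>real. ennreal (k * fst p) < u (snd p)} (t, x) \<partial>lborel)"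
          by (simp add: indicator_def)
      qed
      also have "\<dots> \<in> borel_measurable borel" by measurable
      finally show ?thesis .
    qed
    have "F + G \<le> 2 * H"
      unfolding F_def G_def H_def
      apply (subst nn_integral_add[symmetric])
        apply measurable
      apply (subst nn_integral_cmult[symmetric])
       apply measurable
      apply (intro nn_integral_mono lv)
      done
    \<comment> \<open>The additive bound becomes multiplicative by the inequality of arithmetic and
      geometric means; the scales then recombine through \<open>c * c = a * b\<close>.\<close>
    have "F * G \<le> H\<^sup>2"
    proof (cases "H = top")
      case True then show ?thesis by (simp add: power2_eq_square ennreal_top_mult)
    next
      case False
      then obtain h' where h': "H = ennreal h'" "h' \<ge> 0" by (cases H) auto
      have "2 * H < top" using h' by (simp add: ennreal_mult_less_top)
      with \<open>F + G \<le> 2 * H\<close> have "F + G < top" by (rule le_less_trans)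
      then obtain f' g' where fg: "F = ennreal f'" "G = ennreal g'" "f' \<ge> 0" "g' \<ge> 0"
        by (cases F; cases G) auto
      have "f' + g' \<le> 2 * h'"
        using \<open>F + G \<le> 2 * H\<close> fg h' 
        by (simp flip: ennreal_plus ennreal_mult' ennreal_numeral)
      then have "(f' + g')\<^sup>2 \<le> (2 * h')\<^sup>2" using fg by (intro power_mono) auto
      moreover have "0 \<le> (f' - g')\<^sup>2" by simp
      ultimately have "f' * g' \<le> h'\<^sup>2" by (simp add: power2_eq_square algebra_simps)
      then show ?thesis using fg h' by (simp add: power2_eq_square flip: ennreal_mult')
    qed
    then have "ennreal (a * b) * (F * G) \<le> ennreal (c * c) * H\<^sup>2"
      using c by (intro mult_mono) auto
    moreover have "ennreal (a * b) = ennreal a * ennreal b" "ennreal (c * c) = ennreal c * ennreal c"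
      using pos c(1) by (simp_all add: ennreal_mult')
    ultimately show ?thesis unfolding FGH
      by (simp only: power2_eq_square mult_ac)
  qed
qed

text \<open>Cutting f and g off at height n only lowers the left side of the midpoint hypothesis, so
  the bounded case applies to the truncations, with h unchanged.\<close>

lemma prekopa_leindler_real:
  fixes f g h :: "real \<Rightarrow> ennreal"
  assumes [measurable]: "f \<in> borel_measurable borel" "g \<in> borel_measurable borel" "h \<in> borel_measurable borel"
    and mid: "\<And>x y. f x * g y \<le> (h ((x + y) / 2))\<^sup>2"
  shows "(\<integral>\<^sup>+x. f x \<partial>lborel) * (\<integral>\<^sup>+x. g x \<partial>lborel) \<le> (\<integral>\<^sup>+x. h x \<partial>lborel)\<^sup>2"
proof -
  have sup: "(SUP n. min y (ennreal (real n))) = y" for y :: ennreal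
  proof -
    have "(SUP n. min y (ennreal (real n))) = min y (SUP n. ennreal (real n))"
      by (simp add: inf_min[symmetric] inf_SUP)
    then show ?thesis by (simp add: ennreal_SUP_of_nat_eq_top ennreal_of_nat_eq_real_of_nat[symmetric])
  qed
  have lim: "(\<lambda>n. \<integral>\<^sup>+x. min (u x) (ennreal (real n)) \<partial>lborel) \<longlonglongrightarrow> (\<integral>\<^sup>+x. u x \<partial>lborel)"
    if [measurable]: "u \<in> borel_measurable borel" for u :: "real \<Rightarrow> ennreal"
  proof -
    have mm: "min y (ennreal (real m)) \<le> min y (ennreal (real n))" if "m \<le> n" for y m n
      using that by (intro min.mono ennreal_leI) auto
    then have inc: "incseq (\<lambda>n x. min (u x) (ennreal (real n)))"
      by (auto simp: incseq_def le_fun_def)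
    have "(\<integral>\<^sup>+x. u x \<partial>lborel) = (\<integral>\<^sup>+x. (SUP n. min (u x) (ennreal (real n))) \<partial>lborel)"
      by (simp only: sup)
    also have "\<dots> = (SUP n. \<integral>\<^sup>+x. min (u x) (ennreal (real n)) \<partial>lborel)"
      by (rule nn_integral_monotone_convergence_SUP[OF inc]) measurable
    finally show ?thesis
      using mm by (auto simp only: intro!: LIMSEQ_SUP incseq_SucI nn_integral_mono)
  qed
  show ?thesis
  \<comment> \<open>The product of extended reals is discontinuous at zero times infinity, so a
    vanishing integral is separated from the limit argument.\<close>
  proof (cases "(\<integral>\<^sup>+x. f x \<partial>lborel) = 0 \<or> (\<integral>\<^sup>+x. g x \<partial>lborel) = 0")
    case True
    then show ?thesis by auto
  next
    case False
    have "(\<lambda>n. (\<integral>\<^sup>+x. min (f x) (ennreal (real n)) \<partial>lborel) * (\<integral>\<^sup>+x. min (g x) (ennreal (real n)) \<partial>lborel))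
       \<longlonglongrightarrow> (\<integral>\<^sup>+x. f x \<partial>lborel) * (\<integral>\<^sup>+x. g x \<partial>lborel)"
      using False by (intro tendsto_mult_ennreal lim) auto
    moreover have "(\<integral>\<^sup>+x. min (f x) (ennreal (real n)) \<partial>lborel) * (\<integral>\<^sup>+x. min (g x) (ennreal (real n)) \<partial>lborel)
        \<le> (\<integral>\<^sup>+x. h x \<partial>lborel)\<^sup>2" for n
    proof (rule prekopa_leindler_real_bounded[where N="real n"])
      fix x y
      show "min (f x) (ennreal (real n)) * min (g y) (ennreal (real n)) \<le> (h ((x + y) / 2))\<^sup>2"
        by (rule order_trans[OF mult_mono mid]) auto
    qed auto
    ultimately show ?thesis by (intro LIMSEQ_le_const2) auto
  qed
qed

text \<open>Induction on the coordinates. For two fixed values of the new coordinate, the slices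
  inherit the midpoint hypothesis; by induction their integrals then satisfy the one-dimensional
  hypothesis.\<close>

lemma prekopa_leindler_PiM:
  fixes f g h :: "('i \<Rightarrow> real) \<Rightarrow> ennreal"
  assumes "finite I"
    and "f \<in> borel_measurable (\<Pi>\<^sub>M i\<in>I. lborel)" "g \<in> borel_measurable (\<Pi>\<^sub>M i\<in>I. lborel)"
      "h \<in> borel_measurable (\<Pi>\<^sub>M i\<in>I. lborel)"
    and "\<And>x y. x \<in> extensional I \<Longrightarrow> y \<in> extensional I \<Longrightarrow> 
           f x * g y \<le> (h (\<lambda>i\<in>I. (x i + y i) / 2))\<^sup>2"
  shows "(\<integral>\<^sup>+x. f x \<partial>(\<Pi>\<^sub>M i\<in>I. lborel)) * (\<integral>\<^sup>+x. g x \<partial>(\<Pi>\<^sub>M i\<in>I. lborel))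
    \<le> (\<integral>\<^sup>+x. h x \<partial>(\<Pi>\<^sub>M i\<in>I. lborel))\<^sup>2"
  using assms
proof (induction I arbitrary: f g h rule: finite_induct)
  case empty
  interpret product_sigma_finite "\<lambda>i::'i. lborel :: real measure" by standard
  have "(\<lambda>i\<in>{}. (undefined + undefined) / 2) = (\<lambda>k::'i. undefined :: real)" by auto
  then show ?case
    using empty(4)[of "\<lambda>k. undefined" "\<lambda>k. undefined"] by (simp add: nn_integral_empty)
next
  case (insert i I)
  interpret product_sigma_finite "\<lambda>i::'i. lborel :: real measure" by standard
  note [measurable] = insert.prems(1-3)
  have upd: "(\<lambda>(x, y). u (x(i := y))) \<in> borel_measurable ((\<Pi>\<^sub>M i\<in>I. lborel) \<Otimes>\<^sub>M lborel)"
    if "u \<in> borel_measurable (\<Pi>\<^sub>M i\<in>insert i I. lborel)" for u :: "('i \<Rightarrow> real) \<Rightarrow> ennreal"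
    using measurable_comp[OF measurable_add_dim that] by (simp add: comp_def case_prod_unfold)
  have [measurable]: "(\<lambda>y. \<integral>\<^sup>+x. u (x(i := y)) \<partial>(\<Pi>\<^sub>M i\<in>I. lborel)) \<in> borel_measurable borel"
    if "u \<in> borel_measurable (\<Pi>\<^sub>M i\<in>insert i I. lborel)" for u :: "('i \<Rightarrow> real) \<Rightarrow> ennreal"
  proof -
    have "(\<lambda>(y, x). u (x(i := y))) \<in> borel_measurable (lborel \<Otimes>\<^sub>M (\<Pi>\<^sub>M i\<in>I. lborel))"
      using measurable_comp[OF measurable_pair_swap' upd[OF that]] by (simp add: comp_def case_prod_unfold)
    from sigma_finite_measure.borel_measurable_nn_integral_fst[OF sigma_finite[OF \<open>finite I\<close>] this] show ?thesis by simp
  qed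
  have slice: "(\<lambda>x. u (x(i := y))) \<in> borel_measurable (\<Pi>\<^sub>M i\<in>I. lborel)"
    if "u \<in> borel_measurable (\<Pi>\<^sub>M i\<in>insert i I. lborel)" for u :: "('i \<Rightarrow> real) \<Rightarrow> ennreal" and y
    using measurable_Pair2'[of y lborel] measurable_compose[OF measurable_Pair1' upd[OF that]] 
    using measurable_compose[of "\<lambda>x. (x, y)" "\<Pi>\<^sub>M i\<in>I. lborel" "(\<Pi>\<^sub>M i\<in>I. lborel) \<Otimes>\<^sub>M lborel" _ borel, OF _ upd[OF that]]
    by simp
  show ?case
    unfolding product_nn_integral_insert_rev[OF insert(1,2) insert.prems(1)]
      product_nn_integral_insert_rev[OF insert(1,2) insert.prems(2)]
      product_nn_integral_insert_rev[OF insert(1,2) insert.prems(3)]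
  proof (rule prekopa_leindler_real)
    fix s t :: real
    show "(\<integral>\<^sup>+x. f (x(i := s)) \<partial>(\<Pi>\<^sub>M i\<in>I. lborel)) * (\<integral>\<^sup>+x. g (x(i := t)) \<partial>(\<Pi>\<^sub>M i\<in>I. lborel))
       \<le> (\<integral>\<^sup>+x. h (x(i := (s + t) / 2)) \<partial>(\<Pi>\<^sub>M i\<in>I. lborel))\<^sup>2"
    proof (rule insert.IH)
      fix x y :: "'i \<Rightarrow> real" assume xy: "x \<in> extensional I" "y \<in> extensional I"
      have "(\<lambda>j\<in>insert i I. ((x(i := s)) j + (y(i := t)) j) / 2) = (\<lambda>j\<in>I. (x j + y j) / 2)(i := (s + t) / 2)"
        using \<open>i \<notin> I\<close> by (auto simp: fun_eq_iff)
      then show "f (x(i := s)) * g (y(i := t)) \<le> (h ((\<lambda>j\<in>I. (x j + y j) / 2)(i := (s + t) / 2)))\<^sup>2"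
        using insert.prems(4)[of "x(i := s)" "y(i := t)"] xy by (simp add: extensional_def del: fun_upd_apply) (simp add: fun_upd_def)
    qed (intro slice; fact)+
  qed (use insert.prems in measurable)
qed

theorem prekopa_leindler:
  fixes f g h :: "'a::euclidean_space \<Rightarrow> ennreal"
  assumes [measurable]: "f \<in> borel_measurable borel" "g \<in> borel_measurable borel" "h \<in> borel_measurable borel"
    and mid: "\<And>x y. f x * g y \<le> (h ((1/2) *\<^sub>R (x + y)))\<^sup>2"
  shows "(\<integral>\<^sup>+x. f x \<partial>lborel) * (\<integral>\<^sup>+x. g x \<partial>lborel) \<le> (\<integral>\<^sup>+x. h x \<partial>lborel)\<^sup>2"
proof -
  let ?T = "\<lambda>x::'a\<Rightarrow>real. \<Sum>b\<in>Basis. x b *\<^sub>R b"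
  have [measurable]: "?T \<in> borel_measurable (\<Pi>\<^sub>M b\<in>Basis. lborel)"
    by measurable
  have eq: "(\<integral>\<^sup>+x. u x \<partial>lborel) = (\<integral>\<^sup>+x. u (?T x) \<partial>(\<Pi>\<^sub>M b\<in>Basis. lborel))"
    if [measurable]: "u \<in> borel_measurable borel" for u :: "'a \<Rightarrow> ennreal"
    by (subst lborel_eq, subst nn_integral_distr) auto
  show ?thesis
    unfolding eq[OF assms(1)] eq[OF assms(2)] eq[OF assms(3)]
  proof (rule prekopa_leindler_PiM)
    fix x y :: "'a \<Rightarrow> real"
    have "?T (\<lambda>i\<in>Basis. (x i + y i) / 2) = (1/2) *\<^sub>R (?T x + ?T y)"
      by (simp add: sum.distrib[symmetric] scaleR_sum_right scaleR_add_left[symmetric] add_divide_distrib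
        del: scaleR_add_left)
    then show "f (?T x) * g (?T y) \<le> (h (?T (\<lambda>i\<in>Basis. (x i + y i) / 2)))\<^sup>2"
      using mid[of "?T x" "?T y"] by simp
  qed auto
qed

section \<open>Linearization on the cone\<close>

text \<open>The Lagrange remainder of order four carries an even power of u, so the bound holds for
  either sign of u.\<close>

lemma exp_ge_cubic: "1 + u + u\<^sup>2 / 2 + u ^ 3 / 6 \<le> exp (u :: real)"
proof -
  obtain t where t: "exp u = (\<Sum>m<4. u ^ m / fact m) + exp t / fact 4 * u ^ 4"
    using Maclaurin_exp_le[of u 4] by blast
  have "0 \<le> exp t / fact 4 * u ^ 4" by simp
  then show ?thesis
    unfolding t by (simp add: eval_nat_numeral lessThan_Suc algebra_simps)
qed

text \<open>Put \<open>u = s f - s^2 r\<close>, so \<open>|u| \<le> 2 B s\<close>. In units of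
  \<open>s^3 B^3\<close>, the cubic term costs at most \<open>8/6\<close> and the mixed term of
  \<open>u^2 / 2\<close> at most 1; the constant 3 covers both.\<close>

lemma exp_second_order_lower:
  fixes f r B s :: real
  assumes "\<bar>f\<bar> \<le> B" "\<bar>r\<bar> \<le> B" "1 \<le> B" "0 < s" "s \<le> 1"
  shows "1 + s * f - s\<^sup>2 * r + s\<^sup>2 * f\<^sup>2 / 2 - s ^ 3 * (3 * B ^ 3) \<le> exp (s * f - s\<^sup>2 * r)"
proof -
  define u where "u = s * f - s\<^sup>2 * r"
  have s2: "s\<^sup>2 \<le> s" using assms by (simp add: power2_eq_square mult_left_le)
  have "\<bar>u\<bar> \<le> \<bar>s * f\<bar> + \<bar>s\<^sup>2 * r\<bar>" unfolding u_def by (rule abs_triangle_ineq4)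
  also have "\<dots> \<le> s * B + s * B"
    using assms s2 unfolding abs_mult by (intro add_mono mult_mono) auto
  finally have "\<bar>u\<bar> \<le> 2 * B * s" by simp
  then have "\<bar>u\<bar> ^ 3 \<le> (2 * B * s) ^ 3" by (intro power_mono) auto
  then have u3: "- (8 * B ^ 3 * s ^ 3) \<le> u ^ 3"
    by (auto simp: power_mult_distrib power_abs[symmetric] abs_le_iff)
  have "s ^ 3 * (f * r) \<le> s ^ 3 * B\<^sup>2"
  proof -
    have "f * r \<le> \<bar>f\<bar> * \<bar>r\<bar>" by (metis abs_ge_self abs_mult)
    also have "\<dots> \<le> B * B" using assms by (intro mult_mono) auto
    finally show ?thesis using assms by (intro mult_left_mono) (auto simp: power2_eq_square)
  qed
  moreover have "B\<^sup>2 \<le> B ^ 3" using assms by (intro power_increasing) auto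
  then have "s ^ 3 * B\<^sup>2 \<le> s ^ 3 * B ^ 3" using assms by (intro mult_left_mono) auto
  moreover have "0 \<le> (s\<^sup>2 * r)\<^sup>2" by simp
  moreover have "u\<^sup>2 = s\<^sup>2 * f\<^sup>2 - 2 * (s ^ 3 * (f * r)) + (s\<^sup>2 * r)\<^sup>2"
    unfolding u_def by (simp add: power2_eq_square power3_eq_cube algebra_simps)
  ultimately have "s\<^sup>2 * f\<^sup>2 - 2 * (s ^ 3 * B ^ 3) \<le> u\<^sup>2" by linarith
  moreover have "1 + u + u\<^sup>2 / 2 + u ^ 3 / 6 \<le> exp u" by (rule exp_ge_cubic)
  moreover have "0 \<le> s ^ 3 * B ^ 3" using assms by simp
  moreover have "1 + s * f - s\<^sup>2 * r = 1 + u" by (simp add: u_def)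
  ultimately show ?thesis using u3 unfolding u_def[symmetric]
    by (simp add: mult.commute mult.left_commute)
qed

text \<open>Because f has mean zero, each factor is at least
  \<open>m + s^2 (E f^2 / 2 - E r) - O(s^3)\<close>, where m is the total mass and E the integral.
  Were the bracket positive, both factors would exceed m for small s. Only a lower bound of the
  exponential is used, so no integral has to be differentiated.\<close>

lemma second_moment_le_of_midpoint:
  fixes f r :: "'b \<Rightarrow> real"
  assumes "finite_measure M" and [measurable]: "f \<in> borel_measurable M" "r \<in> borel_measurable M"
    and bdd: "AE x in M. \<bar>f x\<bar> \<le> B" "AE x in M. \<bar>r x\<bar> \<le> B"
    and "s0 > 0"
    and mid: "\<And>s. 0 < s \<Longrightarrow> s < s0 \<Longrightarrow>
      (\<integral>x. exp (- s * f x - s\<^sup>2 * r x) \<partial>M) * (\<integral>x. exp (s * f x - s\<^sup>2 * r x) \<partial>M) \<le> (measure M (space M))\<^sup>2"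
    and mean: "(\<integral>x. f x \<partial>M) = 0"
  shows "(\<integral>x. (f x)\<^sup>2 \<partial>M) \<le> 2 * (\<integral>x. r x \<partial>M)"
proof (rule ccontr)
  interpret finite_measure M by fact
  define A where "A = max B 1"
  have A: "AE x in M. \<bar>f x\<bar> \<le> A" "AE x in M. \<bar>r x\<bar> \<le> A" "1 \<le> A"
    using bdd by (auto simp: A_def elim: eventually_mono)
  have int[simp]: "integrable M f" "integrable M r"
    using A by (auto intro: integrable_const_bound[where B=A])
  have intf2[simp]: "integrable M (\<lambda>x. (f x)\<^sup>2)"
    using A(1,3) by (auto intro!: integrable_const_bound[where B="A\<^sup>2"] power_mono
       elim!: eventually_mono simp flip: abs_le_square_iff)
  define m where "m = measure M (space M)"
  define \<delta> where "\<delta> = (\<integral>x. (f x)\<^sup>2 \<partial>M) / 2 - (\<integral>x. r x \<partial>M)"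
  assume "\<not> ?thesis"
  then have \<delta>: "\<delta> > 0" by (simp add: \<delta>_def)
  define k where "k = 3 * A ^ 3 * m"
  have k: "k \<ge> 0" using A by (simp add: k_def m_def)
  \<comment> \<open>The last argument makes \<open>s * k < \<delta>\<close>, so that the quadratic
    gain \<open>s^2 \<delta>\<close> beats the cubic error \<open>s^3 k\<close>.\<close>
  define s where "s = min (min 1 (s0/2)) (\<delta> / (2 * (k + 1)))"
  have s: "0 < s" "s \<le> 1" "s < s0" using \<delta> k \<open>s0 > 0\<close> by (auto simp: s_def)
  have "s \<le> \<delta> / (2 * (k + 1))" by (simp add: s_def)
  then have "s * (2 * (k + 1)) \<le> \<delta>" using k by (simp add: pos_le_divide_eq)
  then have sk: "s * k < \<delta>" using s k \<delta> by (simp add: algebra_simps)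
  \<comment> \<open>Stated for a function g with the same square as f, because it is applied to both
    f and \<open>- f\<close>.\<close>
  have low: "m < (\<integral>x. exp (s * g x - s\<^sup>2 * r x) \<partial>M)"
    if g[measurable]: "g \<in> borel_measurable M" and gA: "AE x in M. \<bar>g x\<bar> \<le> A" and gm: "(\<integral>x. g x \<partial>M) = 0"
      and g2: "\<And>x. (g x)\<^sup>2 = (f x)\<^sup>2" for g
  proof -
    have [simp]: "integrable M g" using gA by (auto intro: integrable_const_bound[where B=A])
    have "m < m + s\<^sup>2 * \<delta> - s ^ 3 * k"
      using s sk by (simp add: power2_eq_square power3_eq_cube)
    also have "\<dots> = (\<integral>x. 1 + s * g x - s\<^sup>2 * r x + s\<^sup>2 * (f x)\<^sup>2 / 2 - s ^ 3 * (3 * A ^ 3) \<partial>M)"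
      using gm by (simp add: \<delta>_def k_def m_def algebra_simps)
    also have "\<dots> \<le> (\<integral>x. exp (s * g x - s\<^sup>2 * r x) \<partial>M)"
    proof (rule integral_mono_AE)
      show "integrable M (\<lambda>x. exp (s * g x - s\<^sup>2 * r x))"
      proof (rule integrable_const_bound[where B="exp (2 * A)"])
        show "AE x in M. norm (exp (s * g x - s\<^sup>2 * r x)) \<le> exp (2 * A)"
          using gA A(2)
        proof eventually_elim
          case (elim x)
          have "s * g x \<le> s * A" "s * A \<le> 1 * A" using elim s A(3) by (auto intro!: mult_left_mono mult_right_mono)
          moreover have "s\<^sup>2 * (- r x) \<le> s\<^sup>2 * A" using elim by (intro mult_left_mono) auto
          moreover have "s\<^sup>2 * A \<le> 1 * A" using s A(3) by (intro mult_right_mono) (auto intro: power_le_one)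
          ultimately show ?case by simp
        qed
      qed measurable
      show "AE x in M. 1 + s * g x - s\<^sup>2 * r x + s\<^sup>2 * (f x)\<^sup>2 / 2 - s ^ 3 * (3 * A ^ 3) \<le> exp (s * g x - s\<^sup>2 * r x)"
        using gA A(2)
      proof eventually_elim
        case (elim x)
        then show ?case using exp_second_order_lower[of "g x" A "r x" s] A(3) s g2 by simp
      qed
    qed simp
    finally show ?thesis .
  qed
  have "m * m < (\<integral>x. exp (s * - f x - s\<^sup>2 * r x) \<partial>M) * (\<integral>x. exp (s * f x - s\<^sup>2 * r x) \<partial>M)"
    using A mean by (intro mult_strict_mono' low) (auto simp: m_def)
  then show False using mid[OF s(1,3)] by (simp add: m_def power2_eq_square)
qed

section \<open>Strong convexity and the Prekopa-Leindler inequality on the cone\<close>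

lemma powr_midpoint:
  fixes t t' \<alpha> :: real
  assumes "0 < t" "0 < t'" "0 \<le> \<alpha>"
  shows "t powr \<alpha> * t' powr \<alpha> \<le> (((t + t') / 2) powr \<alpha>)\<^sup>2"
proof -
  have "t * t' \<le> ((t + t') / 2)\<^sup>2"
    using zero_le_power2[of "t - t'"] by (simp add: power2_eq_square field_simps)
  then have "(t * t') powr \<alpha> \<le> (((t + t') / 2)\<^sup>2) powr \<alpha>"
    using assms by (intro powr_mono2) auto
  then show ?thesis
    using assms by (simp add: powr_mult power2_eq_square del: times_divide_eq_left times_divide_eq_right times_divide_times_eq)
qed

text \<open>On a convex set this is convexity of \<phi> minus \<open>C / 2\<close> times the squared
  norm. Being free of derivatives, it restricts to compact subsets and depends only on the values of
  \<phi> there.\<close>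

definition strongly_convex_on :: "'a::real_inner set \<Rightarrow> real \<Rightarrow> ('a \<Rightarrow> real) \<Rightarrow> bool" where
  "strongly_convex_on S C \<phi> \<longleftrightarrow> (\<forall>x\<in>S. \<forall>y\<in>S. \<forall>u\<in>{0..1}.
     \<phi> (u *\<^sub>R x + (1 - u) *\<^sub>R y) + C / 2 * (u * (1 - u)) * (norm (x - y))\<^sup>2 \<le> u * \<phi> x + (1 - u) * \<phi> y)"

text \<open>With \<open>u = t0 / (t0 + t1)\<close>, X is the base point of the midpoint of
  \<open>(t0 x0, t0)\<close> and \<open>(t1 x1, t1)\<close>. Multiplying strong convexity by
  \<open>t0 + t1\<close> turns \<open>u (1 - u)\<close> into the harmonic factor
  \<open>t0 t1 / (t0 + t1)\<close>.\<close>

lemma perspective_midpoint: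
  fixes x0 x1 :: "'a::real_inner"
  assumes sc: "strongly_convex_on S C \<phi>" and "x0 \<in> S" "x1 \<in> S" and t: "0 < t0" "0 < t1"
  defines "X \<equiv> (t0 / (t0 + t1)) *\<^sub>R x0 + (1 - t0 / (t0 + t1)) *\<^sub>R x1"
  shows "(t0 + t1) * \<phi> X + C * (t0 * t1 / (t0 + t1)) * (norm (x0 - x1))\<^sup>2 / 2 \<le> t0 * \<phi> x0 + t1 * \<phi> x1"
proof -
  define u where "u = t0 / (t0 + t1)"
  have u: "u \<in> {0..1}" "(t0 + t1) * u = t0" "(t0 + t1) * (1 - u) = t1" using t by (auto simp: u_def field_simps)
  have "\<phi> X + C / 2 * (u * (1 - u)) * (norm (x0 - x1))\<^sup>2 \<le> u * \<phi> x0 + (1 - u) * \<phi> x1"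
    using sc assms(2,3) u(1) unfolding strongly_convex_on_def X_def u_def[symmetric] by blast
  then have "(t0 + t1) * (\<phi> X + C / 2 * (u * (1 - u)) * (norm (x0 - x1))\<^sup>2) \<le> (t0 + t1) * (u * \<phi> x0 + (1 - u) * \<phi> x1)"
    using t by (intro mult_left_mono) auto
  also have "\<dots> = t0 * \<phi> x0 + t1 * \<phi> x1"
    unfolding distrib_left mult.assoc[symmetric] u ..
  also have "(t0 + t1) * (\<phi> X + C / 2 * (u * (1 - u)) * (norm (x0 - x1))\<^sup>2)
     = (t0 + t1) * \<phi> X + C * (((t0 + t1) * u) * (1 - u)) * (norm (x0 - x1))\<^sup>2 / 2"
    by (simp add: algebra_simps)
  also have "((t0 + t1) * u) * (1 - u) = t0 * t1 / (t0 + t1)"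
    unfolding u(2) using t by (simp add: u_def field_simps)
  finally show ?thesis .
qed

lemma nn_integral_dilate:
  fixes u :: "'a::euclidean_space \<Rightarrow> ennreal"
  assumes [measurable]: "u \<in> borel_measurable borel" and t: "t > 0"
  shows "(\<integral>\<^sup>+y. u ((1/t) *\<^sub>R y) \<partial>lborel) = ennreal (t ^ DIM('a)) * (\<integral>\<^sup>+x. u x \<partial>lborel)"
  using t by (subst lborel_affine[of t 0])
    (simp_all add: nn_integral_density nn_integral_distr nn_integral_cmult)

text \<open>The density in the coordinates \<open>(x, t)\<close> of the log-concave measure
  \<open>t\<^sup>\<alpha> e\<^bsup>- t \<phi>(y/t)\<^esup> dy dt\<close> with \<open>\<alpha> = \<beta> - 1 - n\<close>, truncated to \<open>t \<ge> \<rho>\<close>.\<close>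

definition cone_density :: "'a::euclidean_space set \<Rightarrow> ('a \<Rightarrow> real) \<Rightarrow> real \<Rightarrow> real \<Rightarrow> 'a \<times> real \<Rightarrow> real" where
  "cone_density K \<phi> \<beta> \<rho> = (\<lambda>(x, t). indicator K x * (indicator {\<rho>..} t * indicator {0<..} t) * (t powr (\<beta> - 1) * exp (- (t * \<phi> x))))"

lemma borel_measurable_cone_density[measurable]:
  assumes [measurable]: "K \<in> sets borel" "\<phi> \<in> borel_measurable borel"
  shows "cone_density K \<phi> \<beta> \<rho> \<in> borel_measurable borel"
  unfolding cone_density_def borel_prod[symmetric] by measurable

lemma cone_density_nonneg: "0 \<le> cone_density K \<phi> \<beta> \<rho> p"
  by (auto simp: cone_density_def split: prod.split)

text \<open>In the linear coordinates \<open>(t x, t)\<close> the density is not merely log-concave: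
  strong convexity leaves a spare Gaussian factor in the distance of the base points. The hypothesis
  on \<open>w0\<close> and \<open>w1\<close> says that the weights consume no more than this
  factor.\<close>

lemma cone_prekopa_leindler:
  fixes K :: "'a::euclidean_space set" and w0 w1 :: "'a \<times> real \<Rightarrow> real"
  assumes [measurable]: "K \<in> sets borel" "\<phi> \<in> borel_measurable borel"
      "w0 \<in> borel_measurable borel" "w1 \<in> borel_measurable borel"
    and "convex K" and sc: "strongly_convex_on K C \<phi>"
    and \<beta>: "real DIM('a) + 1 \<le> \<beta>" 
    and nn: "\<And>p. 0 \<le> w0 p" "\<And>p. 0 \<le> w1 p"
    and w: "\<And>x0 t0 x1 t1. x0 \<in> K \<Longrightarrow> x1 \<in> K \<Longrightarrow> \<rho> \<le> t0 \<Longrightarrow> \<rho> \<le> t1 \<Longrightarrow> 0 < t0 \<Longrightarrow> 0 < t1 \<Longrightarrow>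
       w0 (x0, t0) * w1 (x1, t1) \<le> exp (C * (t0 * t1 / (t0 + t1)) * (norm (x0 - x1))\<^sup>2 / 2)"
  shows "(\<integral>\<^sup>+p. ennreal (cone_density K \<phi> \<beta> \<rho> p * w0 p) \<partial>lborel) * (\<integral>\<^sup>+p. ennreal (cone_density K \<phi> \<beta> \<rho> p * w1 p) \<partial>lborel)
     \<le> (\<integral>\<^sup>+p. ennreal (cone_density K \<phi> \<beta> \<rho> p) \<partial>lborel)\<^sup>2"
proof -
  let ?d = "cone_density K \<phi> \<beta> \<rho>"
  define \<alpha> where "\<alpha> = \<beta> - 1 - real DIM('a)"
  have \<alpha>: "\<alpha> \<ge> 0" using \<beta> by (simp add: \<alpha>_def)
  \<comment> \<open>The integrand in the coordinates \<open>y = t x\<close>, in which midpoints are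
    taken. Its power of t is \<alpha> rather than \<open>\<beta> - 1\<close>, the difference being
    the Jacobian \<open>t ^ n\<close> of the dilation.\<close>
  define a where "a w = (\<lambda>(y, t). indicator K ((1/t) *\<^sub>R y) * (indicator {\<rho>..} t * indicator {0<..} t) *
      (t powr \<alpha> * exp (- (t * \<phi> ((1/t) *\<^sub>R y)))) * w ((1/t) *\<^sub>R y, t))" for w :: "'a \<times> real \<Rightarrow> real"
  have am[measurable]: "a w \<in> borel_measurable borel" if "w \<in> borel_measurable borel" for w
  proof -
    have [measurable]: "w \<in> borel_measurable (borel \<Otimes>\<^sub>M borel)" using that by (simp add: borel_prod)
    show ?thesis unfolding a_def borel_prod[symmetric] by measurable
  qed
  have cov: "(\<integral>\<^sup>+p. ennreal (a w p) \<partial>lborel) = (\<integral>\<^sup>+p. ennreal (?d p * w p) \<partial>lborel)"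
    if w_meas: "w \<in> borel_measurable borel" and w0: "\<And>p. 0 \<le> w p" for w
  proof -
    have [measurable]: "w \<in> borel_measurable (borel \<Otimes>\<^sub>M borel)" using w_meas by (simp add: borel_prod)
    have [measurable]: "(\<lambda>p. a w p) \<in> borel_measurable (borel \<Otimes>\<^sub>M borel)" using am[OF that(1)] by (simp add: borel_prod)
    have [measurable]: "?d \<in> borel_measurable (borel \<Otimes>\<^sub>M borel)" by (simp add: borel_prod)
    have "(\<integral>\<^sup>+p. ennreal (a w p) \<partial>lborel) = (\<integral>\<^sup>+t. \<integral>\<^sup>+y. ennreal (a w (y, t)) \<partial>lborel \<partial>lborel)"
      unfolding lborel_prod[symmetric] by (subst lborel_pair.nn_integral_snd) auto
    also have "\<dots> = (\<integral>\<^sup>+t. \<integral>\<^sup>+x. ennreal (?d (x, t) * w (x, t)) \<partial>lborel \<partial>lborel)"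
    proof (rule nn_integral_cong)
      fix t :: real
      show "(\<integral>\<^sup>+y. ennreal (a w (y, t)) \<partial>lborel) = (\<integral>\<^sup>+x. ennreal (?d (x, t) * w (x, t)) \<partial>lborel)"
      proof (cases "0 < t")
        case True
        define v where "v x = ennreal (indicator K x * (indicator {\<rho>..} t * indicator {0<..} t) *
           (t powr \<alpha> * exp (- (t * \<phi> x))) * w (x, t))" for x
        have [measurable]: "v \<in> borel_measurable borel" unfolding v_def by measurable
        have "(\<integral>\<^sup>+y. ennreal (a w (y, t)) \<partial>lborel) = (\<integral>\<^sup>+y. v ((1/t) *\<^sub>R y) \<partial>lborel)"
          by (simp add: a_def v_def)
        also have "\<dots> = ennreal (t ^ DIM('a)) * (\<integral>\<^sup>+x. v x \<partial>lborel)"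
          by (rule nn_integral_dilate) (use True in auto)
        also have "\<dots> = (\<integral>\<^sup>+x. ennreal (t ^ DIM('a)) * v x \<partial>lborel)"
          by (rule nn_integral_cmult[symmetric]) auto
        also have "\<dots> = (\<integral>\<^sup>+x. ennreal (?d (x, t) * w (x, t)) \<partial>lborel)"
        proof (rule nn_integral_cong)
          fix x :: 'a
          have "t ^ DIM('a) * t powr \<alpha> = t powr (\<beta> - 1)"
            using True by (simp add: powr_realpow[symmetric] powr_add[symmetric] \<alpha>_def)
          then have "t ^ DIM('a) * (indicator K x * (indicator {\<rho>..} t * indicator {0<..} t) *
              (t powr \<alpha> * exp (- (t * \<phi> x))) * w (x, t)) = ?d (x, t) * w (x, t)"
            by (auto simp: cone_density_def mult_ac)
          then show "ennreal (t ^ DIM('a)) * v x = ennreal (?d (x, t) * w (x, t))"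
            unfolding v_def using zero_le_power[of t "DIM('a)"] True
            by (subst ennreal_mult'[symmetric]) (auto simp only:)
        qed
        finally show ?thesis .
      qed (simp add: a_def cone_density_def)
    qed
    also have "\<dots> = (\<integral>\<^sup>+p. ennreal (?d p * w p) \<partial>lborel)"
      unfolding lborel_prod[symmetric] by (subst lborel_pair.nn_integral_snd[symmetric]) auto
    finally show ?thesis .
  qed
  have "(\<integral>\<^sup>+p. ennreal (a w0 p) \<partial>lborel) * (\<integral>\<^sup>+p. ennreal (a w1 p) \<partial>lborel)
     \<le> (\<integral>\<^sup>+p. ennreal (a (\<lambda>_. 1) p) \<partial>lborel)\<^sup>2"
  proof (rule prekopa_leindler)
    fix p q :: "'a \<times> real"
    obtain y0 t0 y1 t1 where pq: "p = (y0, t0)" "q = (y1, t1)" by fastforce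
    define x0 x1 where "x0 = (1/t0) *\<^sub>R y0" and "x1 = (1/t1) *\<^sub>R y1"
    define T where "T = (t0 + t1) / 2"
    define X where "X = (1/T) *\<^sub>R ((1/2) *\<^sub>R (y0 + y1))"
    have mid: "a (\<lambda>_. 1) ((1/2) *\<^sub>R (p + q)) = indicator K X * (indicator {\<rho>..} T * indicator {0<..} T) * (T powr \<alpha> * exp (- (T * \<phi> X)))"
      by (simp add: a_def pq X_def T_def)
    show "ennreal (a w0 p) * ennreal (a w1 q) \<le> (ennreal (a (\<lambda>_. 1) ((1/2) *\<^sub>R (p + q))))\<^sup>2"
    proof (cases "x0 \<in> K \<and> x1 \<in> K \<and> \<rho> \<le> t0 \<and> \<rho> \<le> t1 \<and> 0 < t0 \<and> 0 < t1")
      case False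
      then have "a w0 p = 0 \<or> a w1 q = 0"
        by (auto simp: a_def pq x0_def x1_def indicator_def)
      then show ?thesis by auto
    next
      case True
      have X: "X = (t0 / (t0 + t1)) *\<^sub>R x0 + (1 - t0 / (t0 + t1)) *\<^sub>R x1"
      proof -
        have "1 - t0 / (t0 + t1) = t1 / (t0 + t1)" using True by (simp add: field_simps)
        moreover have "1 / T * (1 / 2) = 1 / (t0 + t1)" using True by (simp add: T_def field_simps)
        then have "X = (1 / (t0 + t1)) *\<^sub>R (y0 + y1)" unfolding X_def scaleR_scaleR by (simp only:)
        ultimately show ?thesis using True by (simp add: x0_def x1_def scaleR_right_distrib)
      qed
      have XK: "X \<in> K" unfolding X using \<open>convex K\<close> True by (intro convexD) auto
      have T: "\<rho> \<le> T" "0 < T" using True by (auto simp: T_def)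
      have wle: "w0 (x0, t0) * w1 (x1, t1) \<le> exp (C * (t0 * t1 / (t0 + t1)) * (norm (x0 - x1))\<^sup>2 / 2)"
        using True by (intro w) auto
      have ple: "(t0 + t1) * \<phi> X + C * (t0 * t1 / (t0 + t1)) * (norm (x0 - x1))\<^sup>2 / 2 \<le> t0 * \<phi> x0 + t1 * \<phi> x1"
        unfolding X using True by (intro perspective_midpoint[OF sc]) auto
      have "a w0 p * a w1 q = (t0 powr \<alpha> * t1 powr \<alpha>) * (exp (- (t0 * \<phi> x0)) * exp (- (t1 * \<phi> x1)) * (w0 (x0, t0) * w1 (x1, t1)))"
        using True by (simp add: a_def pq x0_def x1_def mult_ac)
      \<comment> \<open>The power of t is log-concave because \<open>\<alpha> \<ge> 0\<close>; here
        the lower bound on \<beta> enters.\<close>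
      also have "\<dots> \<le> (T powr \<alpha>)\<^sup>2 * (exp (- (t0 * \<phi> x0)) * exp (- (t1 * \<phi> x1)) * exp (C * (t0 * t1 / (t0 + t1)) * (norm (x0 - x1))\<^sup>2 / 2))"
        unfolding T_def using True \<alpha> nn wle by (intro mult_mono powr_midpoint mult_left_mono) auto
      also have "\<dots> \<le> (T powr \<alpha>)\<^sup>2 * exp (- (2 * T * \<phi> X))"
      proof -
        have "2 * T = t0 + t1" by (simp add: T_def)
        then have "- (t0 * \<phi> x0) + - (t1 * \<phi> x1) + C * (t0 * t1 / (t0 + t1)) * (norm (x0 - x1))\<^sup>2 / 2 \<le> - (2 * T * \<phi> X)"
          using ple by simp
        then show ?thesis by (intro mult_left_mono) (simp_all only: exp_add[symmetric] exp_le_cancel_iff zero_le_power2)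
      qed
      also have "\<dots> = (a (\<lambda>_. 1) ((1/2) *\<^sub>R (p + q)))\<^sup>2"
        unfolding mid using XK T by (simp add: power2_eq_square algebra_simps flip: exp_add)
      finally show ?thesis
        using nn by (auto simp: a_def ennreal_power simp flip: ennreal_mult' intro!: ennreal_leI split: prod.split)
    qed
  qed auto
  then show ?thesis
    using cov[OF assms(3)] cov[OF assms(4)] cov[of "\<lambda>_. 1"] nn by simp
qed

text \<open>For pairs closer than \<eta> the square is completed. For the others the left side is at
  most \<open>2 B s\<close>; the bound on s makes this at most
  \<open>C (\<rho> / 2) \<eta>^2 / 2\<close>, and the harmonic factor is at least
  \<open>\<rho> / 2\<close>.\<close>

lemma perturbation_exponent_le:
  fixes K :: "'a::euclidean_space set"
  assumes "C > 0" "\<rho> > 0" "\<eta> > 0" and B: "B > 0" "\<And>x. x \<in> K \<Longrightarrow> \<bar>f x\<bar> \<le> B"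
    and S: "\<And>x. 0 \<le> S x" "\<And>x y. x \<in> K \<Longrightarrow> y \<in> K \<Longrightarrow> norm (x - y) < \<eta> \<Longrightarrow> \<bar>f x - f y\<bar> \<le> S x * norm (x - y)"
    and s: "0 < s" "s < C * \<rho> * \<eta>\<^sup>2 / (8 * B)" and x: "x0 \<in> K" "x1 \<in> K" and t: "\<rho> \<le> t0" "\<rho> \<le> t1"
  shows "s * (f x1 - f x0) - s\<^sup>2 * ((S x0)\<^sup>2 / C / (2 * t0) + (S x1)\<^sup>2 / C / (2 * t1))
    \<le> C * (t0 * t1 / (t0 + t1)) * (norm (x0 - x1))\<^sup>2 / 2"
proof -
  define d where "d = norm (x0 - x1)"
  define T where "T = t0 * t1 / (t0 + t1)"
  have tpos: "0 < t0" "0 < t1" using t \<open>\<rho> > 0\<close> by auto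
  have T: "0 < T" using tpos by (simp add: T_def)
  define Q where "Q = (S x0)\<^sup>2 / C / (2 * t0) + (S x1)\<^sup>2 / C / (2 * t1)"
  have Q0: "Q \<ge> 0" using tpos \<open>C > 0\<close> by (simp add: Q_def)
  have "s * (f x1 - f x0) - s\<^sup>2 * Q \<le> C * T * d\<^sup>2 / 2"
  proof (cases "d < \<eta>")
    case True
    \<comment> \<open>The Lipschitz estimate may be based at either endpoint. Taking the smaller
      constant, its square can later be bounded by that of whichever endpoint belongs to the
      term.\<close>
    define l where "l = min (S x0) (S x1)"
    have "f x1 - f x0 \<le> l * d"
      using S(2)[of x0 x1] S(2)[of x1 x0] x True by (auto simp: d_def l_def min_def norm_minus_commute)
    then have "s * (f x1 - f x0) \<le> s * (l * d)" using s by (intro mult_left_mono) auto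
    moreover have "s * (l * d) \<le> C * T * d\<^sup>2 / 2 + s\<^sup>2 * (l\<^sup>2 / (2 * C * T))"
    proof -
      have "0 \<le> (C * T * d - s * l)\<^sup>2 / (2 * C * T)" using \<open>C > 0\<close> T by simp
      also have "\<dots> = C * T * d\<^sup>2 / 2 + s\<^sup>2 * (l\<^sup>2 / (2 * C * T)) - s * (l * d)"
        using \<open>C > 0\<close> T by (simp add: field_simps power2_eq_square)
      finally show ?thesis by simp
    qed
    moreover have "l\<^sup>2 / (2 * C * T) \<le> Q"
    proof -
      have "l\<^sup>2 / (2 * C * T) = l\<^sup>2 / C / (2 * t0) + l\<^sup>2 / C / (2 * t1)"
        \<comment> \<open>This is the splitting \<open>1 / T = 1 / t0 + 1 / t1\<close>.\<close>
        using tpos \<open>C > 0\<close> by (simp add: T_def field_simps)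
      also have "\<dots> \<le> Q" unfolding Q_def using tpos \<open>C > 0\<close> S(1)
        by (intro add_mono divide_right_mono power_mono) (auto simp: l_def)
      finally show ?thesis .
    qed
    then have "s\<^sup>2 * (l\<^sup>2 / (2 * C * T)) \<le> s\<^sup>2 * Q" by (intro mult_left_mono) auto
    ultimately show ?thesis by linarith
  next
    case False
    have "f x1 - f x0 \<le> 2 * B" using B(2)[OF x(1)] B(2)[OF x(2)] by linarith
    then have "s * (f x1 - f x0) \<le> C * \<rho> * \<eta>\<^sup>2 / (8 * B) * (2 * B)"
      using s B(1) by (smt (verit) mult_left_mono mult_right_mono mult_pos_pos)
    also have "\<dots> = C * (\<rho> / 2) * \<eta>\<^sup>2 / 2" using B(1) by simp
    also have "\<dots> \<le> C * T * d\<^sup>2 / 2"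
    proof -
      have "\<rho> * t1 \<le> t0 * t1" "\<rho> * t0 \<le> t1 * t0" using t tpos by (auto intro: mult_right_mono)
      then have "\<rho> * (t0 + t1) \<le> 2 * (t0 * t1)" by (simp add: algebra_simps)
      then have "\<rho> / 2 \<le> T" using tpos by (simp add: T_def field_simps)
      moreover have "\<eta>\<^sup>2 \<le> d\<^sup>2" using False \<open>\<eta> > 0\<close> by (intro power_mono) auto
      ultimately show ?thesis using \<open>C > 0\<close> \<open>\<rho> > 0\<close> T
        by (intro divide_right_mono mult_mono) auto
    qed
    finally show ?thesis using Q0 by (smt (verit) mult_nonneg_nonneg zero_le_power2)
  qed
  then show ?thesis by (simp add: Q_def T_def d_def)
qed

section \<open>Integrating out the height variable\<close>

lemma nn_integral_Gamma_scaled: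
  assumes "s > 0" "a > 0"
  shows "(\<integral>\<^sup>+t. ennreal (indicator {0<..} t * (t powr (s - 1) * exp (- (t * a)))) \<partial>lborel) = ennreal (Gamma s * a powr (- s))"
proof -
  let ?I = "\<integral>\<^sup>+t. ennreal (indicator {0<..} t * (t powr (s - 1) * exp (- (t * a)))) \<partial>lborel"
  have "ennreal (Gamma s) = (\<integral>\<^sup>+t. ennreal (indicator {0..} t * t powr (s - 1) / exp t) \<partial>lborel)"
    by (rule Gamma_conv_nn_integral_real) fact
  also have "\<dots> = ennreal a * (\<integral>\<^sup>+t. ennreal (indicator {0..} (0 + a * t) * (0 + a * t) powr (s - 1) / exp (0 + a * t)) \<partial>lborel)"
    using \<open>a > 0\<close> by (subst nn_integral_real_affine[where c=a and t=0]) auto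
  also have "(\<integral>\<^sup>+t. ennreal (indicator {0..} (0 + a * t) * (0 + a * t) powr (s - 1) / exp (0 + a * t)) \<partial>lborel)
     = (\<integral>\<^sup>+t. ennreal (a powr (s - 1)) * ennreal (indicator {0<..} t * (t powr (s - 1) * exp (- (t * a)))) \<partial>lborel)"
  proof (rule nn_integral_cong)
    fix t :: real
    \<comment> \<open>The half-line is closed on the left and open on the right; at
      \<open>t = 0\<close> both sides vanish because \<open>0 powr x\<close> is 0.\<close>
    have "indicator {0..} (a * t) * (a * t) powr (s - 1) / exp (a * t) = a powr (s - 1) * (indicator {0<..} t * (t powr (s - 1) * exp (- (t * a))))"
      using \<open>a > 0\<close> by (cases "t = 0") (auto simp: indicator_def powr_mult exp_minus field_simps zero_le_mult_iff)
    then show "ennreal (indicator {0..} (0 + a * t) * (0 + a * t) powr (s - 1) / exp (0 + a * t))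
      = ennreal (a powr (s - 1)) * ennreal (indicator {0<..} t * (t powr (s - 1) * exp (- (t * a))))"
      by (simp flip: ennreal_mult')
  qed
  also have "\<dots> = ennreal (a powr (s - 1)) * ?I" by (rule nn_integral_cmult) measurable
  finally have "ennreal (a powr - s) * ennreal (Gamma s) = ennreal (a powr - s * a * a powr (s - 1)) * ?I"
    using \<open>a > 0\<close> by (simp add: ennreal_mult' mult.assoc)
  also have "a powr - s * a * a powr (s - 1) = 1"
    using \<open>a > 0\<close> by (simp add: powr_diff powr_minus field_simps)
  finally show ?thesis using Gamma_real_pos[OF \<open>s > 0\<close>] by (simp add: ennreal_mult mult.commute)
qed

lemma distr_cone_density_fst:
  fixes K :: "'a::euclidean_space set"
  assumes [measurable]: "K \<in> sets borel" "\<phi> \<in> borel_measurable borel"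
    and pos: "\<And>x. \<phi> x > 0" and \<beta>: "\<beta> > 0"
  shows "distr (density lborel (\<lambda>p. ennreal (cone_density K \<phi> \<beta> 0 p))) borel fst
     = density lborel (\<lambda>x. ennreal (indicator K x * (Gamma \<beta> * \<phi> x powr (- \<beta>))))"
proof (rule measure_eqI)
  let ?d = "cone_density K \<phi> \<beta> 0" and ?w = "\<lambda>x. ennreal (indicator K x * (Gamma \<beta> * \<phi> x powr (- \<beta>)))"
  let ?M = "distr (density lborel (\<lambda>p. ennreal (?d p))) borel fst"
  fix A assume "A \<in> sets ?M"
  then have [measurable]: "A \<in> sets borel" by simp
  have [measurable]: "?d \<in> borel_measurable (borel \<Otimes>\<^sub>M borel)" by (simp add: borel_prod)
  have fst_m: "fst \<in> measurable (borel :: ('a \<times> real) measure) borel"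
    by (intro borel_measurable_continuous_onI continuous_intros)
  have vm: "fst -` A \<in> sets (borel :: ('a \<times> real) measure)" using measurable_sets[OF fst_m \<open>A \<in> sets borel\<close>] by simp
  have "emeasure ?M A
    = (\<integral>\<^sup>+p. ennreal (?d p) * indicator (fst -` A) p \<partial>lborel)"
    using fst_m vm by (simp add: emeasure_distr emeasure_density)
  also have "\<dots> = (\<integral>\<^sup>+p. ennreal (?d p) * indicator A (fst p) \<partial>(lborel \<Otimes>\<^sub>M lborel))"
    unfolding lborel_prod by (intro nn_integral_cong) (auto simp: indicator_def)
  also have "\<dots> = (\<integral>\<^sup>+x. \<integral>\<^sup>+t. ennreal (?d (x, t)) * indicator A x \<partial>lborel \<partial>lborel)"
    by (subst lborel.nn_integral_fst[symmetric]) auto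
  also have "\<dots> = (\<integral>\<^sup>+x. ?w x * indicator A x \<partial>lborel)"
  proof (rule nn_integral_cong)
    fix x
    have "(\<integral>\<^sup>+t. ennreal (?d (x, t)) * indicator A x \<partial>lborel)
       = (\<integral>\<^sup>+t. (indicator K x * indicator A x) * ennreal (indicator {0<..} t * (t powr (\<beta> - 1) * exp (- (t * \<phi> x)))) \<partial>lborel)"
      by (intro nn_integral_cong) (auto simp: cone_density_def indicator_def)
    also have "\<dots> = (indicator K x * indicator A x) * ennreal (Gamma \<beta> * \<phi> x powr (- \<beta>))"
      by (subst nn_integral_cmult) (auto simp: nn_integral_Gamma_scaled \<beta> pos)
    finally show "(\<integral>\<^sup>+t. ennreal (?d (x, t)) * indicator A x \<partial>lborel)
       = ?w x * indicator A x"
      by (auto simp: indicator_def)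
  qed
  also have "\<dots> = emeasure (density lborel ?w) A"
    by (simp add: emeasure_density)
  finally show "emeasure ?M A
    = emeasure (density lborel ?w) A" .
qed simp

definition weighted_integral :: "'a::euclidean_space set \<Rightarrow> ('a \<Rightarrow> real) \<Rightarrow> real \<Rightarrow> ('a \<Rightarrow> real) \<Rightarrow> real" where
  "weighted_integral K \<phi> a g = (\<integral>x. indicator K x * \<phi> x powr a * g x \<partial>lborel)"

lemma
  fixes K :: "'a::euclidean_space set" and g :: "'a \<Rightarrow> real"
  assumes [measurable]: "K \<in> sets borel" "\<phi> \<in> borel_measurable borel" "g \<in> borel_measurable borel"
    and pos: "\<And>x. \<phi> x > 0" and \<beta>: "\<beta> > 0"
  shows integrable_cone_density_fst: "integrable lborel (\<lambda>p. cone_density K \<phi> \<beta> 0 p * g (fst p))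
      \<longleftrightarrow> integrable lborel (\<lambda>x. indicator K x * \<phi> x powr (- \<beta>) * g x)" (is ?I)
    and integral_cone_density_fst: "(\<integral>p. cone_density K \<phi> \<beta> 0 p * g (fst p) \<partial>lborel)
      = Gamma \<beta> * weighted_integral K \<phi> (- \<beta>) g" (is ?E)
proof -
  have fst_m[measurable]: "fst \<in> measurable (borel :: ('a \<times> real) measure) borel"
    by (intro borel_measurable_continuous_onI continuous_intros)
  have G: "Gamma \<beta> > 0" using \<beta> by (rule Gamma_real_pos)
  let ?M = "density lborel (\<lambda>p. ennreal (cone_density K \<phi> \<beta> 0 p))"
  let ?N = "density lborel (\<lambda>x. ennreal (indicator K x * (Gamma \<beta> * \<phi> x powr (- \<beta>))))"
  have eq: "indicator K x * (Gamma \<beta> * \<phi> x powr (- \<beta>)) * g x = Gamma \<beta> * (indicator K x * \<phi> x powr (- \<beta>) * g x)" for x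
    by (simp add: mult_ac)
  have "integrable lborel (\<lambda>p. cone_density K \<phi> \<beta> 0 p * g (fst p)) \<longleftrightarrow> integrable ?M (\<lambda>p. g (fst p))"
    by (subst integrable_density) (auto simp: cone_density_nonneg)
  also have "\<dots> \<longleftrightarrow> integrable (distr ?M borel fst) g"
    by (subst integrable_distr_eq) auto
  also have "\<dots> \<longleftrightarrow> integrable lborel (\<lambda>x. indicator K x * (Gamma \<beta> * \<phi> x powr (- \<beta>)) * g x)"
    unfolding distr_cone_density_fst[OF assms(1,2) pos \<beta>]
    using G by (subst integrable_density) auto
  finally show ?I unfolding eq using G by simp
  have "(\<integral>p. cone_density K \<phi> \<beta> 0 p * g (fst p) \<partial>lborel) = (\<integral>p. g (fst p) \<partial>?M)"
    by (subst integral_density) (auto simp: cone_density_nonneg)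
  also have "\<dots> = (\<integral>x. g x \<partial>distr ?M borel fst)"
    by (subst integral_distr) auto
  also have "\<dots> = (\<integral>x. indicator K x * (Gamma \<beta> * \<phi> x powr (- \<beta>)) * g x \<partial>lborel)"
    unfolding distr_cone_density_fst[OF assms(1,2) pos \<beta>]
    using G by (subst integral_density) auto
  finally show ?E unfolding eq weighted_integral_def by simp
qed

lemma cone_density_le: "cone_density K \<phi> \<beta> \<rho> p \<le> cone_density K \<phi> \<beta> 0 p"
  by (auto simp: cone_density_def indicator_def split: prod.split)

text \<open>The factor \<open>1 / t\<close> in the correction lowers the exponent by one; its
  marginal thus carries \<open>Gamma (\<beta> - 1)\<close>. At height 0 both sides are 0, division
  by 0 giving 0.\<close>

lemma cone_density_divide:
  "cone_density K \<phi> \<beta> \<rho> p / snd p = cone_density K \<phi> (\<beta> - 1) \<rho> p"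
  by (auto simp: cone_density_def indicator_def powr_diff power2_eq_square split: prod.split)

text \<open>The restriction to \<open>t \<ge> \<rho>\<close> makes the correction bounded, as the
  second-order expansion requires. The variance is kept in the form mass times second moment minus
  squared first moment, which remains meaningful for mass zero.\<close>

lemma poincare_slope_truncated:
  fixes K :: "'a::euclidean_space set" and f :: "'a \<Rightarrow> real"
  assumes K: "compact K" "convex K"
    and \<phi>: "continuous_on UNIV \<phi>" "\<And>x. \<phi> x > 0" and sc: "strongly_convex_on K C \<phi>"
    and \<beta>: "real DIM('a) + 1 \<le> \<beta>" and "C > 0" "\<rho> > 0" "\<eta> > 0"
    and f: "continuous_on UNIV f" and S[measurable]: "S \<in> borel_measurable borel" and S_bd: "\<And>x. 0 \<le> S x" "\<And>x. S x \<le> L"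
    and S_le: "\<And>x y. x \<in> K \<Longrightarrow> y \<in> K \<Longrightarrow> norm (x - y) < \<eta> \<Longrightarrow> \<bar>f x - f y\<bar> \<le> S x * norm (x - y)"
    and int0: "integrable lborel (cone_density K \<phi> \<beta> 0)"
  defines "q \<equiv> \<lambda>x. (S x)\<^sup>2 / C"
  shows "(\<integral>p. cone_density K \<phi> \<beta> \<rho> p \<partial>lborel) * (\<integral>p. cone_density K \<phi> \<beta> \<rho> p * (f (fst p))\<^sup>2 \<partial>lborel)
      - (\<integral>p. cone_density K \<phi> \<beta> \<rho> p * f (fst p) \<partial>lborel)\<^sup>2
      \<le> (\<integral>p. cone_density K \<phi> \<beta> \<rho> p \<partial>lborel) * (\<integral>p. cone_density K \<phi> (\<beta> - 1) \<rho> p * q (fst p) \<partial>lborel)"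
proof -
  let ?d = "cone_density K \<phi> \<beta> \<rho>"
  have [measurable]: "K \<in> sets borel" using \<open>compact K\<close> by (intro borel_compact)
  have [measurable]: "\<phi> \<in> borel_measurable borel" using \<phi>(1) by (rule borel_measurable_continuous_onI)
  have [measurable]: "f \<in> borel_measurable borel" using f by (rule borel_measurable_continuous_onI)
  have [measurable]: "fst \<in> measurable (borel :: ('a \<times> real) measure) borel" "snd \<in> measurable (borel :: ('a \<times> real) measure) borel"
    by (intro borel_measurable_continuous_onI continuous_intros)+
  have [measurable]: "q \<in> borel_measurable borel" unfolding q_def by measurable
  define M where "M = density lborel (\<lambda>p. ennreal (?d p))"
  have int_d: "integrable lborel ?d"
    using int0 by (rule Bochner_Integration.integrable_bound) (auto simp: cone_density_nonneg cone_density_le)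
  have "emeasure M (space M) = ennreal (\<integral>p. ?d p \<partial>lborel)"
    using int_d by (simp add: M_def emeasure_density nn_integral_eq_integral cone_density_nonneg)
  then interpret finite_measure M by (intro finite_measureI) simp
  define m where "m = (\<integral>p. ?d p \<partial>lborel)"
  have m: "measure M (space M) = m"
    using \<open>emeasure M (space M) = _\<close> unfolding measure_def m_def 
    by (simp add: integral_nonneg_AE cone_density_nonneg)
  have m0: "m \<ge> 0" by (simp add: m_def integral_nonneg_AE cone_density_nonneg)
  have intM: "(\<integral>p. g p \<partial>M) = (\<integral>p. ?d p * g p \<partial>lborel)" if [measurable]: "g \<in> borel_measurable borel" for g
    unfolding M_def by (subst integral_density) (auto simp: cone_density_nonneg)
  have sets_M[measurable_cong]: "sets M = sets borel" by (simp add: M_def)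
  have AE_M: "AE p in M. fst p \<in> K \<and> \<rho> \<le> snd p"
    unfolding M_def by (subst AE_density) (auto simp: cone_density_def indicator_def split: prod.splits if_splits)
  have "bounded (f ` K)" using \<open>compact K\<close> f by (intro compact_imp_bounded compact_continuous_image) (auto intro: continuous_on_subset)
  then obtain B where B: "B > 0" "\<And>x. x \<in> K \<Longrightarrow> \<bar>f x\<bar> \<le> B" unfolding bounded_pos by auto
  define B' where "B' = L\<^sup>2 / C"
  have B': "B' \<ge> 0" "\<bar>q x\<bar> \<le> B'" for x
    using S_bd[of x] \<open>C > 0\<close> by (auto simp: B'_def q_def intro!: divide_right_mono power_mono)
  have AE_f: "AE p in M. \<bar>f (fst p)\<bar> \<le> B" using AE_M by eventually_elim (use B in auto)
  \<comment> \<open>The expansion bounds the second moment by twice the mean of r, whence the 2 in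
    the denominator.\<close>
  define r where "r = (\<lambda>p::'a \<times> real. q (fst p) / (2 * snd p))"
  have [measurable]: "r \<in> borel_measurable borel" unfolding r_def by measurable
  have AE_r: "AE p in M. \<bar>r p\<bar> \<le> B' / (2 * \<rho>)" 
    using AE_M
  proof eventually_elim
    case (elim p)
    then have "\<bar>q (fst p)\<bar> / (2 * snd p) \<le> B' / (2 * \<rho>)"
      using B' \<open>\<rho> > 0\<close> by (intro frac_le) auto
    then show ?case using elim \<open>\<rho> > 0\<close> by (simp add: r_def abs_divide)
  qed
  have int_f: "integrable M (\<lambda>p. f (fst p))"
    using AE_f by (auto intro!: integrable_const_bound[where B=B])
  have int_f2: "integrable M (\<lambda>p. (f (fst p))\<^sup>2)"
    using AE_f B by (auto intro!: integrable_const_bound[where B="B\<^sup>2"] elim!: eventually_mono simp flip: abs_le_square_iff)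
  define J1 where "J1 = (\<integral>p. f (fst p) \<partial>M)"
  define J2 where "J2 = (\<integral>p. (f (fst p))\<^sup>2 \<partial>M)"
  have R: "2 * (\<integral>p. r p \<partial>M) = (\<integral>p. cone_density K \<phi> (\<beta> - 1) \<rho> p * q (fst p) \<partial>lborel)"
  proof -
    have "2 * (?d p * r p) = cone_density K \<phi> (\<beta> - 1) \<rho> p * q (fst p)" for p
      by (simp add: r_def flip: cone_density_divide)
    then show ?thesis by (subst intM) (auto simp flip: integral_mult_right_zero)
  qed
  have "m * J2 - J1\<^sup>2 \<le> m * (2 * (\<integral>p. r p \<partial>M))"
  proof (cases "m = 0")
    case False
    with m0 have mpos: "m > 0" by simp
    \<comment> \<open>Subtracting the mean provides the mean-zero function that the expansion needs;
      increments of f are unaffected.\<close>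
    define c where "c = J1 / m"
    define s0 where "s0 = C * \<rho> * \<eta>\<^sup>2 / (8 * B)"
    have "s0 > 0" using \<open>C > 0\<close> \<open>\<rho> > 0\<close> \<open>\<eta> > 0\<close> B(1) by (simp add: s0_def)
    define A where "A = max (B + \<bar>c\<bar>) (B' / (2 * \<rho>))"
    have gA: "AE p in M. \<bar>f (fst p) - c\<bar> \<le> A" using AE_f by eventually_elim (auto simp: A_def)
    have rA: "AE p in M. \<bar>r p\<bar> \<le> A" using AE_r by eventually_elim (auto simp: A_def)
    have "(\<integral>p. (f (fst p) - c)\<^sup>2 \<partial>M) \<le> 2 * (\<integral>p. r p \<partial>M)"
    proof (rule second_moment_le_of_midpoint[OF finite_measure_axioms _ _ gA rA \<open>s0 > 0\<close>])
      show "(\<integral>p. f (fst p) - c \<partial>M) = 0"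
        using int_f mpos by (simp add: m J1_def[symmetric] c_def)
      fix s assume s: "0 < s" "s < s0"
      define w where "w = (\<lambda>\<sigma> p. exp (\<sigma> * (f (fst p) - c) - s\<^sup>2 * r p))"
      have [measurable]: "w \<sigma> \<in> borel_measurable borel" for \<sigma> unfolding w_def by measurable
      have nnw: "(\<integral>\<^sup>+p. ennreal (?d p * w \<sigma> p) \<partial>lborel) = ennreal (\<integral>p. w \<sigma> p \<partial>M)" for \<sigma>
      proof -
        have "integrable M (w \<sigma>)"
        proof (rule integrable_const_bound[where B="exp (\<bar>\<sigma>\<bar> * A + s\<^sup>2 * A)"])
          show "AE p in M. norm (w \<sigma> p) \<le> exp (\<bar>\<sigma>\<bar> * A + s\<^sup>2 * A)"
            using gA rA
          proof eventually_elim
            case (elim p)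
            have "\<sigma> * (f (fst p) - c) \<le> \<bar>\<sigma>\<bar> * \<bar>f (fst p) - c\<bar>" by (metis abs_ge_self abs_mult)
            also have "\<dots> \<le> \<bar>\<sigma>\<bar> * A" using elim by (intro mult_left_mono) auto
            finally have "\<sigma> * (f (fst p) - c) \<le> \<bar>\<sigma>\<bar> * A" .
            moreover have "s\<^sup>2 * (- r p) \<le> s\<^sup>2 * A" using elim by (intro mult_left_mono) auto
            ultimately show ?case by (simp add: w_def)
          qed
        qed measurable
        then have "ennreal (\<integral>p. w \<sigma> p \<partial>M) = (\<integral>\<^sup>+p. ennreal (w \<sigma> p) \<partial>M)"
          by (intro nn_integral_eq_integral[symmetric]) (auto simp: w_def)
        also have "\<dots> = (\<integral>\<^sup>+p. ennreal (?d p * w \<sigma> p) \<partial>lborel)"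
          unfolding M_def by (subst nn_integral_density) (auto simp: ennreal_mult' cone_density_nonneg)
        finally show ?thesis by simp
      qed
      have "(\<integral>\<^sup>+p. ennreal (?d p * w (-s) p) \<partial>lborel) * (\<integral>\<^sup>+p. ennreal (?d p * w s p) \<partial>lborel)
         \<le> (\<integral>\<^sup>+p. ennreal (?d p) \<partial>lborel)\<^sup>2"
      proof (rule cone_prekopa_leindler[OF _ _ _ _ \<open>convex K\<close> sc \<beta>])
        fix x0 t0 x1 t1
        assume x: "x0 \<in> K" "x1 \<in> K" and t: "\<rho> \<le> t0" "\<rho> \<le> t1"
        show "w (-s) (x0, t0) * w s (x1, t1) \<le> exp (C * (t0 * t1 / (t0 + t1)) * (norm (x0 - x1))\<^sup>2 / 2)"
          using perturbation_exponent_le[OF \<open>C > 0\<close> \<open>\<rho> > 0\<close> \<open>\<eta> > 0\<close> B S_bd(1) S_le s(1) s(2)[unfolded s0_def] x t]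
          by (simp add: w_def r_def q_def algebra_simps flip: exp_add)
      qed (auto simp: w_def)
      also have "(\<integral>\<^sup>+p. ennreal (?d p) \<partial>lborel) = ennreal m"
        using int_d by (simp add: m_def nn_integral_eq_integral cone_density_nonneg)
      finally have "ennreal ((\<integral>p. w (-s) p \<partial>M) * (\<integral>p. w s p \<partial>M)) \<le> ennreal (m\<^sup>2)"
        unfolding nnw using m0 by (simp add: ennreal_mult' ennreal_power w_def integral_nonneg_AE)
      then have "(\<integral>p. w (-s) p \<partial>M) * (\<integral>p. w s p \<partial>M) \<le> m\<^sup>2"
        by (simp add: ennreal_le_iff)
      then show "(\<integral>p. exp (- s * (f (fst p) - c) - s\<^sup>2 * r p) \<partial>M) * (\<integral>p. exp (s * (f (fst p) - c) - s\<^sup>2 * r p) \<partial>M)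
          \<le> (measure M (space M))\<^sup>2"
        by (simp add: w_def m)
    qed measurable
    also have "(\<integral>p. (f (fst p) - c)\<^sup>2 \<partial>M) = (\<integral>p. (f (fst p))\<^sup>2 - 2 * c * f (fst p) + c\<^sup>2 \<partial>M)"
      by (intro Bochner_Integration.integral_cong) (auto simp: power2_eq_square algebra_simps)
    also have "\<dots> = J2 - 2 * c * J1 + c\<^sup>2 * m"
      using int_f int_f2 by (simp add: J2_def J1_def m)
    finally have "m * (J2 - 2 * c * J1 + c\<^sup>2 * m) \<le> m * (2 * (\<integral>p. r p \<partial>M))"
      using mpos by (intro mult_left_mono) auto
    moreover have "m * (J2 - 2 * c * J1 + c\<^sup>2 * m) = m * J2 - J1\<^sup>2"
      using mpos by (simp add: c_def field_simps power2_eq_square)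
    ultimately show ?thesis by simp
  qed simp
  then show ?thesis unfolding R by (simp add: J1_def J2_def intM m_def)
qed

section \<open>Removing the truncation in the height variable\<close>

lemma borel_measurable_indicator_powr:
  fixes A :: "'a::topological_space set"
  assumes "A \<in> sets borel" "continuous_on A \<phi>" "\<And>x. x \<in> A \<Longrightarrow> (0::real) < \<phi> x"
  shows "(\<lambda>x. indicator A x * \<phi> x powr a) \<in> borel_measurable borel"
proof -
  have "continuous_on A (\<lambda>x. \<phi> x powr a)"
    using assms by (intro continuous_intros) (auto simp: less_imp_neq[symmetric])
  from borel_measurable_continuous_on_indicator[OF assms(1) this] show ?thesis by simp
qed

lemma integrable_weighted_compact:
  fixes K :: "'a::euclidean_space set" and \<phi> g :: "'a \<Rightarrow> real"
  assumes K: "compact K" and \<phi>: "continuous_on K \<phi>" "\<And>x. x \<in> K \<Longrightarrow> \<phi> x > 0"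
    and g[measurable]: "g \<in> borel_measurable borel" and D: "\<And>x. x \<in> K \<Longrightarrow> \<bar>g x\<bar> \<le> D"
  shows "integrable lborel (\<lambda>x. indicator K x * \<phi> x powr a * g x)"
proof (rule Bochner_Integration.integrable_bound)
  have "continuous_on K (\<lambda>x. \<phi> x powr a * D)"
    using \<phi> by (intro continuous_intros) (auto simp: less_imp_neq[symmetric])
  from borel_integrable_compact[OF K this] show "integrable lborel (\<lambda>x. indicator K x * (\<phi> x powr a * D))" by simp
  show "(\<lambda>x. indicator K x * \<phi> x powr a * g x) \<in> borel_measurable lborel"
    using borel_measurable_times[OF borel_measurable_indicator_powr[OF borel_compact[OF K] \<phi>] g] by simp
  show "AE x in lborel. norm (indicator K x * \<phi> x powr a * g x) \<le> norm (indicator K x * (\<phi> x powr a * D))"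
    using D order_trans[OF D abs_ge_self] by (auto simp: abs_mult indicator_def intro!: AE_I2 mult_left_mono)
qed

text \<open>The truncation level \<open>1 / (n + 1)\<close> tends to 0, the density without
  truncation serving as majorant. This is applied with exponents \<beta> and
  \<open>\<beta> - 1\<close>, the latter positive because the dimension is at least 1; the
  functional equation of Gamma produces the constant.\<close>

lemma poincare_slope_compact:
  fixes K :: "'a::euclidean_space set" and f :: "'a \<Rightarrow> real"
  assumes K: "compact K" "convex K"
    and \<phi>: "continuous_on UNIV \<phi>" "\<And>x. \<phi> x > 0" and sc: "strongly_convex_on K C \<phi>"
    and \<beta>: "real DIM('a) + 1 \<le> \<beta>" and "C > 0" "\<eta> > 0"
    and f: "continuous_on UNIV f" and S[measurable]: "S \<in> borel_measurable borel" and S_bd: "\<And>x. 0 \<le> S x" "\<And>x. S x \<le> L"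
    and S_le: "\<And>x y. x \<in> K \<Longrightarrow> y \<in> K \<Longrightarrow> norm (x - y) < \<eta> \<Longrightarrow> \<bar>f x - f y\<bar> \<le> S x * norm (x - y)"
  defines "I \<equiv> weighted_integral K \<phi> (- \<beta>)"
  shows "I (\<lambda>x. 1) * I (\<lambda>x. (f x)\<^sup>2) - (I f)\<^sup>2
    \<le> I (\<lambda>x. 1) / (C * (\<beta> - 1)) * weighted_integral K \<phi> (1 - \<beta>) (\<lambda>x. (S x)\<^sup>2)"
proof -
  have \<beta>1: "\<beta> > 1" "\<beta> > 0" using \<beta> DIM_positive[where 'a='a] by linarith+
  have [measurable]: "K \<in> sets borel" using \<open>compact K\<close> by (intro borel_compact)
  have [measurable]: "\<phi> \<in> borel_measurable borel" using \<phi>(1) by (rule borel_measurable_continuous_onI)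
  have [measurable]: "f \<in> borel_measurable borel" using f by (rule borel_measurable_continuous_onI)
  have [measurable]: "fst \<in> measurable (borel :: ('a \<times> real) measure) borel"
    by (intro borel_measurable_continuous_onI continuous_intros)
  note ints = integrable_weighted_compact[OF K(1) continuous_on_subset[OF \<phi>(1) subset_UNIV] \<phi>(2)]
  let ?d = "\<lambda>b n. cone_density K \<phi> b (1 / real (Suc n))"
  let ?c = "\<lambda>b. cone_density K \<phi> b 0"
  have lim: "(\<lambda>n. \<integral>p. ?d b n p * g (fst p) \<partial>lborel) \<longlonglongrightarrow> Gamma b * weighted_integral K \<phi> (- b) g"
    if g[measurable]: "g \<in> borel_measurable borel" and D: "\<And>x. x \<in> K \<Longrightarrow> \<bar>g x\<bar> \<le> D" and b: "b > 0"
    for b D and g :: "'a \<Rightarrow> real"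
  proof -
    have "(\<lambda>n. \<integral>p. ?d b n p * g (fst p) \<partial>lborel) \<longlonglongrightarrow> (\<integral>p. ?c b p * g (fst p) \<partial>lborel)"
    proof (rule integral_dominated_convergence[where w="\<lambda>p. ?c b p * \<bar>g (fst p)\<bar>"])
      show "integrable lborel (\<lambda>p. ?c b p * \<bar>g (fst p)\<bar>)"
        using ints[of "\<lambda>x. \<bar>g x\<bar>" D "-b"] D integrable_cone_density_fst[of K \<phi> "\<lambda>x. \<bar>g x\<bar>" b] b \<phi>(2) by simp
      show "AE p in lborel. (\<lambda>n. ?d b n p * g (fst p)) \<longlonglongrightarrow> ?c b p * g (fst p)"
      proof (intro AE_I2 tendsto_mult tendsto_const)
        fix p :: "'a \<times> real"
        obtain x t where p: "p = (x, t)" by fastforce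
        show "(\<lambda>n. ?d b n p) \<longlonglongrightarrow> ?c b p"
        proof (cases "t > 0")
          case True
          then have "\<forall>\<^sub>F n in sequentially. 1 / real (Suc n) < t"
            using order_tendstoD(2)[OF LIMSEQ_Suc[OF lim_1_over_n] True] by simp
          then have "\<forall>\<^sub>F n in sequentially. ?d b n p = ?c b p"
            by eventually_elim (use True in \<open>auto simp: cone_density_def p indicator_def\<close>)
          then show ?thesis by (rule tendsto_eventually)
        qed (simp add: cone_density_def p)
      qed
      show "AE p in lborel. norm (?d b n p * g (fst p)) \<le> ?c b p * \<bar>g (fst p)\<bar>" for n
        by (auto simp: abs_mult cone_density_nonneg cone_density_le intro!: mult_right_mono)
    qed measurable
    then show ?thesis using integral_cone_density_fst[of K \<phi> g b] \<phi>(2) b by simp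
  qed
  have "bounded (f ` K)" using \<open>compact K\<close> f by (intro compact_imp_bounded compact_continuous_image) (auto intro: continuous_on_subset)
  then obtain B where B: "\<And>x. x \<in> K \<Longrightarrow> \<bar>f x\<bar> \<le> B" unfolding bounded_iff by auto
  have B2: "\<bar>(f x)\<^sup>2\<bar> \<le> B\<^sup>2" if "x \<in> K" for x using power_mono[OF B[OF that] abs_ge_zero, of 2] by simp
  define q where "q x = (S x)\<^sup>2 / C" for x
  have [measurable]: "q \<in> borel_measurable borel" unfolding q_def by measurable
  have q: "\<bar>q x\<bar> \<le> L\<^sup>2 / C" for x
    using S_bd[of x] \<open>C > 0\<close> by (auto simp: q_def intro!: divide_right_mono power_mono)
  have int0: "integrable lborel (cone_density K \<phi> \<beta> 0)"
    using ints[of "\<lambda>x. 1" 1 "- \<beta>"] integrable_cone_density_fst[of K \<phi> "\<lambda>x. 1" \<beta>] \<beta>1 \<phi>(2) by simp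
  have l0: "(\<lambda>n. \<integral>p. ?d \<beta> n p \<partial>lborel) \<longlonglongrightarrow> Gamma \<beta> * I (\<lambda>x. 1)"
    using lim[of "\<lambda>_. 1" 1 \<beta>] \<beta>1 by (simp add: I_def)
  let ?Q = "weighted_integral K \<phi> (1 - \<beta>) q"
  have "(Gamma \<beta> * I (\<lambda>x. 1)) * (Gamma \<beta> * I (\<lambda>x. (f x)\<^sup>2)) - (Gamma \<beta> * I f)\<^sup>2 \<le> (Gamma \<beta> * I (\<lambda>x. 1)) * (Gamma (\<beta> - 1) * ?Q)"
  proof (rule LIMSEQ_le)
    show "(\<lambda>n. (\<integral>p. ?d \<beta> n p \<partial>lborel) * (\<integral>p. ?d \<beta> n p * (f (fst p))\<^sup>2 \<partial>lborel) - (\<integral>p. ?d \<beta> n p * f (fst p) \<partial>lborel)\<^sup>2)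
       \<longlonglongrightarrow> (Gamma \<beta> * I (\<lambda>x. 1)) * (Gamma \<beta> * I (\<lambda>x. (f x)\<^sup>2)) - (Gamma \<beta> * I f)\<^sup>2"
      unfolding I_def using \<beta>1(2) B B2
      by (intro tendsto_diff tendsto_mult tendsto_power l0[unfolded I_def] lim[where D=B] lim[where D="B\<^sup>2"]) auto
    show "(\<lambda>n. (\<integral>p. ?d \<beta> n p \<partial>lborel) * (\<integral>p. ?d (\<beta> - 1) n p * q (fst p) \<partial>lborel))
       \<longlonglongrightarrow> (Gamma \<beta> * I (\<lambda>x. 1)) * (Gamma (\<beta> - 1) * ?Q)"
      using lim[of q "L\<^sup>2 / C" "\<beta> - 1"] q \<beta>1 by (intro tendsto_mult l0) simp
  qed (use poincare_slope_truncated[OF K \<phi> sc \<beta> \<open>C > 0\<close> _ \<open>\<eta> > 0\<close> f S S_bd S_le int0] in \<open>auto simp: q_def\<close>)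
  moreover have "Gamma \<beta> = (\<beta> - 1) * Gamma (\<beta> - 1)"
    using Gamma_plus1[of "\<beta> - 1"] \<beta>1 by (simp add: nonpos_Ints_def)
  then have "Gamma (\<beta> - 1) = Gamma \<beta> / (\<beta> - 1)" using \<beta>1 by simp
  moreover have "Gamma \<beta> > 0" using \<beta>1 by (auto intro: Gamma_real_pos)
  ultimately have "(Gamma \<beta> * Gamma \<beta>) * (I (\<lambda>x. 1) * I (\<lambda>x. (f x)\<^sup>2) - (I f)\<^sup>2) \<le> (Gamma \<beta> * Gamma \<beta>) * (I (\<lambda>x. 1) * (1 / (\<beta> - 1) * ?Q))"
    by (simp add: algebra_simps power2_eq_square)
  then have "I (\<lambda>x. 1) * I (\<lambda>x. (f x)\<^sup>2) - (I f)\<^sup>2 \<le> I (\<lambda>x. 1) * (1 / (\<beta> - 1) * ?Q)"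
    by (rule mult_left_le_imp_le) (use \<open>Gamma \<beta> > 0\<close> in auto)
  also have "?Q = 1 / C * weighted_integral K \<phi> (1 - \<beta>) (\<lambda>x. (S x)\<^sup>2)"
    by (simp add: weighted_integral_def q_def)
  finally show ?thesis by (simp add: field_simps)
qed

section \<open>Rademacher's theorem\<close>

text \<open>The derivative of F in direction i where it exists. An upper limit over the steps
  \<open>1 / (k + 1)\<close> is defined everywhere and inherits Borel measurability from F, being a
  countable limit operation.\<close>

definition forward_slope :: "('a::euclidean_space \<Rightarrow> real) \<Rightarrow> 'a \<Rightarrow> 'a \<Rightarrow> real" where
  "forward_slope F i x = real_of_ereal (limsup (\<lambda>k. ereal (real (Suc k) * (F (x + (1 / real (Suc k)) *\<^sub>R i) - F x))))"

lemma forward_slope_eq: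
  assumes "(\<lambda>k. real (Suc k) * (F (x + (1 / real (Suc k)) *\<^sub>R i) - F x)) \<longlonglongrightarrow> l"
  shows "forward_slope F i x = l"
proof -
  have "(\<lambda>k. ereal (real (Suc k) * (F (x + (1 / real (Suc k)) *\<^sub>R i) - F x))) \<longlonglongrightarrow> ereal l"
    using assms by simp
  then show ?thesis unfolding forward_slope_def by (subst lim_imp_Limsup) auto
qed

lemma borel_measurable_forward_slope:
  assumes [measurable]: "F \<in> borel_measurable borel"
  shows "forward_slope F i \<in> borel_measurable borel"
  unfolding forward_slope_def[abs_def] by measurable

lemma abs_forward_slope_le:
  assumes F: "L-lipschitz_on UNIV F" and "norm i = 1"
  shows "\<bar>forward_slope F i x\<bar> \<le> L"
proof -
  let ?q = "\<lambda>k. real (Suc k) * (F (x + (1 / real (Suc k)) *\<^sub>R i) - F x)"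
  have q: "\<bar>?q k\<bar> \<le> L" for k
  proof -
    have "dist (F (x + (1 / real (Suc k)) *\<^sub>R i)) (F x) \<le> L * dist (x + (1 / real (Suc k)) *\<^sub>R i) x"
      using F by (rule lipschitz_onD) auto
    also have "dist (x + (1 / real (Suc k)) *\<^sub>R i) x = 1 / real (Suc k)"
      using assms(2) by (simp add: dist_norm)
    finally have "real (Suc k) * \<bar>F (x + (1 / real (Suc k)) *\<^sub>R i) - F x\<bar> \<le> real (Suc k) * (L * (1 / real (Suc k)))"
      by (intro mult_left_mono) (auto simp: dist_real_def)
    then show ?thesis by (simp add: abs_mult)
  qed
  have "limsup (\<lambda>k. ereal (?q k)) \<le> ereal L"
    using q by (intro Limsup_bounded) (auto simp: abs_le_iff)
  moreover have "ereal (- L) \<le> limsup (\<lambda>k. ereal (?q k))"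
  proof -
    have "ereal (- L) \<le> liminf (\<lambda>k. ereal (?q k))"
      by (intro Liminf_bounded always_eventually allI) (use q in \<open>auto simp: abs_le_iff minus_le_iff\<close>)
    also have "\<dots> \<le> limsup (\<lambda>k. ereal (?q k))" by (intro Liminf_le_Limsup) simp
    finally show ?thesis .
  qed
  ultimately show ?thesis unfolding forward_slope_def
    by (cases "limsup (\<lambda>k. ereal (?q k))") auto
qed

lemma increasing_bilipschitz_density:
  fixes V :: "real \<Rightarrow> real"
  assumes up: "\<And>s t. s \<le> t \<Longrightarrow> V t - V s \<le> B * (t - s)"
    and low: "\<And>s t. s \<le> t \<Longrightarrow> t - s \<le> V t - V s"
  obtains h :: "real \<Rightarrow> real" where "h \<in> borel_measurable borel" "\<And>x. 0 \<le> h x"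
    "\<And>a b. a \<le> b \<Longrightarrow> (h has_integral (V b - V a)) {a..b}"
proof -
  have smono: "strict_mono V"
    unfolding strict_mono_def by (metis add.commute diff_gt_0_iff_gt less_le_trans low less_imp_le)
  then have inj: "inj V" by (rule strict_mono_imp_inj_on)
  have VB: "\<bar>V y - V x\<bar> \<le> B * \<bar>y - x\<bar>" for x y
    using up[of x y] up[of y x] low[of x y] low[of y x] by (cases "x \<le> y") auto
  have B0: "0 \<le> B" using up[of 0 1] low[of 0 1] by simp
  have "B-lipschitz_on UNIV V" using VB B0 by (intro lipschitz_onI) (auto simp: dist_real_def)
  then have cont: "continuous_on UNIV V" by (rule lipschitz_on_continuous_on)
  have surj: "surj V"
  unfolding surj_def
  proof
    fix y
    define c where "c = \<bar>y - V 0\<bar>"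
    have "V (- c) \<le> y" "y \<le> V c" using low[of "-c" 0] low[of 0 c] by (auto simp: c_def)
    then show "\<exists>x. y = V x"
      using IVT'[of V "-c" y c] cont by (auto simp: c_def intro: continuous_on_subset) 
  qed
  define W where "W = inv V"
  have WV[simp]: "W (V x) = x" "V (W y) = y" for x y
    using inj surj by (auto simp: W_def surj_f_inv_f)
  have "1-lipschitz_on UNIV W"
  proof (rule lipschitz_onI)
    fix x y
    show "dist (W x) (W y) \<le> 1 * dist x y"
      using low[of "W x" "W y"] low[of "W y" "W x"] by (cases "W x \<le> W y") (auto simp: dist_real_def)
  qed simp
  then have [measurable]: "W \<in> borel_measurable borel"
    by (intro borel_measurable_continuous_onI lipschitz_on_continuous_on)
  have vim: "W -` A = V ` A" for A
    using WV by (auto simp: image_iff) (metis WV)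
  \<comment> \<open>The push-forward under the inverse W gives A the length of its image under
    V.\<close>
  define N where "N = distr lborel borel W"
  have "absolutely_continuous lborel N"
    unfolding absolutely_continuous_def
  proof
    fix A :: "real set" assume A: "A \<in> null_sets lborel"
    then have [measurable]: "A \<in> sets borel" by auto
    have "negligible A" using A by (simp add: negligible_iff_null_sets null_sets_completionI)
    then have "negligible (V ` A)"
      by (rule negligible_locally_Lipschitz_image[rotated]) (use VB in \<open>auto intro!: exI[of _ UNIV] exI[of _ B]\<close>)
    moreover have m: "V ` A \<in> sets borel" unfolding vim[symmetric] using measurable_sets[OF \<open>W \<in> _\<close> \<open>A \<in> sets borel\<close>] by simp
    ultimately have "emeasure lborel (V ` A) = 0"
      by (simp add: negligible_iff_null_sets null_sets_completion_iff null_sets_def)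
    then show "A \<in> null_sets N" by (simp add: N_def null_sets_def emeasure_distr vim)
  qed
  then obtain h0 where h0[measurable]: "h0 \<in> borel_measurable lborel" and N: "density lborel h0 = N"
    using sigma_finite_measure.Radon_Nikodym[OF sigma_finite_lborel, of N] by (auto simp: N_def)
  have Icc: "(\<integral>\<^sup>+x. h0 x * indicator {a..b} x \<partial>lborel) = ennreal (V b - V a)" if "a \<le> b" for a b
  proof -
    have "V ` {a..b} = {V a..V b}"
    proof -
      have "W y \<in> {a..b} \<longleftrightarrow> y \<in> {V a..V b}" for y
        using strict_mono_less_eq[OF smono, of a "W y"] strict_mono_less_eq[OF smono, of "W y" b] by simp
      then show ?thesis unfolding vim[symmetric] by auto
    qed
    moreover have "V a \<le> V b" using low[OF that] that by simp
    moreover have "(\<integral>\<^sup>+x. h0 x * indicator {a..b} x \<partial>lborel) = emeasure N {a..b}"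
      by (simp add: N[symmetric] emeasure_density)
    ultimately show ?thesis by (simp add: N_def emeasure_distr vim)
  qed
  have "AE x in lborel. h0 x \<noteq> \<infinity>"
  proof -
    have "AE x in lborel. h0 x * indicator {- real n..real n} x \<noteq> \<infinity>" for n :: nat
      by (rule nn_integral_PInf_AE) (auto simp: Icc)
    then have "AE x in lborel. \<forall>n::nat. h0 x * indicator {- real n..real n} x \<noteq> \<infinity>" by (simp add: AE_all_countable)
    then show ?thesis
    proof eventually_elim
      case (elim x)
      obtain n :: nat where "\<bar>x\<bar> \<le> real n" using real_arch_simple by blast
      then have "x \<in> {- real n..real n}" by auto
      then show ?case using elim[rule_format, of n] by simp
    qed
  qed
  then have fin: "AE x in lborel. h0 x = ennreal (enn2real (h0 x))" by eventually_elim (simp add: less_top)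
  show thesis
  proof (rule that[of "\<lambda>x. enn2real (h0 x)"])
    fix a b :: real assume ab: "a \<le> b"
    have "(\<integral>\<^sup>+x. ennreal (enn2real (h0 x) * indicator {a..b} x) \<partial>lborel) = ennreal (V b - V a)"
    proof -
      have "(\<integral>\<^sup>+x. ennreal (enn2real (h0 x) * indicator {a..b} x) \<partial>lborel) = (\<integral>\<^sup>+x. h0 x * indicator {a..b} x \<partial>lborel)"
        using fin by (intro nn_integral_cong_AE) (auto elim!: eventually_mono simp: indicator_def)
      then show ?thesis using Icc[OF ab] by simp
    qed
    then have "((\<lambda>x. enn2real (h0 x) * indicator {a..b} x) has_integral (V b - V a)) UNIV"
      using low[OF ab] ab by (intro nn_integral_has_integral) auto
    then have "((\<lambda>x. if x \<in> {a..b} then enn2real (h0 x) else 0) has_integral (V b - V a)) UNIV"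
      by (rule has_integral_eq[rotated]) (auto simp: indicator_def)
    then show "((\<lambda>x. enn2real (h0 x)) has_integral (V b - V a)) {a..b}"
      by (simp only: has_integral_restrict_UNIV)
  qed auto
qed

text \<open>Lebesgue differentiation of the density identifies the limit of the forward quotients
  off a null set, which the integral ignores.\<close>

lemma lipschitz_real_has_integral_forward_slope:
  fixes u :: "real \<Rightarrow> real"
  assumes u: "L-lipschitz_on UNIV u" and ab: "a \<le> b"
  shows "(forward_slope u 1 has_integral (u b - u a)) {a..b}"
proof -
  \<comment> \<open>Adding \<open>(L + 1) t\<close> moves all difference quotients of u, which lie
    in \<open>[-L, L]\<close>, into \<open>[1, 2 L + 1]\<close>.\<close>
  define V where "V t = u t + (L + 1) * t" for t
  have uL: "\<bar>u t - u s\<bar> \<le> L * (t - s)" if "s \<le> t" for s t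
    using lipschitz_onD[OF u, of t s] that by (auto simp: dist_real_def)
  have "V t - V s \<le> (2 * L + 1) * (t - s)" "t - s \<le> V t - V s" if "s \<le> t" for s t
    using uL[OF that] by (auto simp: V_def algebra_simps abs_le_iff)
  then obtain h where h: "h \<in> borel_measurable borel" "\<And>x. 0 \<le> h x"
    "\<And>a b. a \<le> b \<Longrightarrow> (h has_integral (V b - V a)) {a..b}"
    using increasing_bilipschitz_density[of V "2 * L + 1"] by metis
  have "h integrable_on cbox a b" for a b
    using h(3)[of a b] by (cases "a \<le> b") (auto intro: has_integral_integrable)
  then obtain N where N: "negligible N"
    "\<And>x e. x \<notin> N \<Longrightarrow> 0 < e \<Longrightarrow> \<exists>d>0. \<forall>k. 0 < k \<and> k < d \<longrightarrow>
        norm (integral (cbox x (x + k *\<^sub>R One)) h /\<^sub>R k ^ DIM(real) - h x) < e"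
    using integrable_ccontinuous_explicit[of h] by blast
  have slope: "forward_slope u 1 x = h x - (L + 1)" if x: "x \<notin> N" for x
  proof (rule forward_slope_eq, rule LIMSEQ_I)
    fix e :: real assume "e > 0"
    then obtain d where d: "d > 0" "\<And>k. 0 < k \<Longrightarrow> k < d \<Longrightarrow> norm (integral (cbox x (x + k *\<^sub>R One)) h /\<^sub>R k ^ DIM(real) - h x) < e"
      using N(2)[OF x \<open>e > 0\<close>] by auto
    obtain n0 where n0: "\<And>n. n \<ge> n0 \<Longrightarrow> 1 / real (Suc n) < d"
      using order_tendstoD(2)[OF LIMSEQ_Suc[OF lim_1_over_n] d(1)] by (auto simp: eventually_sequentially)
    have "norm (real (Suc n) * (u (x + (1 / real (Suc n)) *\<^sub>R 1) - u x) - (h x - (L + 1))) < e" if "n \<ge> n0" for n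
    proof -
      define k where "k = 1 / real (Suc n)"
      have k: "k > 0" "k < d" using n0[OF that] by (auto simp: k_def)
      have "integral {x..x + k} h = V (x + k) - V x" using h(3)[of x "x + k"] k by (simp add: integral_unique)
      then have "integral (cbox x (x + k *\<^sub>R One)) h /\<^sub>R k ^ DIM(real) = (u (x + k) - u x) / k + (L + 1)"
        using k by (simp add: V_def field_simps)
      with d(2)[OF k] show ?thesis by (simp add: k_def algebra_simps)
    qed
    then show "\<exists>n0. \<forall>n\<ge>n0. norm (real (Suc n) * (u (x + (1 / real (Suc n)) *\<^sub>R 1) - u x) - (h x - (L + 1))) < e"
      by blast
  qed
  have "((\<lambda>x. h x - (L + 1)) has_integral (V b - V a - (L + 1) * (b - a))) {a..b}"
    using has_integral_diff[OF h(3)[OF ab] has_integral_const_real[of "L + 1" a b]] ab by (simp add: mult.commute)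
  then have "(forward_slope u 1 has_integral (V b - V a - (L + 1) * (b - a))) {a..b}"
    by (rule has_integral_spike[OF N(1), rotated]) (use slope in auto)
  then show ?thesis by (simp add: V_def algebra_simps)
qed

lemma forward_slope_line:
  "forward_slope (\<lambda>s. F (x + s *\<^sub>R i)) 1 t = forward_slope F i (x + t *\<^sub>R i)" for t :: real
  by (simp add: forward_slope_def scaleR_left_distrib add.assoc)

text \<open>Valid on every line in direction i, not just almost every one: the restriction of F to
  the line is Lipschitz, and exceptional points matter only within that line.\<close>

lemma lipschitz_has_integral_forward_slope:
  fixes F :: "'a::euclidean_space \<Rightarrow> real"
  assumes F: "L-lipschitz_on UNIV F" and i: "norm i = 1" and s: "0 \<le> s"
  shows "((\<lambda>t. forward_slope F i (x + t *\<^sub>R i)) has_integral (F (x + s *\<^sub>R i) - F x)) {0..s}"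
proof -
  have "L-lipschitz_on UNIV (\<lambda>s. F (x + s *\<^sub>R i))"
  proof (rule lipschitz_onI)
    fix s t :: real
    have "dist (F (x + s *\<^sub>R i)) (F (x + t *\<^sub>R i)) \<le> L * dist (x + s *\<^sub>R i) (x + t *\<^sub>R i)"
      using F by (rule lipschitz_onD) auto
    also have "dist (x + s *\<^sub>R i) (x + t *\<^sub>R i) = dist s t"
      using i by (simp add: dist_norm flip: scaleR_left_diff_distrib)
    finally show "dist (F (x + s *\<^sub>R i)) (F (x + t *\<^sub>R i)) \<le> L * dist s t" .
  qed (use lipschitz_on_nonneg[OF F] in auto)
  moreover have "forward_slope (\<lambda>s. F (x + s *\<^sub>R i)) 1 = (\<lambda>t. forward_slope F i (x + t *\<^sub>R i))"
    by (rule ext) (rule forward_slope_line)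
  ultimately show ?thesis
    using lipschitz_real_has_integral_forward_slope[OF _ s, of L "\<lambda>s. F (x + s *\<^sub>R i)"] by simp
qed

section \<open>Averages over cubes and Lebesgue points\<close>

definition reflect :: "'a::euclidean_space set \<Rightarrow> 'a \<Rightarrow> 'a" where
  "reflect S x = (\<Sum>i\<in>Basis. ((if i \<in> S then -1 else 1) * (x \<bullet> i)) *\<^sub>R i)"

lemma inner_reflect: "i \<in> Basis \<Longrightarrow> reflect S x \<bullet> i = (if i \<in> S then - (x \<bullet> i) else x \<bullet> i)"
  unfolding reflect_def by (subst inner_sum_left_Basis) auto

lemma reflect_reflect[simp]: "reflect S (reflect S x) = x"
  by (rule euclidean_eqI) (auto simp: inner_reflect)

lemma reflect_add: "reflect S (x + y) = reflect S x + reflect S y"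
  by (rule euclidean_eqI) (auto simp: inner_reflect inner_add_left)

lemma borel_measurable_reflect[measurable]: "reflect S \<in> borel_measurable borel"
  unfolding reflect_def[abs_def] by measurable

lemma lborel_distr_reflect: "distr lborel borel (reflect S) = (lborel :: 'a::euclidean_space measure)"
proof -
  have T: "(\<lambda>x. 0 + (\<Sum>j\<in>Basis. ((if j \<in> S then -1 else 1) * (x \<bullet> j)) *\<^sub>R j)) = (reflect S :: 'a \<Rightarrow> 'a)"
    by (auto simp: reflect_def)
  have "(\<Prod>j\<in>Basis. \<bar>if j \<in> S then - 1 else 1 :: real\<bar>) = 1" by (intro prod.neutral) auto
  moreover have "(lborel :: 'a measure) = density (distr lborel borel (\<lambda>x. 0 + (\<Sum>j\<in>Basis. ((if j \<in> S then -1 else 1) * (x \<bullet> j)) *\<^sub>R j)))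
     (\<lambda>_. (\<Prod>j\<in>Basis. \<bar>if j \<in> S then - 1 else 1 :: real\<bar>))"
    by (rule lborel_affine_euclidean) auto
  ultimately show ?thesis unfolding T by (simp add: density_1)
qed

lemma AE_lborel_not_in: "negligible N \<Longrightarrow> AE x in lborel. x \<notin> N"
  by (simp add: AE_iff_null_sets negligible_iff_null_sets) (metis AE_completion_iff AE_not_in)

lemma AE_lborel_reflect:
  assumes "AE x in lborel. P x"
  shows "AE x in lborel. P (reflect S x)"
proof -
  from assms obtain N where N: "N \<in> null_sets lborel" "{x. \<not> P x} \<subseteq> N"
    by (auto simp: eventually_ae_filter)
  have "AE x in distr lborel borel (reflect S). x \<notin> N"
    unfolding lborel_distr_reflect using N(1) by (rule AE_not_in)
  then have "AE x in lborel. reflect S x \<notin> N"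
    using N(1) by (subst (asm) AE_distr_iff) auto
  then show ?thesis by eventually_elim (use N(2) in auto)
qed

lemma nn_integral_reflect:
  "u \<in> borel_measurable borel \<Longrightarrow> (\<integral>\<^sup>+x. u (reflect S x) \<partial>lborel) = (\<integral>\<^sup>+x. u x \<partial>lborel)"
  by (subst (2) lborel_distr_reflect[symmetric, of S], subst nn_integral_distr) auto

lemma nn_integral_shift:
  fixes u :: "'a::euclidean_space \<Rightarrow> ennreal"
  assumes [measurable]: "u \<in> borel_measurable borel"
  shows "(\<integral>\<^sup>+x. u (z + x) \<partial>lborel) = (\<integral>\<^sup>+x. u x \<partial>lborel)"
  by (subst (2) lborel_distr_plus[symmetric, of z], subst nn_integral_distr) auto

text \<open>Says that the upper limit, as h decreases to 0, of the integral of v over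
  \<open>Q h\<close> divided by \<open>h ^ n\<close> is at most c. The side length of
  \<open>Q h\<close> need not be h, so c absorbs the volume factor.\<close>

definition cube_mass_le :: "(real \<Rightarrow> 'a::euclidean_space set) \<Rightarrow> ('a \<Rightarrow> real) \<Rightarrow> real \<Rightarrow> bool" where
  "cube_mass_le Q v c \<longleftrightarrow> (\<forall>e>0. \<forall>\<^sub>F h in at_right 0.
     (\<integral>\<^sup>+y. indicator (Q h) y * ennreal (v y) \<partial>lborel) \<le> ennreal ((c + e) * h ^ DIM('a)))"

abbreviation forward_cube :: "real \<Rightarrow> 'a::euclidean_space set" where
  "forward_cube h \<equiv> cbox 0 (h *\<^sub>R One)"

abbreviation centered_cube :: "real \<Rightarrow> 'a::euclidean_space set" where
  "centered_cube h \<equiv> cbox (- h *\<^sub>R One) (h *\<^sub>R One)"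

text \<open>Lebesgue differentiation along cubes that have x as their lowest corner.\<close>

lemma forward_cube_average:
  fixes v :: "'a::euclidean_space \<Rightarrow> real"
  assumes [measurable]: "v \<in> borel_measurable borel" and v: "\<And>x. 0 \<le> v x" "\<And>x. v x \<le> M"
  shows "AE x in lborel. cube_mass_le forward_cube (\<lambda>y. v (x + y)) (v x)"
proof -
  have ai: "integrable lborel (\<lambda>x. indicator (cbox a b) x * v x)" for a b
  proof (rule Bochner_Integration.integrable_bound[where f="\<lambda>x. indicator (cbox a b) x * M"])
    show "AE x in lborel. norm (indicator (cbox a b) x * v x) \<le> norm (indicator (cbox a b) x * M)"
      using v order_trans[OF v(2) abs_ge_self] by (auto simp: indicator_def)
    have "integrable lborel (indicat_real (cbox a b))"
      using emeasure_lborel_cbox_finite[of a b] by (intro integrable_real_indicator) auto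
    then show "integrable lborel (\<lambda>x. indicator (cbox a b) x * M)" by (intro integrable_mult_left)
  qed auto
  have hi: "(v has_integral (\<integral>x. indicator (cbox a b) x * v x \<partial>lborel)) (cbox a b)" for a b
  proof -
    have "((\<lambda>x. if x \<in> cbox a b then v x else 0) has_integral (\<integral>x. indicator (cbox a b) x * v x \<partial>lborel)) UNIV"
      by (rule has_integral_eq[OF _ has_integral_integral_lborel[OF ai[of a b]]]) (auto simp: indicator_def)
    then show ?thesis by (simp only: has_integral_restrict_UNIV)
  qed
  then have "\<And>a b. v integrable_on cbox a b" by (auto intro: has_integral_integrable)
  then obtain N where N: "negligible N"
    "\<And>x e. x \<notin> N \<Longrightarrow> 0 < e \<Longrightarrow> \<exists>d>0. \<forall>h. 0 < h \<and> h < d \<longrightarrow>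
        norm (integral (cbox x (x + h *\<^sub>R One)) v /\<^sub>R h ^ DIM('a) - v x) < e"
    using integrable_ccontinuous_explicit[of v] by blast
  have nn: "(\<integral>\<^sup>+y. indicator (forward_cube h) y * ennreal (v (x + y)) \<partial>lborel)
      = ennreal (integral (cbox x (x + h *\<^sub>R One)) v)" for x h
  proof -
    have "(\<integral>\<^sup>+y. indicator (forward_cube h) y * ennreal (v (x + y)) \<partial>lborel)
      = (\<integral>\<^sup>+y. ennreal (indicator (cbox x (x + h *\<^sub>R One)) (x + y) * v (x + y)) \<partial>lborel)"
      by (intro nn_integral_cong) (auto simp: indicator_def mem_box inner_add_left)
    also have "\<dots> = (\<integral>\<^sup>+y. ennreal (indicator (cbox x (x + h *\<^sub>R One)) y * v y) \<partial>lborel)"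
      by (rule nn_integral_shift[of "\<lambda>y. ennreal (indicator (cbox x (x + h *\<^sub>R One)) y * v y)"]) measurable
    also have "\<dots> = ennreal (\<integral>y. indicator (cbox x (x + h *\<^sub>R One)) y * v y \<partial>lborel)"
      by (intro nn_integral_eq_integral ai) (auto simp: v)
    finally show ?thesis unfolding integral_unique[OF hi] .
  qed
  show ?thesis
    using AE_lborel_not_in[OF N(1)]
  proof (eventually_elim, unfold cube_mass_le_def, intro allI impI)
    fix x :: 'a and e :: real assume x: "x \<notin> N" and "e > 0"
    then obtain d where d: "d > 0" "\<And>h. 0 < h \<Longrightarrow> h < d \<Longrightarrow> norm (integral (cbox x (x + h *\<^sub>R One)) v /\<^sub>R h ^ DIM('a) - v x) < e"
      using N(2)[OF x \<open>e > 0\<close>] by auto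
    have "integral (cbox x (x + h *\<^sub>R One)) v \<le> (v x + e) * h ^ DIM('a)" if "0 < h" "h < d" for h
    proof -
      have "integral (cbox x (x + h *\<^sub>R One)) v / h ^ DIM('a) \<le> v x + e"
        using d(2)[OF that] by (simp add: abs_less_iff divide_inverse mult.commute)
      then show ?thesis using that by (simp add: pos_divide_le_eq)
    qed
    then show "\<forall>\<^sub>F h in at_right 0. (\<integral>\<^sup>+y. indicator (forward_cube h) y * ennreal (v (x + y)) \<partial>lborel)
        \<le> ennreal ((v x + e) * h ^ DIM('a))"
      unfolding nn eventually_at_right_field using d(1) by (auto intro!: exI[of _ d] ennreal_leI)
  qed
qed

text \<open>The centered cube is covered by the \<open>2 ^ n\<close> images of the forward cube
  under sign changes of coordinates. Reflections preserve Lebesgue measure, so each orthant reduces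
  to forward cubes for a reflected function; this is the origin of the factor
  \<open>2 ^ n\<close>.\<close>

lemma centered_cube_average:
  fixes v :: "'a::euclidean_space \<Rightarrow> real"
  assumes [measurable]: "v \<in> borel_measurable borel" and v: "\<And>x. 0 \<le> v x" "\<And>x. v x \<le> M"
  shows "AE x in lborel. cube_mass_le centered_cube (\<lambda>y. v (x + y)) (2 ^ DIM('a) * v x)"
proof -
  have "AE x in lborel. cube_mass_le forward_cube (\<lambda>y. v (x + reflect S y)) (v x)" for S :: "'a set"
    using AE_lborel_reflect[OF forward_cube_average[of "\<lambda>x. v (reflect S x)" M], of S] v
    by (simp add: reflect_add)
  then have "AE x in lborel. \<forall>S\<in>Pow Basis. cube_mass_le forward_cube (\<lambda>y. v (x + reflect S y)) (v x)"
    by (intro AE_finite_allI) auto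
  then show ?thesis
  proof (eventually_elim, unfold cube_mass_le_def, intro allI impI)
    fix x :: 'a and e :: real
    assume S: "\<forall>S\<in>Pow Basis. \<forall>e>0. \<forall>\<^sub>F h in at_right 0.
        (\<integral>\<^sup>+y. indicator (forward_cube h) y * ennreal (v (x + reflect S y)) \<partial>lborel) \<le> ennreal ((v x + e) * h ^ DIM('a))"
      and e: "e > 0"
    let ?e = "e / 2 ^ DIM('a)"
    have e': "?e > 0" using e by simp
    have "\<forall>\<^sub>F h in at_right 0. \<forall>S\<in>Pow Basis.
        (\<integral>\<^sup>+y. indicator (forward_cube h) y * ennreal (v (x + reflect S y)) \<partial>lborel) \<le> ennreal ((v x + ?e) * h ^ DIM('a))"
      using S e' by (intro eventually_ball_finite ballI) (simp, blast)
    then show "\<forall>\<^sub>F h in at_right 0. (\<integral>\<^sup>+y. indicator (centered_cube h) y * ennreal (v (x + y)) \<partial>lborel)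
        \<le> ennreal ((2 ^ DIM('a) * v x + e) * h ^ DIM('a))"
      using eventually_at_right_less[of 0]
    proof eventually_elim
      case (elim h)
      let ?f = "\<lambda>S y. indicator (forward_cube h) (reflect S y) * ennreal (v (x + y))"
      have "(\<integral>\<^sup>+y. indicator (centered_cube h) y * ennreal (v (x + y)) \<partial>lborel) \<le> (\<integral>\<^sup>+y. (\<Sum>S\<in>Pow Basis. ?f S y) \<partial>lborel)"
      proof (rule nn_integral_mono)
        fix y :: 'a
        \<comment> \<open>Flipping the negative coordinates of y moves it into the forward
          cube.\<close>
        define S where "S = {i\<in>Basis. y \<bullet> i < 0}"
        have "indicator (centered_cube h) y * ennreal (v (x + y)) \<le> ?f S y"
          by (auto simp: indicator_def mem_box inner_reflect S_def)
        also have "\<dots> \<le> (\<Sum>S\<in>Pow Basis. ?f S y)"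
          by (rule member_le_sum) (auto simp: S_def)
        finally show "indicator (centered_cube h) y * ennreal (v (x + y)) \<le> (\<Sum>S\<in>Pow Basis. ?f S y)" .
      qed
      also have "\<dots> = (\<Sum>S\<in>Pow Basis. \<integral>\<^sup>+y. ?f S y \<partial>lborel)"
        by (rule nn_integral_sum) measurable
      also have "\<dots> \<le> (\<Sum>S\<in>Pow (Basis::'a set). ennreal ((v x + ?e) * h ^ DIM('a)))"
      proof (rule sum_mono)
        fix S :: "'a set" assume "S \<in> Pow Basis"
        then show "(\<integral>\<^sup>+y. ?f S y \<partial>lborel) \<le> ennreal ((v x + ?e) * h ^ DIM('a))"
          using nn_integral_reflect[of "\<lambda>y. indicator (forward_cube h) y * ennreal (v (x + reflect S y))" S] elim(1) by simp
      qed
      also have "\<dots> = ennreal (2 ^ DIM('a) * ((v x + ?e) * h ^ DIM('a)))"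
        using v(1)[of x] e' elim(2) unfolding sum_constant ennreal_of_nat_eq_real_of_nat
        by (simp add: card_Pow flip: ennreal_mult')
      also have "2 ^ DIM('a) * ((v x + ?e) * h ^ DIM('a)) = (2 ^ DIM('a) * v x + e) * h ^ DIM('a)"
        by (simp add: algebra_simps)
      finally show ?case .
    qed
  qed
qed

text \<open>Only countably many functions \<open>|g - q|\<close>, with q rational, are averaged, so
  one null set serves for all. At a good x, a rational q close to \<open>g x\<close> replaces the
  value \<open>g x\<close>.\<close>

lemma lebesgue_points:
  fixes g :: "'a::euclidean_space \<Rightarrow> real"
  assumes [measurable]: "g \<in> borel_measurable borel" and g: "\<And>x. \<bar>g x\<bar> \<le> M"
  shows "AE x in lborel. cube_mass_le centered_cube (\<lambda>y. \<bar>g (x + y) - g x\<bar>) 0"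
proof -
  have "AE x in lborel. \<forall>q\<in>\<rat>. cube_mass_le centered_cube (\<lambda>y. \<bar>g (x + y) - q\<bar>) (2 ^ DIM('a) * \<bar>g x - q\<bar>)"
  proof (subst AE_ball_countable[OF countable_rat], intro ballI)
    fix q :: real
    show "AE x in lborel. cube_mass_le centered_cube (\<lambda>y. \<bar>g (x + y) - q\<bar>) (2 ^ DIM('a) * \<bar>g x - q\<bar>)"
    proof (rule centered_cube_average[where M="M + \<bar>q\<bar>"])
      show "\<bar>g x - q\<bar> \<le> M + \<bar>q\<bar>" for x using g[of x] by linarith
    qed auto
  qed
  then show ?thesis
  proof eventually_elim
    case (elim x)
    show ?case unfolding cube_mass_le_def
    proof (intro allI impI)
      fix e :: real assume e: "e > 0"
      \<comment> \<open>Three errors of size \<open>2 ^ n * c\<close> occur: the distance of q to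
        \<open>g x\<close> inside the average, the tolerance of that average, and the constant c
        over the cube of volume \<open>(2 h) ^ n\<close>.\<close>
      define c where "c = e / (3 * 2 ^ DIM('a))"
      have c: "c > 0" "3 * (2 ^ DIM('a) * c) = e" using e by (auto simp: c_def)
      obtain q where q: "q \<in> \<rat>" "g x < q" "q < g x + c"
        using Rats_dense_in_real[of "g x" "g x + c"] c by auto
      let ?M = "\<lambda>h. \<integral>\<^sup>+y. indicator (centered_cube h) y * ennreal \<bar>g (x + y) - q\<bar> \<partial>lborel" and ?c = "2 ^ DIM('a) * c"
      have "?c > 0" using c by simp
      then have "\<forall>\<^sub>F h in at_right 0. ?M h
          \<le> ennreal ((2 ^ DIM('a) * \<bar>g x - q\<bar> + ?c) * h ^ DIM('a))"
        using elim q(1) unfolding cube_mass_le_def by blast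
      then show "\<forall>\<^sub>F h in at_right 0. (\<integral>\<^sup>+y. indicator (centered_cube h) y * ennreal \<bar>g (x + y) - g x\<bar> \<partial>lborel)
          \<le> ennreal ((0 + e) * h ^ DIM('a))"
        using eventually_at_right_less[of 0]
      proof eventually_elim
        case (elim h)
        have "(\<integral>\<^sup>+y. indicator (centered_cube h) y * ennreal \<bar>g (x + y) - g x\<bar> \<partial>lborel)
          \<le> (\<integral>\<^sup>+y. indicator (centered_cube h) y * ennreal \<bar>g (x + y) - q\<bar> + ennreal c * indicator (centered_cube h) y \<partial>lborel)"
          using q c by (intro nn_integral_mono) (auto simp: indicator_def intro!: ennreal_leI simp flip: ennreal_plus)
        also have "\<dots> = ?M h + ennreal c * emeasure lborel (centered_cube h :: 'a set)"
          by (subst nn_integral_add) (auto simp: nn_integral_cmult)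
        also have "emeasure lborel (centered_cube h :: 'a set) = ennreal ((2 * h) ^ DIM('a))"
        proof -
          have "(\<Prod>b\<in>Basis. (h *\<^sub>R One - (- h *\<^sub>R One) :: 'a) \<bullet> b) = (\<Prod>b\<in>(Basis::'a set). 2 * h)"
            by (intro prod.cong) (auto simp: inner_add_left)
          then show ?thesis using elim(2) by (subst emeasure_lborel_cbox) (auto simp: power_mult_distrib)
        qed
        also have "?M h + ennreal c * ennreal ((2 * h) ^ DIM('a))
           \<le> ennreal ((?c + ?c) * h ^ DIM('a)) + ennreal c * ennreal ((2 * h) ^ DIM('a))"
          using q elim(2) by (intro add_right_mono order_trans[OF elim(1)] ennreal_leI mult_right_mono add_right_mono mult_left_mono) auto
        also have "\<dots> = ennreal ((?c + ?c) * h ^ DIM('a) + c * (2 * h) ^ DIM('a))"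
          using c elim(2) by (simp flip: ennreal_mult' ennreal_plus)
        also have "(?c + ?c) * h ^ DIM('a) + c * (2 * h) ^ DIM('a) = (0 + 3 * (?c)) * h ^ DIM('a)"
          by (simp add: power_mult_distrib algebra_simps)
        finally show ?case unfolding c(2) .
      qed
    qed
  qed
qed

text \<open>The increment is the integral of the slope along a segment in direction i. After
  exchanging the integrals, at each time t the translate of Q lies in B, so each t costs at most the
  integral over B.\<close>

lemma cube_slide_le:
  fixes F :: "'a::euclidean_space \<Rightarrow> real"
  assumes F: "L-lipschitz_on UNIV F" and i: "i \<in> Basis" and s: "0 \<le> s"
    and [measurable]: "Q \<in> sets borel" "B \<in> sets borel"
    and sub: "\<And>y t. y \<in> Q \<Longrightarrow> 0 \<le> t \<Longrightarrow> t \<le> s \<Longrightarrow> z + t *\<^sub>R i + y \<in> B"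
  shows "(\<integral>\<^sup>+y. indicator Q y * ennreal \<bar>F (z + s *\<^sub>R i + y) - F (z + y) - a * s\<bar> \<partial>lborel)
    \<le> ennreal s * (\<integral>\<^sup>+y. indicator B y * ennreal \<bar>forward_slope F i y - a\<bar> \<partial>lborel)"
proof -
  let ?g = "forward_slope F i" and ?v = "\<lambda>t y. \<bar>forward_slope F i (z + t *\<^sub>R i + y) - a\<bar>"
  have [measurable]: "?g \<in> borel_measurable borel"
    by (intro borel_measurable_forward_slope borel_measurable_continuous_onI lipschitz_on_continuous_on[OF F])
  have ni: "norm i = 1" using i by simp
  have "(\<integral>\<^sup>+y. indicator Q y * ennreal \<bar>F (z + s *\<^sub>R i + y) - F (z + y) - a * s\<bar> \<partial>lborel)
    \<le> (\<integral>\<^sup>+y. indicator Q y * (\<integral>\<^sup>+t. indicator {0..s} t * ennreal (?v t y) \<partial>lborel) \<partial>lborel)"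
  proof (intro nn_integral_mono mult_left_mono)
    fix y
    have "((\<lambda>t. ?g (z + y + t *\<^sub>R i)) has_integral (F (z + y + s *\<^sub>R i) - F (z + y))) {0..s}"
      by (rule lipschitz_has_integral_forward_slope[OF F ni s])
    from has_integral_diff[OF this has_integral_const_real[of a 0 s]]
    have hi: "((\<lambda>t. ?g (z + t *\<^sub>R i + y) - a) has_integral (F (z + s *\<^sub>R i + y) - F (z + y) - a * s)) {0..s}"
      using s by (simp add: algebra_simps)
    have ai: "integrable lborel (\<lambda>t. indicator {0..s} t * ?v t y)"
    proof (rule Bochner_Integration.integrable_bound[where f="\<lambda>t. indicator {0..s} t * (L + \<bar>a\<bar>)"])
      show "integrable lborel (\<lambda>t. indicator {0..s} t * (L + \<bar>a\<bar>))"
        by (intro integrable_mult_left integrable_real_indicator) (auto simp: emeasure_lborel_Icc_eq)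
      show "AE t in lborel. norm (indicator {0..s} t * ?v t y) \<le> norm (indicator {0..s} t * (L + \<bar>a\<bar>))"
      proof (rule AE_I2)
        fix t
        have "?v t y \<le> L + \<bar>a\<bar>"
          using abs_forward_slope_le[OF F ni, of "z + t *\<^sub>R i + y"] by linarith
        then show "norm (indicator {0..s} t * ?v t y) \<le> norm (indicator {0..s} t * (L + \<bar>a\<bar>))"
          by (auto simp: indicator_def)
      qed
    qed measurable
    have hi2: "((\<lambda>t. ?v t y) has_integral (\<integral>t. indicator {0..s} t * ?v t y \<partial>lborel)) {0..s}"
    proof -
      have "((\<lambda>t. if t \<in> {0..s} then ?v t y else 0) has_integral (\<integral>t. indicator {0..s} t * ?v t y \<partial>lborel)) UNIV"
        by (rule has_integral_eq[OF _ has_integral_integral_lborel[OF ai]]) (auto simp: indicator_def)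
      then show ?thesis by (simp only: has_integral_restrict_UNIV)
    qed
    have "\<bar>F (z + s *\<^sub>R i + y) - F (z + y) - a * s\<bar> \<le> (\<integral>t. indicator {0..s} t * ?v t y \<partial>lborel)"
      using integral_norm_bound_integral[OF has_integral_integrable[OF hi] has_integral_integrable[OF hi2]]
      by (simp add: integral_unique[OF hi] integral_unique[OF hi2])
    then have "ennreal \<bar>F (z + s *\<^sub>R i + y) - F (z + y) - a * s\<bar> \<le> ennreal (\<integral>t. indicator {0..s} t * ?v t y \<partial>lborel)"
      by (rule ennreal_leI)
    also have "\<dots> = (\<integral>\<^sup>+t. ennreal (indicator {0..s} t * ?v t y) \<partial>lborel)"
      by (rule nn_integral_eq_integral[OF ai, symmetric]) auto
    also have "\<dots> = (\<integral>\<^sup>+t. indicator {0..s} t * ennreal (?v t y) \<partial>lborel)"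
      by (intro nn_integral_cong) (auto simp: indicator_def)
    finally show "ennreal \<bar>F (z + s *\<^sub>R i + y) - F (z + y) - a * s\<bar> \<le> (\<integral>\<^sup>+t. indicator {0..s} t * ennreal (?v t y) \<partial>lborel)" .
  qed auto
  also have "\<dots> = (\<integral>\<^sup>+y. \<integral>\<^sup>+t. indicator Q y * (indicator {0..s} t * ennreal (?v t y)) \<partial>lborel \<partial>lborel)"
    by (intro nn_integral_cong nn_integral_cmult[symmetric]) measurable
  also have "\<dots> = (\<integral>\<^sup>+t. \<integral>\<^sup>+y. indicator Q y * (indicator {0..s} t * ennreal (?v t y)) \<partial>lborel \<partial>lborel)"
    by (rule lborel_pair.Fubini'[symmetric]) measurable
  also have "\<dots> \<le> (\<integral>\<^sup>+t. indicator {0..s} t * (\<integral>\<^sup>+y. indicator B y * ennreal \<bar>?g y - a\<bar> \<partial>lborel) \<partial>lborel)"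
  proof (rule nn_integral_mono)
    fix t :: real
    have "(\<integral>\<^sup>+y. indicator Q y * (indicator {0..s} t * ennreal (?v t y)) \<partial>lborel)
      \<le> (\<integral>\<^sup>+y. indicator {0..s} t * (indicator B (z + t *\<^sub>R i + y) * ennreal (?v t y)) \<partial>lborel)"
      using sub by (intro nn_integral_mono) (auto simp: indicator_def)
    also have "\<dots> = indicator {0..s} t * (\<integral>\<^sup>+y. indicator B (z + t *\<^sub>R i + y) * ennreal (?v t y) \<partial>lborel)"
      by (rule nn_integral_cmult) measurable
    also have "(\<integral>\<^sup>+y. indicator B (z + t *\<^sub>R i + y) * ennreal (?v t y) \<partial>lborel) = (\<integral>\<^sup>+y. indicator B y * ennreal \<bar>?g y - a\<bar> \<partial>lborel)"
      by (rule nn_integral_shift) measurable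
    finally show "(\<integral>\<^sup>+y. indicator Q y * (indicator {0..s} t * ennreal (?v t y)) \<partial>lborel)
      \<le> indicator {0..s} t * (\<integral>\<^sup>+y. indicator B y * ennreal \<bar>?g y - a\<bar> \<partial>lborel)" .
  qed
  also have "\<dots> = (\<integral>\<^sup>+t. indicator {0..s} t \<partial>lborel) * (\<integral>\<^sup>+y. indicator B y * ennreal \<bar>?g y - a\<bar> \<partial>lborel)"
    by (rule nn_integral_multc) measurable
  also have "(\<integral>\<^sup>+t. indicator {0..s} t \<partial>lborel) = ennreal s" using s by simp
  finally show ?thesis .
qed

text \<open>The increment of \<open>F\<close> minus its linear part is averaged over a cube of side \<open>\<eta> h\<close>
  and the averages at \<open>x\<close> and \<open>x + v\<close> are joined by a path parallel to the axes.\<close>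

lemma increment_bound_at_lebesgue_point:
  fixes F :: "'a::euclidean_space \<Rightarrow> real" and a :: "'a \<Rightarrow> real" and L h \<eta> e :: real
  assumes F: "L-lipschitz_on UNIV F" and h: "h > 0" and \<eta>: "0 < \<eta>" "\<eta> \<le> 1" and e: "e \<ge> 0"
    and leb: "\<And>i. i \<in> Basis \<Longrightarrow>
      (\<integral>\<^sup>+y. indicator (centered_cube (2 * h)) y * ennreal \<bar>forward_slope F i (x + y) - a i\<bar> \<partial>lborel)
        \<le> ennreal (e * (2 * h) ^ DIM('a))"
    and v: "norm v \<le> h"
  shows "\<bar>F (x + v) - F x - (\<Sum>i\<in>Basis. a i * (v \<bullet> i))\<bar>
    \<le> h * (DIM('a) * e * 2 ^ DIM('a) / \<eta> ^ DIM('a) + 2 * L * DIM('a) * \<eta>)"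
proof -
  let ?g = "forward_slope F" and ?n = "DIM('a)"
  define Q :: "'a set" where "Q = forward_cube (\<eta> * h)"
  define B where "B = cbox (x - (2 * h) *\<^sub>R One) (x + (2 * h) *\<^sub>R One)"
  have [measurable]: "Q \<in> sets borel" "B \<in> sets borel" by (auto simp: Q_def B_def)
  have [measurable]: "F \<in> borel_measurable borel"
    by (intro borel_measurable_continuous_onI lipschitz_on_continuous_on[OF F])
  have slope_m: "?g i \<in> borel_measurable borel" for i
    by (intro borel_measurable_forward_slope borel_measurable_continuous_onI lipschitz_on_continuous_on[OF F])
  have L0: "L \<ge> 0" using F by (rule lipschitz_on_nonneg)
  define K where "K = e * (2 * h) ^ ?n"
  have K0: "K \<ge> 0" using e h by (simp add: K_def)
  have leb': "(\<integral>\<^sup>+y. indicator B y * ennreal \<bar>?g i y - a i\<bar> \<partial>lborel) \<le> ennreal K" if i: "i \<in> Basis" for i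
  proof -
    note slope_m[of i, measurable]
    have "(\<integral>\<^sup>+y. indicator B y * ennreal \<bar>?g i y - a i\<bar> \<partial>lborel)
       = (\<integral>\<^sup>+y. indicator B (x + y) * ennreal \<bar>?g i (x + y) - a i\<bar> \<partial>lborel)"
      by (rule nn_integral_shift[symmetric]) measurable
    also have "\<dots> = (\<integral>\<^sup>+y. indicator (centered_cube (2 * h)) y * ennreal \<bar>?g i (x + y) - a i\<bar> \<partial>lborel)"
      by (intro nn_integral_cong) (auto simp: indicator_def B_def mem_box inner_add_left inner_diff_left)
    finally show ?thesis using leb[OF i] by (simp add: K_def)
  qed
  have vi: "\<bar>v \<bullet> i\<bar> \<le> h" if "i \<in> Basis" for i
    using Basis_le_norm[OF that, of v] v by linarith
  \<comment> \<open>The corners of the axis-parallel path: S collects the directions already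
    traversed.\<close>
  define P where "P S = (\<Sum>i\<in>S. (v \<bullet> i) *\<^sub>R i)" for S
  have Pi: "P S \<bullet> i = (if i \<in> S then v \<bullet> i else 0)" if "S \<subseteq> Basis" "i \<in> Basis" for S i
  proof -
    have "P S \<bullet> i = (\<Sum>j\<in>S. (v \<bullet> j) * (j \<bullet> i))" by (simp add: P_def inner_sum_left)
    also have "\<dots> = (\<Sum>j\<in>S. if j = i then v \<bullet> j else 0)"
      using that by (intro sum.cong) (auto simp: inner_Basis subset_iff)
    also have "\<dots> = (if i \<in> S then v \<bullet> i else 0)"
      using finite_subset[OF that(1)] by (simp add: sum.delta)
    finally show ?thesis .
  qed
  define D where "D S y = F (x + P S + y) - F (x + y) - (\<Sum>i\<in>S. a i * (v \<bullet> i))" for S y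
  have Dm[measurable]: "D S \<in> borel_measurable borel" for S unfolding D_def by measurable
  have step: "(\<integral>\<^sup>+y. indicator Q y * ennreal \<bar>D (insert i S) y - D S y\<bar> \<partial>lborel) \<le> ennreal (h * K)"
    if S: "S \<subseteq> Basis" "i \<in> Basis" "i \<notin> S" for S i
  proof -
    have fin: "finite S" using S(1) by (rule finite_subset) simp
    define s where "s = \<bar>v \<bullet> i\<bar>"
    \<comment> \<open>The slide has nonnegative length, so it starts from the end with the smaller
      i-th coordinate, whatever the sign of \<open>v \<bullet> i\<close>.\<close>
    define z where "z = x + P S + min 0 (v \<bullet> i) *\<^sub>R i"
    have diff: "\<bar>D (insert i S) y - D S y\<bar> = \<bar>F (z + s *\<^sub>R i + y) - F (z + y) - a i * s\<bar>" for y
    proof -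
      have *: "D (insert i S) y - D S y = F (x + P S + (v \<bullet> i) *\<^sub>R i + y) - F (x + P S + y) - a i * (v \<bullet> i)"
        using S fin by (simp add: D_def P_def algebra_simps)
      show ?thesis
      proof (cases "0 \<le> v \<bullet> i")
        case True then show ?thesis unfolding * by (simp add: z_def s_def)
      next
        case False
        then have "z + s *\<^sub>R i = x + P S" "z = x + P S + (v \<bullet> i) *\<^sub>R i" by (auto simp: z_def s_def)
        then show ?thesis unfolding * using False by (simp add: s_def abs_minus_commute)
      qed
    qed
    have "(\<integral>\<^sup>+y. indicator Q y * ennreal \<bar>D (insert i S) y - D S y\<bar> \<partial>lborel)
      \<le> ennreal s * (\<integral>\<^sup>+y. indicator B y * ennreal \<bar>?g i y - a i\<bar> \<partial>lborel)"
      unfolding diff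
    proof (rule cube_slide_le[OF F S(2)])
      fix y t assume y: "y \<in> Q" and t: "0 \<le> t" "t \<le> s"
      show "z + t *\<^sub>R i + y \<in> B"
        unfolding B_def mem_box
      proof (intro ballI)
        fix j :: 'a assume j: "j \<in> Basis"
        have y': "0 \<le> y \<bullet> j" "y \<bullet> j \<le> h"
        proof -
          have "0 \<le> y \<bullet> j" "y \<bullet> j \<le> \<eta> * h" using y j by (auto simp: Q_def mem_box)
          moreover have "\<eta> * h \<le> 1 * h" using \<eta> h by (intro mult_right_mono) auto
          ultimately show "0 \<le> y \<bullet> j" "y \<bullet> j \<le> h" by auto
        qed
        have "\<bar>(z + t *\<^sub>R i - x) \<bullet> j\<bar> \<le> h"
        proof (cases "j = i")
          case True
          then show ?thesis using Pi[OF S(1) j] S t vi[OF j] 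
            by (auto simp: z_def inner_add_left s_def inner_Basis min_def split: if_splits)
        next
          case False
          then show ?thesis using Pi[OF S(1) j] S vi[OF j] j h
            by (auto simp: z_def inner_add_left inner_Basis)
        qed
        \<comment> \<open>The path strays at most h from x in each coordinate and the small cube
          adds at most h, which explains the half-side \<open>2 h\<close>.\<close>
        then show "(x - (2 * h) *\<^sub>R One) \<bullet> j \<le> (z + t *\<^sub>R i + y) \<bullet> j \<and> (z + t *\<^sub>R i + y) \<bullet> j \<le> (x + (2 * h) *\<^sub>R One) \<bullet> j"
          using y' j by (auto simp: inner_add_left inner_diff_left abs_le_iff)
      qed
    qed (auto simp: s_def)
    also have "\<dots> \<le> ennreal h * ennreal K"
      using vi[OF S(2)] by (intro mult_mono leb' S ennreal_leI) (auto simp: s_def)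
    finally show ?thesis using h by (simp add: ennreal_mult')
  qed
  have tot: "(\<integral>\<^sup>+y. indicator Q y * ennreal \<bar>D S y\<bar> \<partial>lborel) \<le> ennreal (card S * (h * K))" if "S \<subseteq> Basis" for S
    using finite_subset[OF that finite_Basis] that
  proof (induction S rule: finite_induct)
    case empty
    then show ?case by (simp add: D_def P_def)
  next
    case (insert i S)
    have "(\<integral>\<^sup>+y. indicator Q y * ennreal \<bar>D (insert i S) y\<bar> \<partial>lborel)
      \<le> (\<integral>\<^sup>+y. indicator Q y * ennreal \<bar>D (insert i S) y - D S y\<bar> + indicator Q y * ennreal \<bar>D S y\<bar> \<partial>lborel)"
      by (intro nn_integral_mono) (auto simp: indicator_def intro!: ennreal_leI simp flip: ennreal_plus)
    also have "\<dots> = (\<integral>\<^sup>+y. indicator Q y * ennreal \<bar>D (insert i S) y - D S y\<bar> \<partial>lborel) + (\<integral>\<^sup>+y. indicator Q y * ennreal \<bar>D S y\<bar> \<partial>lborel)"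
      by (rule nn_integral_add) measurable
    also have "\<dots> \<le> ennreal (h * K) + ennreal (card S * (h * K))"
      using insert by (intro add_mono step) auto
    also have "\<dots> = ennreal (card (insert i S) * (h * K))"
      using insert h K0 by (simp add: algebra_simps flip: ennreal_plus)
    finally show ?case .
  qed
  have P_Basis: "P Basis = v" by (simp add: P_def euclidean_representation)
  define E where "E = F (x + v) - F x - (\<Sum>i\<in>Basis. a i * (v \<bullet> i))"
  \<comment> \<open>Replacing the value by the shifted value at each of the two ends costs L times
    the diameter bound \<open>n \<eta> h\<close>.\<close>
  have ED: "\<bar>E\<bar> - 2 * (L * (?n * (\<eta> * h))) \<le> \<bar>D Basis y\<bar>" if y: "y \<in> Q" for y
  proof -
    have "norm y \<le> (\<Sum>i\<in>Basis. \<bar>y \<bullet> i\<bar>)" by (rule norm_le_l1)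
    also have "\<dots> \<le> (\<Sum>i\<in>(Basis::'a set). \<eta> * h)" using y by (intro sum_mono) (auto simp: Q_def mem_box)
    finally have ny: "norm y \<le> ?n * (\<eta> * h)" by simp
    have lip: "\<bar>F (w + y) - F w\<bar> \<le> L * (?n * (\<eta> * h))" for w
    proof -
      have "\<bar>F (w + y) - F w\<bar> \<le> L * norm y" using lipschitz_onD[OF F, of "w + y" w] by (simp add: dist_norm)
      also have "\<dots> \<le> L * (?n * (\<eta> * h))" using ny L0 by (rule mult_left_mono)
      finally show ?thesis .
    qed
    show ?thesis using lip[of "x + v"] lip[of x] unfolding D_def E_def P_Basis by linarith
  qed
  have emQ: "emeasure lborel Q = ennreal ((\<eta> * h) ^ ?n)"
  proof -
    have "(\<Prod>b\<in>Basis. ((\<eta> * h) *\<^sub>R One - 0 :: 'a) \<bullet> b) = (\<Prod>b\<in>(Basis::'a set). \<eta> * h)"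
      by (intro prod.cong) auto
    then show ?thesis unfolding Q_def using h \<eta> by (subst emeasure_lborel_cbox) auto
  qed
  define R where "R = \<bar>E\<bar> - 2 * (L * (?n * (\<eta> * h)))"
  have "R * (\<eta> * h) ^ ?n \<le> ?n * (h * K)"
  proof (cases "R \<ge> 0")
    case True
    have "ennreal R * ennreal ((\<eta> * h) ^ ?n) = (\<integral>\<^sup>+y. ennreal R * indicator Q y \<partial>lborel)"
      by (simp add: nn_integral_cmult emQ)
    also have "\<dots> \<le> (\<integral>\<^sup>+y. indicator Q y * ennreal \<bar>D Basis y\<bar> \<partial>lborel)"
      using ED by (intro nn_integral_mono) (auto simp: R_def indicator_def intro!: ennreal_leI)
    also have "\<dots> \<le> ennreal (?n * (h * K))" by (rule tot) simp
    finally show ?thesis using True h \<eta> K0 by (simp flip: ennreal_mult')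
  next
    case False
    then have "R * (\<eta> * h) ^ ?n \<le> 0" using h \<eta> by (simp add: mult_nonpos_nonneg)
    moreover have "0 \<le> ?n * (h * K)" using h K0 by simp
    ultimately show ?thesis by linarith
  qed
  then have "R \<le> ?n * (h * K) / (\<eta> * h) ^ ?n" using h \<eta> by (simp add: pos_le_divide_eq)
  also have "\<dots> = h * (?n * e * 2 ^ ?n / \<eta> ^ ?n)"
    using h \<eta> by (simp add: K_def power_mult_distrib)
  finally show ?thesis unfolding R_def E_def by (simp add: algebra_simps)
qed

text \<open>At a common Lebesgue point of all coordinate slopes, the averaged estimate makes the
  linear approximation error \<open>o(h)\<close>: the cube ratio \<eta> is fixed first, then the
  mean oscillation e is made small relative to \<open>\<eta> ^ n\<close>.\<close>

theorem rademacher: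
  fixes F :: "'a::euclidean_space \<Rightarrow> real"
  assumes F: "L-lipschitz_on UNIV F"
  obtains G where "G \<in> borel_measurable borel" "\<And>x. norm (G x) \<le> L * DIM('a)"
    "AE x in lborel. (F has_derivative (\<lambda>h. G x \<bullet> h)) (at x)"
proof
  let ?g = "forward_slope F"
  define G where "G x = (\<Sum>i\<in>Basis. ?g i x *\<^sub>R i)" for x
  have slope_m: "?g i \<in> borel_measurable borel" for i
    by (intro borel_measurable_forward_slope borel_measurable_continuous_onI lipschitz_on_continuous_on[OF F])
  note slope_b = abs_forward_slope_le[OF F]
  show "G \<in> borel_measurable borel" unfolding G_def[abs_def]
    by (intro borel_measurable_sum borel_measurable_scaleR slope_m borel_measurable_const)
  show "norm (G x) \<le> L * DIM('a)" for x
  proof -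
    have "norm (G x) \<le> (\<Sum>i\<in>(Basis::'a set). L)"
      unfolding G_def using slope_b by (intro sum_norm_le) auto
    then show ?thesis by (simp add: mult.commute)
  qed
  have L0: "L \<ge> 0" using F by (rule lipschitz_on_nonneg)
  have "AE x in lborel. \<forall>i\<in>Basis. cube_mass_le centered_cube (\<lambda>y. \<bar>?g i (x + y) - ?g i x\<bar>) 0"
    by (intro AE_finite_allI lebesgue_points[OF slope_m slope_b]) auto
  then show "AE x in lborel. (F has_derivative (\<lambda>h. G x \<bullet> h)) (at x)"
  proof eventually_elim
    case (elim x)
    show ?case unfolding has_derivative_at_alt
    proof (intro conjI allI impI)
      show "bounded_linear (\<lambda>h. G x \<bullet> h)" by (rule bounded_linear_inner_right)
      fix c :: real assume c: "c > 0"
      define n where "n = real DIM('a)"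
      have n: "n > 0" by (simp add: n_def)
      \<comment> \<open>Makes the averaging error \<open>2 L n \<eta>\<close> at most
        \<open>c / 2\<close>; \<open>L + 1\<close> avoids a zero denominator.\<close>
      define \<eta> where "\<eta> = min 1 (c / (4 * (L + 1) * n))"
      have \<eta>: "0 < \<eta>" "\<eta> \<le> 1" using c L0 n by (auto simp: \<eta>_def)
      \<comment> \<open>Chosen so that \<open>n e 2^n / \<eta>^n\<close> equals
        \<open>c / 2\<close>.\<close>
      define e where "e = c * \<eta> ^ DIM('a) / (2 * n * 2 ^ DIM('a))"
      have e: "e > 0" using c \<eta> n by (simp add: e_def)
      let ?P = "\<lambda>i h. (\<integral>\<^sup>+y. indicator (centered_cube h) y * ennreal \<bar>?g i (x + y) - ?g i x\<bar> \<partial>lborel)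
        \<le> ennreal (e * h ^ DIM('a))"
      have "\<forall>\<^sub>F h in at_right 0. \<forall>i\<in>Basis. ?P i h"
        using elim e unfolding cube_mass_le_def by (intro eventually_ball_finite ballI) (simp, fastforce)
      then obtain d0 where d0: "d0 > 0" and d: "\<And>h i. 0 < h \<Longrightarrow> h < d0 \<Longrightarrow> i \<in> Basis \<Longrightarrow> ?P i h"
        unfolding eventually_at_right_field by blast
      show "\<exists>r>0. \<forall>y. norm (y - x) < r \<longrightarrow> norm (F y - F x - G x \<bullet> (y - x)) \<le> c * norm (y - x)"
      \<comment> \<open>Half of \<open>d0\<close>, because an increment of length h is estimated on
        the centered cube with parameter \<open>2 * h\<close>.\<close>
      proof (intro exI[of _ "d0 / 2"] conjI allI impI)
        fix y assume y: "norm (y - x) < d0 / 2"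
        show "norm (F y - F x - G x \<bullet> (y - x)) \<le> c * norm (y - x)"
        proof (cases "y = x")
          case False
          define h where "h = norm (y - x)"
          have h: "h > 0" "2 * h < d0" using False y by (auto simp: h_def)
          have "\<bar>F (x + (y - x)) - F x - (\<Sum>i\<in>Basis. ?g i x * ((y - x) \<bullet> i))\<bar>
            \<le> h * (DIM('a) * e * 2 ^ DIM('a) / \<eta> ^ DIM('a) + 2 * L * DIM('a) * \<eta>)"
          proof (rule increment_bound_at_lebesgue_point[OF F h(1) \<eta>])
            fix i :: 'a assume i: "i \<in> Basis"
            show "(\<integral>\<^sup>+y. indicator (centered_cube (2 * h)) y * ennreal \<bar>?g i (x + y) - ?g i x\<bar> \<partial>lborel)
              \<le> ennreal (e * (2 * h) ^ DIM('a))"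
              using d[of "2 * h", OF _ _ i] h by simp
          qed (use e in \<open>auto simp: h_def\<close>)
          also have "\<dots> \<le> h * (c / 2 + c / 2)"
          proof (intro mult_left_mono add_mono)
            show "DIM('a) * e * 2 ^ DIM('a) / \<eta> ^ DIM('a) \<le> c / 2"
              using \<eta> n by (simp add: e_def n_def[symmetric])
            have eq: "2 * L * n * (c / (4 * M * n)) = c / 2 * (L / M)" if "M > 0" for M
              using n that by (simp add: field_simps)
            have "2 * L * n * \<eta> \<le> 2 * L * n * (c / (4 * (L + 1) * n))"
              using L0 n by (intro mult_left_mono) (auto simp: \<eta>_def)
            also have "\<dots> = c / 2 * (L / (L + 1))" using L0 by (intro eq) simp
            also have "\<dots> \<le> c / 2 * 1" using L0 c by (intro mult_left_mono) auto
            finally show "2 * L * DIM('a) * \<eta> \<le> c / 2" by (simp add: n_def)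
          qed (use h in auto)
          moreover have "G x \<bullet> w = (\<Sum>i\<in>Basis. ?g i x * (w \<bullet> i))" for w
            unfolding G_def inner_sum_left by (simp add: inner_commute)
          ultimately show ?thesis by (simp add: h_def mult.commute)
        qed simp
      qed (use d0 in simp)
    qed
  qed
qed

section \<open>Locally Lipschitz functions on compact convex sets\<close>

text \<open>The pointwise Lipschitz constant at scale \<open>\<eta>\<close> replaces the gradient in the linearization, so \<open>f\<close>
  need not be smoothed; it decreases to \<open>\<bar>\<nabla>f\<bar>\<close> at points of differentiability as \<open>\<eta> \<rightarrow> 0\<close>.\<close>

definition slope :: "('a::euclidean_space \<Rightarrow> real) \<Rightarrow> real \<Rightarrow> 'a \<Rightarrow> real" where
  "slope F \<eta> x = (SUP v\<in>{v. v \<noteq> 0 \<and> norm v < \<eta>}. \<bar>F (x + v) - F x\<bar> / norm v)"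

lemma
  fixes F :: "'a::euclidean_space \<Rightarrow> real"
  assumes F: "L-lipschitz_on UNIV F" and \<eta>: "\<eta> > 0"
  shows slope_le: "slope F \<eta> x \<le> L"
    and increment_le_slope: "norm (x - y) < \<eta> \<Longrightarrow> \<bar>F x - F y\<bar> \<le> slope F \<eta> x * norm (x - y)"
    and borel_measurable_slope: "slope F \<eta> \<in> borel_measurable borel"
    and slope_le_derivative: "(F has_derivative (\<lambda>h. a \<bullet> h)) (at x) \<Longrightarrow> e > 0 \<Longrightarrow>
      \<forall>\<^sub>F k in sequentially. slope F (1 / real (Suc k)) x \<le> norm a + e"
proof -
  let ?V = "\<lambda>\<eta>. {v::'a. v \<noteq> 0 \<and> norm v < \<eta>}"
  have ne: "?V \<eta> \<noteq> {}" if "\<eta> > 0" for \<eta>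
  proof -
    obtain b :: 'a where "b \<in> Basis" by (meson nonempty_Basis ex_in_conv)
    then have "(\<eta> / 2) *\<^sub>R b \<in> ?V \<eta>" using that by (auto simp: nonzero_Basis)
    then show ?thesis by blast
  qed
  have qL: "\<bar>F (x + v) - F x\<bar> / norm v \<le> L" if "v \<noteq> 0" for x v
    using lipschitz_onD[OF F, of "x + v" x] that by (simp add: dist_norm divide_le_eq)
  have bdd: "bdd_above ((\<lambda>v. \<bar>F (x + v) - F x\<bar> / norm v) ` ?V \<eta>)" for x \<eta>
    using qL by (auto intro!: bdd_aboveI[of _ L])
  show "slope F \<eta> x \<le> L" unfolding slope_def using ne[OF \<eta>] qL by (intro cSUP_least) auto
  show "\<bar>F x - F y\<bar> \<le> slope F \<eta> x * norm (x - y)" if "norm (x - y) < \<eta>"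
  proof (cases "x = y")
    case False
    then have v: "y - x \<in> ?V \<eta>" using that by (auto simp: norm_minus_commute)
    have "\<bar>F (x + (y - x)) - F x\<bar> / norm (y - x) \<le> slope F \<eta> x"
      unfolding slope_def by (rule cSUP_upper[OF v bdd])
    then show ?thesis using False by (simp add: divide_le_eq norm_minus_commute abs_minus_commute)
  qed simp
  have cont: "continuous_on UNIV (\<lambda>x. \<bar>F (x + v) - F x\<bar> / norm v)" if "v \<noteq> 0" for v
    using that by (intro continuous_intros continuous_on_compose2[OF lipschitz_on_continuous_on[OF F]]) auto
  show "slope F \<eta> \<in> borel_measurable borel"
  proof (rule borel_measurableI_greater)
    fix c
    \<comment> \<open>The supremum is uncountable, but each quotient is continuous in x; superlevel
      sets are unions of open sets.\<close>
    have "{x \<in> space borel. c < slope F \<eta> x} = (\<Union>v\<in>?V \<eta>. {x. c < \<bar>F (x + v) - F x\<bar> / norm v})"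
      unfolding slope_def using less_cSUP_iff[OF ne[OF \<eta>] bdd] by auto
    also have "open \<dots>" using cont by (intro open_UN ballI open_Collect_less continuous_on_const) auto
    finally show "{x \<in> space borel. c < slope F \<eta> x} \<in> sets borel" by (rule borel_open)
  qed
  show "\<forall>\<^sub>F k in sequentially. slope F (1 / real (Suc k)) x \<le> norm a + e"
    if a: "(F has_derivative (\<lambda>h. a \<bullet> h)) (at x)" and e: "e > 0"
  proof -
    obtain r where r: "r > 0" "\<And>y. norm (y - x) < r \<Longrightarrow> norm (F y - F x - a \<bullet> (y - x)) \<le> e * norm (y - x)"
      using a e unfolding has_derivative_at_alt by blast
    have "\<forall>\<^sub>F k in sequentially. 1 / real (Suc k) < r"
      using order_tendstoD(2)[OF LIMSEQ_Suc[OF lim_1_over_n] r(1)] .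
    then show ?thesis
    proof eventually_elim
      case (elim k)
      show ?case unfolding slope_def
      proof (rule cSUP_least)
        fix v assume v: "v \<in> ?V (1 / real (Suc k))"
        have "\<bar>F (x + v) - F x - a \<bullet> v\<bar> \<le> e * norm v" using r(2)[of "x + v"] v elim by simp
        moreover have "\<bar>a \<bullet> v\<bar> \<le> norm a * norm v" by (rule Cauchy_Schwarz_ineq2)
        ultimately have "\<bar>F (x + v) - F x\<bar> \<le> (norm a + e) * norm v" by (simp add: distrib_right)
        then show "\<bar>F (x + v) - F x\<bar> / norm v \<le> norm a + e" using v by (simp add: divide_le_eq)
      qed (rule ne, simp)
    qed
  qed
qed

text \<open>On a compact convex neighbourhood of K, f is Lipschitz, and composing with the
  nearest-point projection, which convexity makes 1-Lipschitz, extends it. Agreement on an open set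
  around K, not just on K, is what transfers derivatives between F and f.\<close>

lemma locally_lipschitz_compact_extension:
  fixes K :: "'a::euclidean_space set"
  assumes "open X" "compact K" "convex K" "K \<subseteq> X" "K \<noteq> {}" and f: "locally_lipschitz_on X f"
  obtains L F U where "L-lipschitz_on UNIV F" "open U" "K \<subseteq> U" "\<And>x. x \<in> U \<Longrightarrow> F x = f x"
proof -
  obtain r where r: "r > 0" "(\<Union>x\<in>K. cball x r) \<subseteq> X"
  proof -
    obtain r where "r > 0" "(\<Union>x\<in>K. ball x r) \<subseteq> X"
      using compact_subset_open_imp_ball_epsilon_subset[OF \<open>compact K\<close> \<open>open X\<close> \<open>K \<subseteq> X\<close>] by metis
    moreover have "cball x (r/2) \<subseteq> ball x r" for x :: 'a using \<open>r > 0\<close> by auto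
    ultimately show thesis by (intro that[of "r/2"]) (simp, blast)
  qed
  define K' where "K' = {x + y | x y. x \<in> K \<and> y \<in> cball 0 r}"
  have K'1: "compact K'" unfolding K'_def using \<open>compact K\<close> by (intro compact_sums) auto
  have K'2: "convex K'"
  proof -
    have "K' = (\<Union>x\<in>K. \<Union>y\<in>cball 0 r. {x + y})" unfolding K'_def by blast
    then show ?thesis using convex_sums[OF \<open>convex K\<close> convex_cball] by simp
  qed
  have K'3: "K' \<subseteq> X" using r(2) by (force simp: K'_def dist_norm)
  have KK': "ball x r \<subseteq> K'" if "x \<in> K" for x
  proof
    fix z assume "z \<in> ball x r"
    then have "z = x + (z - x)" "z - x \<in> cball 0 r" by (auto simp: dist_norm norm_minus_commute)
    then show "z \<in> K'" unfolding K'_def using that by blast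
  qed
  have "K' \<noteq> {}" using \<open>K \<noteq> {}\<close> KK' r(1) by fastforce
  \<comment> \<open>\<open>local_lipschitz\<close> concerns families depending on a time parameter;
    the single time 0 serves as a dummy.\<close>
  have "local_lipschitz {0::real} X (\<lambda>_. f)"
  proof (rule local_lipschitzI)
    fix t x assume t: "t \<in> {0::real}" and x: "x \<in> X"
    obtain e L where e: "e > 0" "L-lipschitz_on (ball x e \<inter> X) f"
      using f x unfolding locally_lipschitz_on_def by blast
    have "L-lipschitz_on (cball x (e/2) \<inter> X) f"
      using e by (intro lipschitz_on_subset[OF e(2)]) auto
    then show "\<exists>u>0. \<exists>L. \<forall>t\<in>cball t u \<inter> {0}. L-lipschitz_on (cball x u \<inter> X) f"
      using e(1) by (intro exI[of _ "e/2"]) auto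
  qed
  then have ll: "local_lipschitz {0::real} K' (\<lambda>_. f)" by (rule local_lipschitz_subset) (use K'3 in auto)
  then obtain L where L: "L-lipschitz_on K' f"
    using local_lipschitz_compact_implies_lipschitz[OF ll K'1 compact_sing] by auto
  define F where "F x = f (closest_point K' x)" for x
  have cp: "closest_point K' x \<in> K'" for x
    using closest_point_in_set[of K' x] K'1 \<open>K' \<noteq> {}\<close> by (simp add: compact_imp_closed)
  show thesis
  proof (rule that)
    show "L-lipschitz_on UNIV F"
    proof (rule lipschitz_onI)
      fix x y
      have "dist (F x) (F y) \<le> L * dist (closest_point K' x) (closest_point K' y)"
        unfolding F_def using L cp by (intro lipschitz_onD[OF L])
      also have "\<dots> \<le> L * dist x y"
        using closest_point_lipschitz[OF K'2 _ \<open>K' \<noteq> {}\<close>, of x y] K'1 lipschitz_on_nonneg[OF L]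
        by (intro mult_left_mono) (auto simp: compact_imp_closed)
      finally show "dist (F x) (F y) \<le> L * dist x y" .
    qed (rule lipschitz_on_nonneg[OF L])
    show "open (\<Union>x\<in>K. ball x r)" "K \<subseteq> (\<Union>x\<in>K. ball x r)" using r(1) by auto
    show "F x = f x" if "x \<in> (\<Union>x\<in>K. ball x r)" for x
      using that KK' by (auto simp: F_def closest_point_self subset_iff)
  qed
qed

lemma gradient_unique:
  fixes a b :: "'a::euclidean_space"
  assumes "(f has_derivative (\<lambda>h. a \<bullet> h)) (at x)" "(f has_derivative (\<lambda>h. b \<bullet> h)) (at x)"
  shows "a = b"
proof -
  have "(\<lambda>h. a \<bullet> h) = (\<lambda>h. b \<bullet> h)" by (rule has_derivative_unique[OF assms])
  then show ?thesis by (metis vector_eq_rdot inner_commute)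
qed

lemma weighted_integral_cong:
  assumes "\<And>x. x \<in> K \<Longrightarrow> \<phi> x = p x" "\<And>x. x \<in> K \<Longrightarrow> g x = h x"
  shows "weighted_integral K \<phi> a g = weighted_integral K p a h"
  unfolding weighted_integral_def using assms
  by (intro Bochner_Integration.integral_cong) (auto simp: indicator_def)

text \<open>The scale \<open>1 / (k + 1)\<close> of the slopes tends to 0 for the extension F. Since
  F and f coincide near K, the field G from Rademacher's theorem agrees almost everywhere on K with
  the given g.\<close>

lemma poincare_locally_lipschitz_compact:
  fixes K :: "'a::euclidean_space set" and f :: "'a \<Rightarrow> real"
  assumes "open X" and K: "compact K" "convex K" "K \<subseteq> X"
    and \<phi>: "continuous_on K \<phi>" "\<And>x. x \<in> K \<Longrightarrow> \<phi> x > 0" and sc: "strongly_convex_on K C \<phi>"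
    and \<beta>: "real DIM('a) + 1 \<le> \<beta>" and "C > 0"
    and f: "locally_lipschitz_on X f"
    and ae: "AE x in lborel. x \<in> X \<longrightarrow> (f has_derivative (\<lambda>h. g x \<bullet> h)) (at x)"
  defines "I \<equiv> weighted_integral K \<phi> (- \<beta>)"
  shows "ennreal (I (\<lambda>x. 1) * I (\<lambda>x. (f x)\<^sup>2) - (I f)\<^sup>2) \<le> ennreal (I (\<lambda>x. 1) / (C * (\<beta> - 1))) *
    (\<integral>\<^sup>+x. ennreal (indicator K x * \<phi> x powr (1 - \<beta>) * (norm (g x))\<^sup>2) \<partial>lborel)" (is "_ \<le> _ * ?T")
proof (cases "K = {}")
  case False
  obtain L F U where F: "L-lipschitz_on UNIV F" "open U" "K \<subseteq> U" "\<And>x. x \<in> U \<Longrightarrow> F x = f x"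
    using locally_lipschitz_compact_extension[OF \<open>open X\<close> K False f] by metis
  obtain G where G[measurable]: "G \<in> borel_measurable borel" and GN: "\<And>x. norm (G x) \<le> L * DIM('a)"
    and Gd: "AE x in lborel. (F has_derivative (\<lambda>h. G x \<bullet> h)) (at x)"
    using rademacher[OF F(1)] by metis
  \<comment> \<open>Projecting onto K extends \<phi> to a positive continuous function on the whole
    space; strong convexity is needed only on K, where nothing changes.\<close>
  define p where "p x = \<phi> (closest_point K x)" for x
  let ?w = "\<lambda>x. indicator K x * p x powr (1 - \<beta>)"
  have clK: "closed K" using K(1) by (rule compact_imp_closed)
  have cpK: "closest_point K x \<in> K" for x using clK False by (rule closest_point_in_set)
  have p: "continuous_on UNIV p" "\<And>x. p x > 0" "\<And>x. x \<in> K \<Longrightarrow> p x = \<phi> x"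
  proof -
    show "continuous_on UNIV p" unfolding p_def[abs_def]
      using cpK by (intro continuous_on_compose2[OF \<phi>(1) continuous_on_closest_point[OF K(2) clK False]]) auto
  qed (use \<phi>(2) cpK in \<open>auto simp: p_def closest_point_self\<close>)
  have sc': "strongly_convex_on K C p"
    unfolding strongly_convex_on_def
  proof (intro ballI)
    fix x y and u :: real assume xy: "x \<in> K" "y \<in> K" and u: "u \<in> {0..1}"
    have "u *\<^sub>R x + (1 - u) *\<^sub>R y \<in> K" using K(2) xy u by (intro convexD) auto
    then show "p (u *\<^sub>R x + (1 - u) *\<^sub>R y) + C / 2 * (u * (1 - u)) * (norm (x - y))\<^sup>2 \<le> u * p x + (1 - u) * p y"
      using sc xy u p(3) unfolding strongly_convex_on_def by simp
  qed
  have [measurable]: "K \<in> sets borel" using clK by (rule borel_closed)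
  have [measurable]: "p \<in> borel_measurable borel" using p(1) by (rule borel_measurable_continuous_onI)
  \<comment> \<open>The maximum gives nonnegativity and the lower bound of the limit for free,
    leaving only the upper estimate of the slope to be checked.\<close>
  define S where "S k x = max (slope F (1 / real (Suc k)) x) (norm (G x))" for k x
  define N where "N = max L (L * DIM('a))"
  have [measurable]: "slope F (1 / real (Suc k)) \<in> borel_measurable borel" for k
    using F(1) by (rule borel_measurable_slope) simp
  have [measurable]: "S k \<in> borel_measurable borel" for k unfolding S_def by measurable
  have S: "0 \<le> S k x" "S k x \<le> N" for k x
    using slope_le[OF F(1), of "1 / real (Suc k)" x] GN[of x] by (auto simp: S_def N_def le_max_iff_disj)
  have S_le: "\<bar>F x - F y\<bar> \<le> S k x * norm (x - y)" if "norm (x - y) < 1 / real (Suc k)" for k x y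
  proof -
    have "\<bar>F x - F y\<bar> \<le> slope F (1 / real (Suc k)) x * norm (x - y)"
      using F(1) _ that by (rule increment_le_slope) simp
    also have "\<dots> \<le> S k x * norm (x - y)" by (intro mult_right_mono) (auto simp: S_def)
    finally show ?thesis .
  qed
  have S_lim: "(\<lambda>k. S k x) \<longlonglongrightarrow> norm (G x)" if "(F has_derivative (\<lambda>h. G x \<bullet> h)) (at x)" for x
  proof (rule tendstoI)
    fix e :: real assume "e > 0"
    then have "\<forall>\<^sub>F k in sequentially. slope F (1 / real (Suc k)) x \<le> norm (G x) + e / 2"
      using F(1) _ that by (intro slope_le_derivative[where \<eta>=1]) auto
    then show "\<forall>\<^sub>F k in sequentially. dist (S k x) (norm (G x)) < e"
      by eventually_elim (use \<open>e > 0\<close> in \<open>auto simp: S_def dist_real_def\<close>)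
  qed
  let ?W = "weighted_integral K p (1 - \<beta>)" and ?J = "weighted_integral K p (- \<beta>)"
  note ints = integrable_weighted_compact[OF K(1) continuous_on_subset[OF p(1) subset_UNIV] p(2)]
  have W_lim: "(\<lambda>k. ?W (\<lambda>x. (S k x)\<^sup>2)) \<longlonglongrightarrow> ?W (\<lambda>x. (norm (G x))\<^sup>2)"
    unfolding weighted_integral_def
  proof (rule integral_dominated_convergence[where w="\<lambda>x. ?w x * N\<^sup>2"])
    show "AE x in lborel. (\<lambda>k. ?w x * (S k x)\<^sup>2) \<longlonglongrightarrow> ?w x * (norm (G x))\<^sup>2"
      using Gd by eventually_elim (intro tendsto_intros S_lim)
    show "AE x in lborel. norm (?w x * (S k x)\<^sup>2) \<le> ?w x * N\<^sup>2" for k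
      using S by (auto simp: abs_mult intro!: AE_I2 mult_left_mono power_mono)
  qed (use ints[of "\<lambda>_. N\<^sup>2" "N\<^sup>2"] in auto)
  have "?J (\<lambda>x. 1) * ?J (\<lambda>x. (F x)\<^sup>2) - (?J F)\<^sup>2 \<le> ?J (\<lambda>x. 1) / (C * (\<beta> - 1)) * ?W (\<lambda>x. (S k x)\<^sup>2)" for k
    by (rule poincare_slope_compact[OF K(1,2) p(1,2) sc' \<beta> \<open>C > 0\<close> _ lipschitz_on_continuous_on[OF F(1)] _ S S_le[of _ _ k]]) auto
  then have main: "?J (\<lambda>x. 1) * ?J (\<lambda>x. (F x)\<^sup>2) - (?J F)\<^sup>2 \<le> ?J (\<lambda>x. 1) / (C * (\<beta> - 1)) * ?W (\<lambda>x. (norm (G x))\<^sup>2)"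
    by (intro LIMSEQ_le_const[OF tendsto_mult[OF tendsto_const W_lim]]) auto
  have I: "I (\<lambda>x. 1) = ?J (\<lambda>x. 1)" "I (\<lambda>x. (f x)\<^sup>2) = ?J (\<lambda>x. (F x)\<^sup>2)" "I f = ?J F"
    unfolding I_def using p(3) F(3,4) by (auto intro!: weighted_integral_cong simp: subset_iff)
  have "\<bar>(norm (G x))\<^sup>2\<bar> \<le> (L * DIM('a))\<^sup>2" for x using power_mono[OF GN norm_ge_zero, of x 2] by simp
  then have "ennreal (?W (\<lambda>x. (norm (G x))\<^sup>2)) = (\<integral>\<^sup>+x. ennreal (?w x * (norm (G x))\<^sup>2) \<partial>lborel)"
    unfolding weighted_integral_def by (intro nn_integral_eq_integral[symmetric] ints) auto
  also have "\<dots> = ?T"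
  proof (rule nn_integral_cong_AE)
    show "AE x in lborel. ennreal (?w x * (norm (G x))\<^sup>2) = ennreal (indicator K x * \<phi> x powr (1 - \<beta>) * (norm (g x))\<^sup>2)"
      using Gd ae
    proof eventually_elim
      case (elim x)
      show ?case
      proof (cases "x \<in> K")
        case True
        have "(f has_derivative (\<lambda>h. G x \<bullet> h)) (at x)"
          by (rule has_derivative_transform_within_open[OF elim(1) F(2)]) (use F(3,4) True in auto)
        moreover have "(f has_derivative (\<lambda>h. g x \<bullet> h)) (at x)" using elim(2) K(3) True by auto
        ultimately have "G x = g x" by (rule gradient_unique)
        then show ?thesis using True p(3) by simp
      qed simp
    qed
  qed
  finally have E: "ennreal (?W (\<lambda>x. (norm (G x))\<^sup>2)) = ?T" .
  have "\<beta> > 1" using \<beta> DIM_positive[where 'a='a] by linarith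
  moreover have "?J (\<lambda>x. 1) \<ge> 0" unfolding weighted_integral_def by (intro integral_nonneg_AE) auto
  ultimately have "ennreal (?J (\<lambda>x. 1) / (C * (\<beta> - 1)) * ?W (\<lambda>x. (norm (G x))\<^sup>2)) =
     ennreal (?J (\<lambda>x. 1) / (C * (\<beta> - 1))) * ennreal (?W (\<lambda>x. (norm (G x))\<^sup>2))"
    using \<open>C > 0\<close> by (intro ennreal_mult') auto
  then show ?thesis unfolding I using ennreal_leI[OF main] E by simp
qed (simp add: I_def weighted_integral_def)

section \<open>Exhaustion of convex domains\<close>

text \<open>A condition on balls, rather than on the distance to the complement, also makes sense
  when S is the whole space.\<close>

definition inner_exhaustion :: "'a::euclidean_space set \<Rightarrow> nat \<Rightarrow> 'a set" where
  "inner_exhaustion S k = {x. norm x \<le> real k \<and> ball x (1 / real (Suc k)) \<subseteq> S}"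

lemma inner_exhaustion_subset: "inner_exhaustion S k \<subseteq> S"
  by (auto simp: inner_exhaustion_def subset_iff)

lemma compact_inner_exhaustion: "compact (inner_exhaustion S k)"
proof -
  have "{x. ball x (1 / real (Suc k)) \<subseteq> S} = - (\<Union>z\<in>-S. ball z (1 / real (Suc k)))"
    by (auto simp: subset_iff dist_commute)
  then have "closed {x. ball x (1 / real (Suc k)) \<subseteq> S}" by (simp only:) (intro closed_Compl open_UN ballI open_ball)
  moreover have "inner_exhaustion S k = cball 0 (real k) \<inter> {x. ball x (1 / real (Suc k)) \<subseteq> S}"
    by (auto simp: inner_exhaustion_def)
  ultimately show ?thesis by (simp add: compact_Int_closed)
qed

text \<open>A displacement w of the convex combination is realized by the same displacement of both
  endpoints, since the weights add up to 1.\<close>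

lemma convex_inner_exhaustion:
  assumes "convex S"
  shows "convex (inner_exhaustion S k)"
proof (rule convexI)
  fix x y :: 'a and u v :: real
  assume xy: "x \<in> inner_exhaustion S k" "y \<in> inner_exhaustion S k" and uv: "0 \<le> u" "0 \<le> v" "u + v = 1"
  have "u *\<^sub>R x + v *\<^sub>R y \<in> cball 0 (real k)"
    using xy uv by (intro convexD[OF convex_cball]) (auto simp: inner_exhaustion_def)
  moreover have "z \<in> S" if "z \<in> ball (u *\<^sub>R x + v *\<^sub>R y) (1 / real (Suc k))" for z
  proof -
    define w where "w = z - (u *\<^sub>R x + v *\<^sub>R y)"
    have "norm w < 1 / real (Suc k)" using that by (simp add: w_def dist_norm norm_minus_commute)
    then have "x + w \<in> S" "y + w \<in> S" using xy by (auto simp: inner_exhaustion_def subset_iff dist_norm)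
    then have "u *\<^sub>R (x + w) + v *\<^sub>R (y + w) \<in> S" using uv by (intro convexD[OF assms]) auto
    moreover have "u *\<^sub>R (x + w) + v *\<^sub>R (y + w) = z"
    proof -
      have "u *\<^sub>R (x + w) + v *\<^sub>R (y + w) = u *\<^sub>R x + v *\<^sub>R y + (u + v) *\<^sub>R w" by (simp add: algebra_simps)
      then show ?thesis using uv by (simp add: w_def)
    qed
    ultimately show ?thesis by simp
  qed
  ultimately show "u *\<^sub>R x + v *\<^sub>R y \<in> inner_exhaustion S k" by (auto simp: inner_exhaustion_def)
qed

lemma eventually_inner_exhaustion:
  assumes "open S" "x \<in> S"
  shows "\<forall>\<^sub>F k in sequentially. x \<in> inner_exhaustion S k"
proof -
  obtain e where e: "e > 0" "ball x e \<subseteq> S" using assms openE by blast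
  have "\<forall>\<^sub>F k in sequentially. 1 / real (Suc k) < e"
    using order_tendstoD(2)[OF LIMSEQ_Suc[OF lim_1_over_n] e(1)] .
  moreover obtain k0 :: nat where "norm x \<le> real k0" using real_arch_simple by blast
  then have "\<forall>\<^sub>F k in sequentially. norm x \<le> real k" by (intro eventually_sequentiallyI[of k0]) auto
  ultimately show ?thesis
    by eventually_elim (use e(2) in \<open>auto simp: inner_exhaustion_def\<close>)
qed

section \<open>The inequality on an open convex domain\<close>

lemma strongly_convex_on_subset: "strongly_convex_on S C \<phi> \<Longrightarrow> T \<subseteq> S \<Longrightarrow> strongly_convex_on T C \<phi>"
  unfolding strongly_convex_on_def by blast

text \<open>Along the line through x and y, subtracting \<open>C / 2 * (v \<bullet> v) * t^2\<close>
  from \<phi> leaves a function with nonnegative second derivative. Its convexity between 0 and 1 is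
  the claim, as \<open>u - u^2 = u (1 - u)\<close>.\<close>

lemma strongly_convex_on_hessian:
  fixes S :: "'a::euclidean_space set"
  assumes "open S" "convex S"
    and d1: "\<forall>x\<in>S. (\<phi> has_derivative (\<lambda>h. D\<phi> x \<bullet> h)) (at x)"
    and d2: "\<forall>x\<in>S. (D\<phi> has_derivative H x) (at x)"
    and hess: "\<forall>x\<in>S. \<forall>v. v \<bullet> H x v \<ge> C * (v \<bullet> v)"
  shows "strongly_convex_on S C \<phi>"
  unfolding strongly_convex_on_def
proof (intro ballI)
  fix x y and u :: real assume x: "x \<in> S" and y: "y \<in> S" and u: "u \<in> {0..1}"
  define v where "v = x - y"
  define l where "l t = y + t *\<^sub>R v" for t
  define T where "T = l -` S"
  have "convex T"
  proof (rule convexI)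
    fix s t a b :: real assume st: "s \<in> T" "t \<in> T" and ab: "0 \<le> a" "0 \<le> b" "a + b = 1"
    have "a *\<^sub>R l s + b *\<^sub>R l t \<in> S" using st ab by (intro convexD[OF \<open>convex S\<close>]) (auto simp: T_def)
    moreover have "a *\<^sub>R l s + b *\<^sub>R l t = (a + b) *\<^sub>R y + (a * s + b * t) *\<^sub>R v" by (simp add: l_def algebra_simps)
    ultimately show "a *\<^sub>R s + b *\<^sub>R t \<in> T" using ab by (simp add: T_def l_def)
  qed
  define \<psi> where "\<psi> t = \<phi> (l t) - C / 2 * (v \<bullet> v) * t\<^sup>2" for t
  have l': "(l has_derivative (\<lambda>h. h *\<^sub>R v)) (at t)" for t
    unfolding l_def by (auto intro!: derivative_eq_intros)
  have "convex_on T \<psi>"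
  proof (rule f''_ge0_imp_convex[OF \<open>convex T\<close>])
    fix t assume t: "t \<in> T"
    then have lt: "l t \<in> S" by (simp add: T_def)
    have "((\<lambda>t. \<phi> (l t)) has_derivative (\<lambda>h. D\<phi> (l t) \<bullet> (h *\<^sub>R v))) (at t)"
      using has_derivative_compose[OF l', of \<phi>] d1 lt by blast
    then have D1: "DERIV (\<lambda>t. \<phi> (l t)) t :> D\<phi> (l t) \<bullet> v"
      by (simp add: has_field_derivative_def mult.commute[of _ "_ \<bullet> _"])
    show "DERIV \<psi> t :> D\<phi> (l t) \<bullet> v - C * (v \<bullet> v) * t"
      unfolding \<psi>_def by (auto intro!: derivative_eq_intros D1)
    have "((\<lambda>t. D\<phi> (l t)) has_derivative (\<lambda>h. H (l t) (h *\<^sub>R v))) (at t)"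
      using has_derivative_compose[OF l', of D\<phi>] d2 lt by blast
    then have "((\<lambda>t. D\<phi> (l t) \<bullet> v) has_derivative (\<lambda>h. H (l t) (h *\<^sub>R v) \<bullet> v)) (at t)"
      by (rule has_derivative_inner_left)
    moreover have "H (l t) (h *\<^sub>R v) = h *\<^sub>R H (l t) v" for h
      using d2 lt by (intro linear_scale) (auto intro: has_derivative_linear)
    ultimately have D2: "DERIV (\<lambda>t. D\<phi> (l t) \<bullet> v) t :> v \<bullet> H (l t) v"
      by (simp add: has_field_derivative_def inner_commute mult.commute[of _ "_ \<bullet> _"])
    show "DERIV (\<lambda>t. D\<phi> (l t) \<bullet> v - C * (v \<bullet> v) * t) t :> v \<bullet> H (l t) v - C * (v \<bullet> v)"
      by (auto intro!: derivative_eq_intros D2)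
    show "v \<bullet> H (l t) v - C * (v \<bullet> v) \<ge> 0" using hess lt by simp
  qed
  moreover have "1 \<in> T" "0 \<in> T" using x y by (auto simp: T_def l_def v_def)
  ultimately have "\<psi> (u *\<^sub>R 1 + (1 - u) *\<^sub>R 0) \<le> u * \<psi> 1 + (1 - u) * \<psi> 0"
    using u unfolding convex_on_def by (metis add.commute atLeastAtMost_iff diff_add_cancel diff_ge_0_iff_ge)
  moreover have "l u = u *\<^sub>R x + (1 - u) *\<^sub>R y" "l 1 = x" "l 0 = y" by (auto simp: l_def v_def algebra_simps)
  moreover have "(norm (x - y))\<^sup>2 = v \<bullet> v" by (simp add: v_def power2_norm_eq_inner)
  ultimately show "\<phi> (u *\<^sub>R x + (1 - u) *\<^sub>R y) + C / 2 * (u * (1 - u)) * (norm (x - y))\<^sup>2 \<le> u * \<phi> x + (1 - u) * \<phi> y"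
    by (simp add: \<psi>_def power2_eq_square[of u] algebra_simps diff_divide_distrib)
qed

lemma locally_lipschitz_on_imp_continuous_on:
  fixes S :: "'a::metric_space set"
  assumes "open S" and f: "locally_lipschitz_on S f"
  shows "continuous_on S f"
  unfolding continuous_on_eq_continuous_at[OF \<open>open S\<close>]
proof
  fix x assume x: "x \<in> S"
  obtain e L where "e > 0" "L-lipschitz_on (ball x e \<inter> S) f" using f x unfolding locally_lipschitz_on_def by blast
  then have "continuous_on (ball x e \<inter> S) f" "x \<in> ball x e \<inter> S" using x by (auto intro: lipschitz_on_continuous_on)
  then show "isCont f x" using \<open>open S\<close> continuous_on_interior[of "ball x e \<inter> S" f x] by (simp add: interior_open open_Int)
qed

text \<open>Rademacher's theorem on each compact piece yields existence of the derivative almost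
  everywhere. A single Borel field is then read off from forward slopes, so no patching of the local
  gradient fields is required.\<close>

lemma locally_lipschitz_gradient:
  fixes S :: "'a::euclidean_space set"
  assumes "open S" "convex S" and f: "locally_lipschitz_on S f"
  obtains g where "g \<in> borel_measurable borel"
    "AE x in lborel. x \<in> S \<longrightarrow> (f has_derivative (\<lambda>h. g x \<bullet> h)) (at x)"
proof -
  have "AE x in lborel. x \<in> inner_exhaustion S k \<longrightarrow> (\<exists>a. (f has_derivative (\<lambda>h. a \<bullet> h)) (at x))" for k
  proof (cases "inner_exhaustion S k = {}")
    case False
    obtain L F U where F: "L-lipschitz_on UNIV F" "open U" "inner_exhaustion S k \<subseteq> U" "\<And>x. x \<in> U \<Longrightarrow> F x = f x"
      using locally_lipschitz_compact_extension[OF \<open>open S\<close> compact_inner_exhaustion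
         convex_inner_exhaustion[OF \<open>convex S\<close>] inner_exhaustion_subset False f] by metis
    obtain G where "AE x in lborel. (F has_derivative (\<lambda>h. G x \<bullet> h)) (at x)"
      using rademacher[OF F(1)] by metis
    then show ?thesis
    proof (eventually_elim, intro impI exI)
      fix x assume x: "(F has_derivative (\<lambda>h. G x \<bullet> h)) (at x)" "x \<in> inner_exhaustion S k"
      show "(f has_derivative (\<lambda>h. G x \<bullet> h)) (at x)"
        by (rule has_derivative_transform_within_open[OF x(1) F(2)]) (use F(3,4) x(2) in auto)
    qed
  qed simp
  then have "AE x in lborel. \<forall>k. x \<in> inner_exhaustion S k \<longrightarrow> (\<exists>a. (f has_derivative (\<lambda>h. a \<bullet> h)) (at x))"
    by (subst AE_all_countable) blast
  then have ex: "AE x in lborel. x \<in> S \<longrightarrow> (\<exists>a. (f has_derivative (\<lambda>h. a \<bullet> h)) (at x))"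
  proof (eventually_elim, intro impI)
    fix x assume "\<forall>k. x \<in> inner_exhaustion S k \<longrightarrow> (\<exists>a. (f has_derivative (\<lambda>h. a \<bullet> h)) (at x))" and x: "x \<in> S"
    moreover obtain k where "x \<in> inner_exhaustion S k"
      using eventually_happens'[OF sequentially_bot eventually_inner_exhaustion[OF \<open>open S\<close> x]] by blast
    ultimately show "\<exists>a. (f has_derivative (\<lambda>h. a \<bullet> h)) (at x)" by blast
  qed
  \<comment> \<open>Extension by zero is Borel and has the same derivatives at points of the open
    set S.\<close>
  define f0 where "f0 x = indicator S x * f x" for x
  define g where "g x = (\<Sum>i\<in>Basis. forward_slope f0 i x *\<^sub>R i)" for x
  have "continuous_on S f" by (rule locally_lipschitz_on_imp_continuous_on[OF \<open>open S\<close> f])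
  then have f0m: "f0 \<in> borel_measurable borel"
    using borel_measurable_continuous_on_indicator[of S f] \<open>open S\<close> by (simp add: f0_def[abs_def])
  show thesis
  proof
    show "g \<in> borel_measurable borel" unfolding g_def[abs_def]
      by (intro borel_measurable_sum borel_measurable_scaleR borel_measurable_forward_slope f0m borel_measurable_const)
    show "AE x in lborel. x \<in> S \<longrightarrow> (f has_derivative (\<lambda>h. g x \<bullet> h)) (at x)"
      using ex
    proof (eventually_elim, intro impI)
      fix x assume "x \<in> S \<longrightarrow> (\<exists>a. (f has_derivative (\<lambda>h. a \<bullet> h)) (at x))" and x: "x \<in> S"
      then obtain a where a: "(f has_derivative (\<lambda>h. a \<bullet> h)) (at x)" by blast
      have a0: "(f0 has_derivative (\<lambda>h. a \<bullet> h)) (at x)"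
        by (rule has_derivative_transform_within_open[OF a \<open>open S\<close> x]) (simp add: f0_def)
      have "forward_slope f0 i x = a \<bullet> i" for i
      proof (rule forward_slope_eq)
        have "((\<lambda>t. x + t *\<^sub>R i) has_derivative (\<lambda>h. h *\<^sub>R i)) (at 0)" by (auto intro!: derivative_eq_intros)
        from has_derivative_compose[OF this, of f0 "\<lambda>h. a \<bullet> h"] a0
        have "((\<lambda>t. f0 (x + t *\<^sub>R i)) has_field_derivative (a \<bullet> i)) (at 0)"
          by (simp add: has_field_derivative_def mult.commute[of _ "_ \<bullet> _"])
        then have "(\<lambda>t. (f0 (x + t *\<^sub>R i) - f0 x) / t) \<midarrow>0\<rightarrow> a \<bullet> i"
          by (simp add: DERIV_def)
        moreover have "filterlim (\<lambda>k. 1 / real (Suc k)) (at 0) sequentially"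
          using LIMSEQ_Suc[OF lim_1_over_n] by (intro filterlim_atI) (simp_all del: of_nat_Suc)
        ultimately have "(\<lambda>k. (f0 (x + (1 / real (Suc k)) *\<^sub>R i) - f0 x) / (1 / real (Suc k))) \<longlonglongrightarrow> a \<bullet> i"
          by (rule filterlim_compose)
        then show "(\<lambda>k. real (Suc k) * (f0 (x + (1 / real (Suc k)) *\<^sub>R i) - f0 x)) \<longlonglongrightarrow> a \<bullet> i"
          by (simp add: mult.commute)
      qed
      then have "g x = a" by (simp add: g_def euclidean_representation)
      with a show "(f has_derivative (\<lambda>h. g x \<bullet> h)) (at x)" by simp
    qed
  qed
qed

text \<open>The moments over the exhaustion converge by domination. The right-hand sides need no
  limit: for every k they are bounded by the energy over S, which may be infinite.\<close>

lemma poincare_convex_domain: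
  fixes S :: "'a::euclidean_space set" and f :: "'a \<Rightarrow> real"
  assumes "open S" "convex S"
    and \<phi>: "continuous_on S \<phi>" "\<And>x. x \<in> S \<Longrightarrow> \<phi> x > 0" and sc: "strongly_convex_on S C \<phi>"
    and \<beta>: "real DIM('a) + 1 \<le> \<beta>" and "C > 0" and f: "locally_lipschitz_on S f"
    and ae: "AE x in lborel. x \<in> S \<longrightarrow> (f has_derivative (\<lambda>h. g x \<bullet> h)) (at x)"
    and int: "integrable lborel (\<lambda>x. indicator S x * \<phi> x powr (- \<beta>))"
      "integrable lborel (\<lambda>x. indicator S x * \<phi> x powr (- \<beta>) * f x)"
      "integrable lborel (\<lambda>x. indicator S x * \<phi> x powr (- \<beta>) * (f x)\<^sup>2)"
  defines "I \<equiv> weighted_integral S \<phi> (- \<beta>)"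
  shows "ennreal (I (\<lambda>x. 1) * I (\<lambda>x. (f x)\<^sup>2) - (I f)\<^sup>2) \<le> ennreal (I (\<lambda>x. 1) / (C * (\<beta> - 1))) *
    (\<integral>\<^sup>+x. ennreal (indicator S x * \<phi> x powr (1 - \<beta>) * (norm (g x))\<^sup>2) \<partial>lborel)" (is "_ \<le> _ * ?T")
proof -
  let ?K = "inner_exhaustion S"
  have [measurable]: "?K k \<in> sets borel" for k by (intro borel_compact compact_inner_exhaustion)
  have "\<beta> > 1" using \<beta> DIM_positive[where 'a='a] by linarith
  have sub: "indicat_real (?K k) x \<le> indicator S x" for k x
    using inner_exhaustion_subset[of S k] by (auto simp: indicator_def)
  define J where "J k = weighted_integral (?K k) \<phi> (- \<beta>)" for k
  let ?v = "\<lambda>u x. indicator S x * \<phi> x powr (- \<beta>) * u x"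
  have conv: "(\<lambda>k. J k u) \<longlonglongrightarrow> I u" if u: "integrable lborel (\<lambda>x. ?v u x)" for u
    unfolding J_def I_def weighted_integral_def
  proof (rule integral_dominated_convergence[where w="\<lambda>x. norm (?v u x)"])
    have eq: "(\<lambda>x. indicator (?K k) x * \<phi> x powr (- \<beta>) * u x) = (\<lambda>x. indicator (?K k) x * (?v u x))" for k
      using inner_exhaustion_subset[of S k] by (auto simp: indicator_def fun_eq_iff)
    show "(\<lambda>x. indicator (?K k) x * \<phi> x powr (- \<beta>) * u x) \<in> borel_measurable lborel" for k
      unfolding eq by (rule borel_measurable_times[OF _ borel_measurable_integrable[OF u]]) measurable
    show "AE x in lborel. (\<lambda>k. indicator (?K k) x * \<phi> x powr (- \<beta>) * u x) \<longlonglongrightarrow> ?v u x"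
    proof (intro AE_I2 tendsto_mult tendsto_const)
      fix x
      show "(\<lambda>k. indicat_real (?K k) x) \<longlonglongrightarrow> indicator S x"
      proof (cases "x \<in> S")
        case True
        have "\<forall>\<^sub>F k in sequentially. indicat_real (?K k) x = indicator S x"
          using eventually_inner_exhaustion[OF \<open>open S\<close> True] by eventually_elim (use True in simp)
        then show ?thesis by (rule tendsto_eventually)
      next
        case False
        then have "x \<notin> ?K k" for k using inner_exhaustion_subset[of S k] by blast
        then show ?thesis using False by simp
      qed
    qed
    show "AE x in lborel. norm (indicator (?K k) x * \<phi> x powr (- \<beta>) * u x) \<le> norm (?v u x)" for k
      using sub[of k] by (auto simp: abs_mult intro!: AE_I2 mult_right_mono)
  qed (use borel_measurable_integrable[OF u] integrable_norm[OF u] in auto)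
  have le: "ennreal (J k (\<lambda>x. 1) * J k (\<lambda>x. (f x)\<^sup>2) - (J k f)\<^sup>2) \<le> ennreal (I (\<lambda>x. 1) / (C * (\<beta> - 1))) * ?T" for k
  proof -
    have "ennreal (J k (\<lambda>x. 1) * J k (\<lambda>x. (f x)\<^sup>2) - (J k f)\<^sup>2)
      \<le> ennreal (J k (\<lambda>x. 1) / (C * (\<beta> - 1))) * (\<integral>\<^sup>+x. ennreal (indicator (?K k) x * \<phi> x powr (1 - \<beta>) * (norm (g x))\<^sup>2) \<partial>lborel)"
      unfolding J_def
      by (rule poincare_locally_lipschitz_compact[OF \<open>open S\<close> compact_inner_exhaustion
        convex_inner_exhaustion[OF \<open>convex S\<close>] inner_exhaustion_subset _ _ strongly_convex_on_subset[OF sc inner_exhaustion_subset] \<beta> \<open>C > 0\<close> f ae])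
        (use \<phi> inner_exhaustion_subset[of S k] in \<open>auto intro: continuous_on_subset\<close>)
    also have "\<dots> \<le> ennreal (I (\<lambda>x. 1) / (C * (\<beta> - 1))) * ?T"
    proof (rule mult_mono)
      have "J k (\<lambda>x. 1) \<le> I (\<lambda>x. 1)"
        unfolding I_def J_def weighted_integral_def using int(1) sub
        by (intro integral_mono_AE') (auto intro!: AE_I2 mult_right_mono)
      then show "ennreal (J k (\<lambda>x. 1) / (C * (\<beta> - 1))) \<le> ennreal (I (\<lambda>x. 1) / (C * (\<beta> - 1)))"
        using \<open>C > 0\<close> \<open>\<beta> > 1\<close> by (intro ennreal_leI divide_right_mono) auto
      show "(\<integral>\<^sup>+x. ennreal (indicator (?K k) x * \<phi> x powr (1 - \<beta>) * (norm (g x))\<^sup>2) \<partial>lborel) \<le> ?T"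
        using sub by (intro nn_integral_mono ennreal_leI mult_right_mono) auto
    qed auto
    finally show ?thesis .
  qed
  have "(\<lambda>k. J k (\<lambda>x. 1) * J k (\<lambda>x. (f x)\<^sup>2) - (J k f)\<^sup>2) \<longlonglongrightarrow> I (\<lambda>x. 1) * I (\<lambda>x. (f x)\<^sup>2) - (I f)\<^sup>2"
    using int by (intro tendsto_intros conv) auto
  from LIMSEQ_le_const2[OF tendsto_ennrealI[OF this]] le show ?thesis by simp
qed

section \<open>Smooth functions and the normalized measure\<close>

lemma grad_eq: "(f has_derivative (\<lambda>h. a \<bullet> h)) (at x) \<Longrightarrow> grad f x = a"
  unfolding grad_def by (auto simp: differentiable_def intro: the_equality gradient_unique)

lemma gradient_increment_bound:
  fixes f :: "'a::euclidean_space \<Rightarrow> real"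
  assumes "\<And>z. z \<in> closed_segment x y \<Longrightarrow> (f has_derivative (\<lambda>h. G z \<bullet> h)) (at z)"
    and "\<And>z. z \<in> closed_segment x y \<Longrightarrow> norm (G z) \<le> l"
  shows "\<bar>f y - f x\<bar> \<le> l * norm (x - y)"
proof -
  have "norm (f y - f x) \<le> l * norm (y - x)"
  proof (rule differentiable_bound[of "closed_segment x y"])
    fix z assume z: "z \<in> closed_segment x y"
    show "(f has_derivative (\<lambda>h. G z \<bullet> h)) (at z within closed_segment x y)"
      using assms(1)[OF z] by (rule has_derivative_at_withinI)
    show "onorm (\<lambda>h. G z \<bullet> h) \<le> l"
    proof (rule onorm_le)
      fix h
      have "norm (G z \<bullet> h) \<le> norm (G z) * norm h" using Cauchy_Schwarz_ineq2 by simp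
      also have "\<dots> \<le> l * norm h" using assms(2)[OF z] by (intro mult_right_mono) auto
      finally show "norm (G z \<bullet> h) \<le> l * norm h" .
    qed
  qed auto
  then show ?thesis by (simp add: norm_minus_commute)
qed

text \<open>The partial derivatives are again smooth, hence continuous and bounded on a closed ball
  inside S; the mean value inequality on segments of the ball does the rest.\<close>

lemma smooth_on_imp_locally_lipschitz:
  fixes S :: "'a::euclidean_space set"
  assumes "open S" and f: "smooth_on S f"
  shows "locally_lipschitz_on S f"
  unfolding locally_lipschitz_on_def
proof
  fix x assume x: "x \<in> S"
  from f obtain d where "\<forall>x\<in>S. (f has_derivative (\<lambda>h. \<Sum>i\<in>Basis. (h \<bullet> i) * d i x)) (at x)"
      "\<forall>i\<in>Basis. smooth_on S (d i)"
    by cases blast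
  then have d: "\<And>x. x \<in> S \<Longrightarrow> (f has_derivative (\<lambda>h. \<Sum>i\<in>Basis. (h \<bullet> i) * d i x)) (at x)"
      "\<And>i. i \<in> Basis \<Longrightarrow> smooth_on S (d i)"
    by auto
  have cd: "continuous_on S (d i)" if "i \<in> Basis" for i
  proof -
    \<comment> \<open>One more unfolding of the coinductive definition: \<open>d i\<close> is
      differentiable, thus continuous.\<close>
    from d(2)[OF that] have "\<forall>y\<in>S. isCont (d i) y"
      by cases (auto intro: has_derivative_continuous)
    then show ?thesis by (intro continuous_at_imp_continuous_on)
  qed
  obtain r where r: "r > 0" "cball x r \<subseteq> S" using \<open>open S\<close> x open_contains_cball by blast
  define G where "G y = (\<Sum>i\<in>Basis. d i y *\<^sub>R i)" for y
  have "continuous_on (cball x r) G" unfolding G_def[abs_def]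
    using cd r(2) by (intro continuous_intros) (auto intro: continuous_on_subset)
  then have "bounded (G ` cball x r)" by (intro compact_imp_bounded compact_continuous_image) auto
  then obtain B where B: "B > 0" "\<And>y. y \<in> cball x r \<Longrightarrow> norm (G y) \<le> B" unfolding bounded_pos by auto
  have "B-lipschitz_on (ball x r \<inter> S) f"
  proof (rule lipschitz_onI)
    fix y z assume yz: "y \<in> ball x r \<inter> S" "z \<in> ball x r \<inter> S"
    have seg: "w \<in> cball x r" if "w \<in> closed_segment z y" for w
      using closed_segment_subset[of z "cball x r" y] yz that by auto
    have "\<bar>f y - f z\<bar> \<le> B * norm (z - y)"
    proof (rule gradient_increment_bound[of z y f G])
      fix w assume w: "w \<in> closed_segment z y"
      have "(\<lambda>h. \<Sum>i\<in>Basis. (h \<bullet> i) * d i w) = (\<lambda>h. G w \<bullet> h)"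
        unfolding G_def inner_sum_left by (simp add: inner_commute mult.commute)
      then show "(f has_derivative (\<lambda>h. G w \<bullet> h)) (at w)" using d(1)[of w] seg[OF w] r(2) by auto
      show "norm (G w) \<le> B" using B(2) seg[OF w] by blast
    qed
    then show "dist (f y) (f z) \<le> B * dist y z" by (simp add: dist_norm norm_minus_commute)
  qed (use B in simp)
  then show "\<exists>e>0. \<exists>L. L-lipschitz_on (ball x e \<inter> S) f" using r(1) by blast
qed

text \<open>The functions below need not be Borel off \<open>S\<close>, so \<open>mu_beta\<close>, defined from Lebesgue
  measure restricted to \<open>S\<close>, is expressed by Borel functions vanishing off \<open>S\<close>.\<close>

lemma
  fixes S :: "'a::euclidean_space set" and \<phi> :: "'a \<Rightarrow> real" and \<beta> :: real
  assumes "open S" and \<phi>: "continuous_on S \<phi>" "\<And>x. x \<in> S \<Longrightarrow> \<phi> x > 0"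
  defines "Z \<equiv> weighted_integral S \<phi> (- \<beta>) (\<lambda>x. 1)"
  shows AE_mu_beta: "AE x in lborel. x \<in> S \<longrightarrow> P x \<Longrightarrow> AE x in mu_beta S \<phi> \<beta>. P x"
    and integrable_mu_beta: "(\<lambda>x. indicator S x * u x) \<in> borel_measurable borel \<Longrightarrow> Z > 0 \<Longrightarrow>
      integrable (mu_beta S \<phi> \<beta>) u \<longleftrightarrow> integrable lborel (\<lambda>x. indicator S x * \<phi> x powr (- \<beta>) * u x)"
    and integral_mu_beta: "(\<lambda>x. indicator S x * u x) \<in> borel_measurable borel \<Longrightarrow>
      (\<integral>x. u x \<partial>mu_beta S \<phi> \<beta>) = weighted_integral S \<phi> (- \<beta>) u / Z"
    and nn_integral_mu_beta: "(\<lambda>x. indicator S x * u x) \<in> borel_measurable borel \<Longrightarrow> (\<And>x. x \<in> S \<Longrightarrow> 0 \<le> u x) \<Longrightarrow>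
      (\<integral>\<^sup>+x. ennreal (u x) \<partial>mu_beta S \<phi> \<beta>) =
         ennreal (1 / Z) * (\<integral>\<^sup>+x. ennreal (indicator S x * \<phi> x powr (- \<beta>) * u x) \<partial>lborel)"
proof -
  let ?B = "\<lambda>u :: 'a \<Rightarrow> real. (\<lambda>x. indicator S x * u x) \<in> borel_measurable borel"
  let ?\<mu> = "mu_beta S \<phi> \<beta>" and ?R = "restrict_space lebesgue S" and ?w = "\<lambda>x. indicator S x * \<phi> x powr (- \<beta>)"
  have Om: "S \<inter> space lebesgue \<in> sets lebesgue" using \<open>open S\<close> by simp
  have pm: "?w \<in> borel_measurable borel"
    using borel_measurable_indicator_powr[OF _ \<phi>] \<open>open S\<close> by simp
  have rm: "v \<in> borel_measurable ?R" if "?B v" for v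
  proof -
    have "(\<lambda>x. indicator S x * v x) \<in> borel_measurable lebesgue" using that by (intro measurable_completion) simp
    then show ?thesis by (subst borel_measurable_restrict_space_iff[OF Om]) (simp add: mult.commute)
  qed
  have Z0: "Z \<ge> 0" unfolding Z_def weighted_integral_def by (intro integral_nonneg_AE) auto
  have "(\<integral>y\<in>S. \<phi> y powr (-\<beta>) \<partial>lebesgue) = Z"
    unfolding Z_def weighted_integral_def set_lebesgue_integral_def using pm by (simp add: integral_completion)
  then have mu: "?\<mu> = density ?R (\<lambda>x. ennreal (\<phi> x powr (- \<beta>) / Z))" by (simp add: mu_beta_def)
  have dm: "(\<lambda>x. \<phi> x powr (- \<beta>) / Z) \<in> borel_measurable ?R" using rm[OF pm] by simp
  show "AE x in ?\<mu>. P x" if "AE x in lborel. x \<in> S \<longrightarrow> P x"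
  proof -
    have "AE x in ?R. P x" using AE_completion[OF that] by (subst AE_restrict_space_iff[OF Om])
    then show ?thesis unfolding mu using dm by (subst AE_density) (auto elim: eventually_mono)
  qed
  have pum: "(\<lambda>x. ?w x * u x) \<in> borel_measurable borel" if "?B u" for u
  proof -
    have "(\<lambda>x. ?w x * u x) = (\<lambda>x. ?w x * (indicator S x * u x))" by (auto simp: indicator_def)
    then show ?thesis using borel_measurable_times[OF pm that] by simp
  qed
  show "integrable ?\<mu> u \<longleftrightarrow> integrable lborel (\<lambda>x. ?w x * u x)"
    if u: "?B u" and "Z > 0"
  proof -
    have "integrable ?\<mu> u \<longleftrightarrow> integrable ?R (\<lambda>x. \<phi> x powr (- \<beta>) / Z * u x)"
      unfolding mu using dm rm[OF u] Z0 by (subst integrable_density) auto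
    also have "\<dots> \<longleftrightarrow> integrable lebesgue (\<lambda>x. indicator S x * (\<phi> x powr (- \<beta>) / Z * u x))"
      by (subst integrable_restrict_space[OF Om]) simp
    also have "\<dots> \<longleftrightarrow> integrable lborel (\<lambda>x. indicator S x * (\<phi> x powr (- \<beta>) / Z * u x))"
      using pum[OF u] by (intro integrable_completion) (simp add: mult.assoc)
    finally show ?thesis
      using \<open>Z > 0\<close> integrable_mult_right_iff[of lborel "\<lambda>x. ?w x * u x" "1 / Z"] by (simp add: mult_ac)
  qed
  show "(\<integral>x. u x \<partial>?\<mu>) = weighted_integral S \<phi> (- \<beta>) u / Z"
    if u: "?B u"
  proof -
    have "(\<integral>x. u x \<partial>?\<mu>) = (\<integral>x. \<phi> x powr (- \<beta>) / Z * u x \<partial>?R)"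
      unfolding mu using dm rm[OF u] Z0 by (subst integral_density) auto
    also have "\<dots> = (\<integral>x. indicator S x * (\<phi> x powr (- \<beta>) / Z * u x) \<partial>lebesgue)"
      by (subst integral_restrict_space[OF Om]) simp
    also have "\<dots> = (\<integral>x. indicator S x * (\<phi> x powr (- \<beta>) / Z * u x) \<partial>lborel)"
      using pum[OF u] by (intro integral_completion) (simp add: mult.assoc)
    also have "\<dots> = (\<integral>x. ?w x * u x / Z \<partial>lborel)" by (simp add: mult_ac)
    also have "\<dots> = (\<integral>x. ?w x * u x \<partial>lborel) / Z" by (rule integral_divide_zero)
    finally show ?thesis by (simp add: weighted_integral_def)
  qed
  show "(\<integral>\<^sup>+x. ennreal (u x) \<partial>?\<mu>) = ennreal (1 / Z) * (\<integral>\<^sup>+x. ennreal (?w x * u x) \<partial>lborel)"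
    if u: "?B u" and u0: "\<And>x. x \<in> S \<Longrightarrow> 0 \<le> u x"
  proof -
    have "(\<integral>\<^sup>+x. ennreal (u x) \<partial>?\<mu>) = (\<integral>\<^sup>+x. ennreal (\<phi> x powr (- \<beta>) / Z) * ennreal (u x) \<partial>?R)"
      unfolding mu using dm rm[OF u] by (subst nn_integral_density) auto
    also have "\<dots> = (\<integral>\<^sup>+x. ennreal (\<phi> x powr (- \<beta>) / Z) * ennreal (u x) * indicator S x \<partial>lebesgue)"
      by (rule nn_integral_restrict_space[OF Om])
    also have "\<dots> = (\<integral>\<^sup>+x. ennreal (1 / Z) * ennreal (?w x * u x) \<partial>lebesgue)"
      using u0 Z0 by (intro nn_integral_cong) (auto simp: indicator_def ennreal_mult'[symmetric])
    also have "\<dots> = (\<integral>\<^sup>+x. ennreal (1 / Z) * ennreal (?w x * u x) \<partial>lborel)"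
      by (rule nn_integral_completion)
    also have "\<dots> = ennreal (1 / Z) * (\<integral>\<^sup>+x. ennreal (?w x * u x) \<partial>lborel)"
      using pum[OF u] by (intro nn_integral_cmult) simp
    finally show ?thesis .
  qed
qed

theorem theorem12:
  fixes \<Omega> :: "'a::euclidean_space set" and \<phi> :: "'a \<Rightarrow> real"
    and D\<phi> :: "'a \<Rightarrow> 'a" and H :: "'a \<Rightarrow> 'a \<Rightarrow> 'a"
    and C \<beta> :: real
  assumes "open \<Omega>" and "convex \<Omega>"
    and pos: "\<forall>x\<in>\<Omega>. \<phi> x > 0"
    and cvx: "convex_on \<Omega> \<phi>"
    and d1: "\<forall>x\<in>\<Omega>. (\<phi> has_derivative (\<lambda>h. D\<phi> x \<bullet> h)) (at x)"
    and d2: "\<forall>x\<in>\<Omega>. (D\<phi> has_derivative H x) (at x)"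
    and C2: "\<forall>v. continuous_on \<Omega> (\<lambda>x. H x v)"
    and "C > 0"
    and hess: "\<forall>x\<in>\<Omega>. \<forall>v. v \<bullet> H x v \<ge> C * (v \<bullet> v)"
    and int_beta: "set_integrable lebesgue \<Omega> (\<lambda>x. \<phi> x powr (-\<beta>))"
  shows
    "(\<beta> \<ge> real DIM('a) + 1 \<longrightarrow>
       (\<forall>f. locally_lipschitz_on \<Omega> f \<and> f \<in> borel_measurable (mu_beta \<Omega> \<phi> \<beta>)
            \<and> integrable (mu_beta \<Omega> \<phi> \<beta>) (\<lambda>x. (f x)\<^sup>2) \<longrightarrow>
          ennreal (Var (mu_beta \<Omega> \<phi> \<beta>) f)
            \<le> ennreal (1 / (C * (\<beta> - 1))) *
              (\<integral>\<^sup>+ x. ennreal ((norm (grad f x))\<^sup>2 * \<phi> x) \<partial>(mu_beta \<Omega> \<phi> \<beta>))))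
     \<and>
     (\<beta> \<ge> real DIM('a) \<and> set_integrable lebesgue \<Omega> (\<lambda>x. \<phi> x powr (-\<beta> - 1)) \<longrightarrow>
       (\<forall>f. smooth_on \<Omega> f \<and> bounded (f ` \<Omega>) \<longrightarrow>
          (INF c::real. \<integral>\<^sup>+ x. ennreal ((f x - c)\<^sup>2 / \<phi> x) \<partial>(mu_beta \<Omega> \<phi> \<beta>))
            \<le> ennreal (1 / (C * \<beta>)) *
              (\<integral>\<^sup>+ x. ennreal ((norm (grad f x))\<^sup>2) \<partial>(mu_beta \<Omega> \<phi> \<beta>))))"
\<comment> \<open>The empty domain is separate because its normalizing integral is 0; all integrals
  over it vanish.\<close>
proof (cases "\<Omega> = {}")
  case True
  then have "space (mu_beta \<Omega> \<phi> \<beta>) = {}" by (simp add: mu_beta_def space_restrict_space)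
  then have "(\<integral>x. u x \<partial>mu_beta \<Omega> \<phi> \<beta>) = 0" "(\<integral>\<^sup>+x. v x \<partial>mu_beta \<Omega> \<phi> \<beta>) = 0" for u :: "'a \<Rightarrow> real" and v
    by (simp_all add: Bochner_Integration.integral_empty nn_integral_empty)
  then show ?thesis by (simp add: Var_def)
next
  case False
  let ?\<mu> = "mu_beta \<Omega> \<phi> \<beta>"
  have \<phi>: "continuous_on \<Omega> \<phi>" "\<And>x. x \<in> \<Omega> \<Longrightarrow> \<phi> x > 0"
    using d1 pos by (auto intro!: continuous_at_imp_continuous_on has_derivative_continuous)
  have sc: "strongly_convex_on \<Omega> C \<phi>"
    by (rule strongly_convex_on_hessian[OF \<open>open \<Omega>\<close> \<open>convex \<Omega>\<close> d1 d2 hess])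
  let ?w = "\<lambda>b x. indicator \<Omega> x * \<phi> x powr b" and ?J = "weighted_integral \<Omega> \<phi>"
  have wm: "?w b \<in> borel_measurable borel" for b
    using borel_measurable_indicator_powr[OF _ \<phi>] \<open>open \<Omega>\<close> by simp
  have cm: "(\<lambda>x. indicator \<Omega> x * h x) \<in> borel_measurable borel" if "continuous_on \<Omega> h" for h :: "'a \<Rightarrow> real"
    using borel_measurable_continuous_on_indicator[of \<Omega> h] that \<open>open \<Omega>\<close> by simp
  have powm: "(\<lambda>x. ?w b x * h x) \<in> borel_measurable borel" if "continuous_on \<Omega> h" for b and h :: "'a \<Rightarrow> real"
  proof -
    have "(\<lambda>x. ?w b x * h x) = (\<lambda>x. ?w b x * (indicator \<Omega> x * h x))" by (auto simp: indicator_def)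
    then show ?thesis using borel_measurable_times[OF wm cm[OF that]] by simp
  qed
  have lebint: "integrable lborel (?w b)" if "set_integrable lebesgue \<Omega> (\<lambda>x. \<phi> x powr b)" for b
    using that wm[of b] unfolding set_integrable_def by (simp add: integrable_completion)
  \<comment> \<open>A zero integral of a positive function would make the nonempty open set \<Omega>
    negligible.\<close>
  have Jpos: "?J b (\<lambda>x. 1) > 0" if b: "integrable lborel (?w b)" for b
  proof -
    have "?J b (\<lambda>x. 1) \<noteq> 0"
    proof
      assume "?J b (\<lambda>x. 1) = 0"
      then have "AE x in lborel. ?w b x = 0"
        using integral_nonneg_eq_0_iff_AE[OF b] by (simp add: weighted_integral_def)
      then have "AE x in lborel. x \<notin> \<Omega>" by eventually_elim (use \<phi>(2) in \<open>force simp: indicator_def\<close>)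
      then have "negligible \<Omega>" using AE_iff_null_sets[of \<Omega> lebesgue] AE_completion \<open>open \<Omega>\<close>
        by (simp add: negligible_iff_null_sets)
      then show False using open_not_negligible[OF \<open>open \<Omega>\<close> False] by simp
    qed
    moreover have "?J b (\<lambda>x. 1) \<ge> 0" unfolding weighted_integral_def by (intro integral_nonneg_AE) auto
    ultimately show ?thesis by simp
  qed
  define Z where "Z = ?J (- \<beta>) (\<lambda>x. 1)"
  have intZ: "integrable lborel (?w (- \<beta>))" by (rule lebint[OF int_beta])
  have Z: "Z > 0" unfolding Z_def by (rule Jpos[OF intZ])
  note mu_simps = integrable_mu_beta[OF \<open>open \<Omega>\<close> \<phi>, where \<beta>=\<beta>, folded Z_def]
    integral_mu_beta[OF \<open>open \<Omega>\<close> \<phi>, where \<beta>=\<beta>, folded Z_def]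
  note mu_nn = nn_integral_mu_beta[OF \<open>open \<Omega>\<close> \<phi>, where \<beta>=\<beta>, folded Z_def]
  \<comment> \<open>Passes from unnormalized to normalized form. W is the mass belonging to the
    variance and Z the one in \<mu>: they coincide in (i), while in (ii) W belongs to the exponent
    \<open>\<beta> + 1\<close>.\<close>
  have scale: "ennreal (1 / Z * (1 / W) * V) \<le> ennreal c * (ennreal (1 / Z) * T)"
    if "ennreal V \<le> ennreal (W * c) * T" "W > 0" for V W c T
  proof -
    have "ennreal (1 / Z * (1 / W) * V) = ennreal (1 / Z * (1 / W)) * ennreal V"
      using Z that(2) by (intro ennreal_mult') simp
    also have "\<dots> \<le> ennreal (1 / Z * (1 / W)) * (ennreal (W * c) * T)" by (intro mult_left_mono that(1)) simp
    also have "\<dots> = ennreal (1 / Z * (1 / W) * (W * c)) * T"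
      using Z that(2) by (subst ennreal_mult'[of "1 / Z * (1 / W)"]) (simp_all add: mult.assoc)
    also have "1 / Z * (1 / W) * (W * c) = 1 / Z * c" using that(2) by simp
    also have "ennreal (1 / Z * c) = ennreal (1 / Z) * ennreal c" using Z by (intro ennreal_mult') simp
    finally show ?thesis by (simp only: mult_ac)
  qed
  show ?thesis
  proof (intro conjI impI allI)
    fix f assume \<beta>: "real DIM('a) + 1 \<le> \<beta>"
      and "locally_lipschitz_on \<Omega> f \<and> f \<in> borel_measurable ?\<mu> \<and> integrable ?\<mu> (\<lambda>x. (f x)\<^sup>2)"
    then have lip: "locally_lipschitz_on \<Omega> f" and f2: "integrable ?\<mu> (\<lambda>x. (f x)\<^sup>2)" by auto
    have fc: "continuous_on \<Omega> f" by (rule locally_lipschitz_on_imp_continuous_on[OF \<open>open \<Omega>\<close> lip])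
    obtain g where g[measurable]: "g \<in> borel_measurable borel"
      and ae: "AE x in lborel. x \<in> \<Omega> \<longrightarrow> (f has_derivative (\<lambda>h. g x \<bullet> h)) (at x)"
      using locally_lipschitz_gradient[OF \<open>open \<Omega>\<close> \<open>convex \<Omega>\<close> lip] by metis
    have f2m: "(\<lambda>x. indicator \<Omega> x * (f x)\<^sup>2) \<in> borel_measurable borel" using fc by (intro cm continuous_intros)
    have int2: "integrable lborel (\<lambda>x. ?w (- \<beta>) x * (f x)\<^sup>2)"
      using f2 mu_simps(1)[OF _ f2m Z] by auto
    have int1: "integrable lborel (\<lambda>x. ?w (- \<beta>) x * f x)"
    \<comment> \<open>The first moment is dominated through \<open>|f| \<le> 1 + f^2\<close>, as the
      weight has finite mass.\<close>
    proof (rule Bochner_Integration.integrable_bound[OF Bochner_Integration.integrable_add[OF intZ int2]])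
      have "\<bar>f x\<bar> \<le> 1 + (f x)\<^sup>2" for x
        using zero_le_power2[of "\<bar>f x\<bar> - 1"] zero_le_power2[of "f x"] by (simp add: power2_diff)
      then have "?w (- \<beta>) x * \<bar>f x\<bar> \<le> ?w (- \<beta>) x * (1 + (f x)\<^sup>2)" for x by (intro mult_left_mono) auto
      then show "AE x in lborel. norm (?w (- \<beta>) x * f x) \<le> norm (?w (- \<beta>) x + ?w (- \<beta>) x * (f x)\<^sup>2)"
        by (intro AE_I2) (simp add: abs_mult distrib_left)
    qed (use powm[OF fc] in simp)
    define T where "T = (\<integral>\<^sup>+x. ennreal (?w (1 - \<beta>) x * (norm (g x))\<^sup>2) \<partial>lborel)"
    have "(\<integral>\<^sup>+x. ennreal ((norm (grad f x))\<^sup>2 * \<phi> x) \<partial>?\<mu>) = (\<integral>\<^sup>+x. ennreal ((norm (g x))\<^sup>2 * \<phi> x) \<partial>?\<mu>)"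
      by (intro nn_integral_cong_AE AE_mu_beta[OF \<open>open \<Omega>\<close> \<phi>] eventually_mono[OF ae]) (auto simp: grad_eq)
    also have "\<dots> = ennreal (1 / Z) * (\<integral>\<^sup>+x. ennreal (?w (- \<beta>) x * ((norm (g x))\<^sup>2 * \<phi> x)) \<partial>lborel)"
    proof (rule mu_nn)
      have "(\<lambda>x. indicator \<Omega> x * \<phi> x * (norm (g x))\<^sup>2) \<in> borel_measurable borel" using cm[OF \<phi>(1)] by measurable
      then show "(\<lambda>x. indicator \<Omega> x * ((norm (g x))\<^sup>2 * \<phi> x)) \<in> borel_measurable borel" by (simp add: mult_ac)
    qed (use \<phi>(2) in \<open>auto simp: less_imp_le\<close>)
    also have "(\<integral>\<^sup>+x. ennreal (?w (- \<beta>) x * ((norm (g x))\<^sup>2 * \<phi> x)) \<partial>lborel) = T"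
      unfolding T_def
    proof (rule nn_integral_cong)
      fix x
      have "\<phi> x powr (1 - \<beta>) = \<phi> x powr (- \<beta>) * \<phi> x" if "x \<in> \<Omega>"
        using \<phi>(2)[OF that] by (simp add: powr_diff powr_minus field_simps)
      then show "ennreal (?w (- \<beta>) x * ((norm (g x))\<^sup>2 * \<phi> x)) = ennreal (?w (1 - \<beta>) x * (norm (g x))\<^sup>2)"
        by (cases "x \<in> \<Omega>") (simp_all add: mult_ac)
    qed
    finally have rhs: "(\<integral>\<^sup>+x. ennreal ((norm (grad f x))\<^sup>2 * \<phi> x) \<partial>?\<mu>) = ennreal (1 / Z) * T" .
    have mom: "(\<integral>x. (f x)\<^sup>2 \<partial>?\<mu>) = ?J (- \<beta>) (\<lambda>x. (f x)\<^sup>2) / Z" "(\<integral>x. f x \<partial>?\<mu>) = ?J (- \<beta>) f / Z"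
      using mu_simps(2)[OF _ f2m] mu_simps(2)[OF _ cm[OF fc]] by simp_all
    have "Var ?\<mu> f = 1 / Z * (1 / Z) * (Z * ?J (- \<beta>) (\<lambda>x. (f x)\<^sup>2) - (?J (- \<beta>) f)\<^sup>2)"
      unfolding Var_def mom using Z by (simp add: field_simps power2_eq_square)
    moreover have "ennreal (Z * ?J (- \<beta>) (\<lambda>x. (f x)\<^sup>2) - (?J (- \<beta>) f)\<^sup>2) \<le> ennreal (Z * (1 / (C * (\<beta> - 1)))) * T"
      using poincare_convex_domain[OF \<open>open \<Omega>\<close> \<open>convex \<Omega>\<close> \<phi> sc \<beta> \<open>C > 0\<close> lip ae intZ int1 int2]
      by (simp add: Z_def T_def)
    ultimately show "ennreal (Var ?\<mu> f) \<le> ennreal (1 / (C * (\<beta> - 1))) * (\<integral>\<^sup>+x. ennreal ((norm (grad f x))\<^sup>2 * \<phi> x) \<partial>?\<mu>)"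
      unfolding rhs using scale[of _ Z] Z by simp
  next
    fix f assume A: "real DIM('a) \<le> \<beta> \<and> set_integrable lebesgue \<Omega> (\<lambda>x. \<phi> x powr (- \<beta> - 1))"
      and f: "smooth_on \<Omega> f \<and> bounded (f ` \<Omega>)"
    \<comment> \<open>The weight \<open>\<phi> powr (- \<beta>) / \<phi>\<close> on the left of (ii)
      is the one for exponent b. In the energy \<open>1 - b = - \<beta>\<close>, so the additional
      factor \<phi> disappears, and the constant is \<open>C (b - 1) = C \<beta>\<close>.\<close>
    define b where "b = \<beta> + 1"
    have b: "real DIM('a) + 1 \<le> b" using A by (simp add: b_def)
    have intW: "integrable lborel (?w (- b))"
      using lebint[of "- b"] A by (simp add: b_def)
    define W where "W = ?J (- b) (\<lambda>x. 1)"
    have W: "W > 0" unfolding W_def by (rule Jpos[OF intW])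
    have lip: "locally_lipschitz_on \<Omega> f" using f by (intro smooth_on_imp_locally_lipschitz \<open>open \<Omega>\<close>) simp
    have fc: "continuous_on \<Omega> f" by (rule locally_lipschitz_on_imp_continuous_on[OF \<open>open \<Omega>\<close> lip])
    obtain g where g[measurable]: "g \<in> borel_measurable borel"
      and ae: "AE x in lborel. x \<in> \<Omega> \<longrightarrow> (f has_derivative (\<lambda>h. g x \<bullet> h)) (at x)"
      using locally_lipschitz_gradient[OF \<open>open \<Omega>\<close> \<open>convex \<Omega>\<close> lip] by metis
    obtain B where B: "\<And>x. x \<in> \<Omega> \<Longrightarrow> \<bar>f x\<bar> \<le> B" using f unfolding bounded_iff by auto
    have bint: "integrable lborel (\<lambda>x. ?w (- b) x * h x)"
      if h: "continuous_on \<Omega> h" "\<And>x. x \<in> \<Omega> \<Longrightarrow> \<bar>h x\<bar> \<le> D" for h D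
    proof (rule Bochner_Integration.integrable_bound[OF integrable_mult_left[OF intW, of D]])
      show "AE x in lborel. norm (?w (- b) x * h x) \<le> norm (?w (- b) x * D)"
        using h(2) order_trans[OF h(2) abs_ge_self] by (auto simp: abs_mult indicator_def intro!: AE_I2 mult_left_mono)
    qed (use powm[OF h(1)] in simp)
    have int1: "integrable lborel (\<lambda>x. ?w (- b) x * f x)" by (rule bint[OF fc B])
    have int2: "integrable lborel (\<lambda>x. ?w (- b) x * (f x)\<^sup>2)"
    proof (rule bint[where D="B\<^sup>2"])
      show "\<bar>(f x)\<^sup>2\<bar> \<le> B\<^sup>2" if "x \<in> \<Omega>" for x using power_mono[OF B[OF that] abs_ge_zero, of 2] by simp
    qed (use fc in \<open>intro continuous_intros\<close>)
    define T where "T = (\<integral>\<^sup>+x. ennreal (?w (- \<beta>) x * (norm (g x))\<^sup>2) \<partial>lborel)"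
    have "(\<integral>\<^sup>+x. ennreal ((norm (grad f x))\<^sup>2) \<partial>?\<mu>) = (\<integral>\<^sup>+x. ennreal ((norm (g x))\<^sup>2) \<partial>?\<mu>)"
      by (intro nn_integral_cong_AE AE_mu_beta[OF \<open>open \<Omega>\<close> \<phi>] eventually_mono[OF ae]) (auto simp: grad_eq)
    also have "\<dots> = ennreal (1 / Z) * T"
      unfolding T_def using \<open>open \<Omega>\<close> by (intro mu_nn borel_measurable_times borel_measurable_indicator) auto
    finally have rhs: "(\<integral>\<^sup>+x. ennreal ((norm (grad f x))\<^sup>2) \<partial>?\<mu>) = ennreal (1 / Z) * T" .
    \<comment> \<open>The mean of f for the exponent b, which turns the second moment about c into a
      variance.\<close>
    define c where "c = ?J (- b) f / W"
    \<comment> \<open>The square is kept expanded because integrability is known for the three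
      moments separately.\<close>
    let ?h = "\<lambda>x. ?w (- b) x * (f x)\<^sup>2 - 2 * c * (?w (- b) x * f x) + c\<^sup>2 * ?w (- b) x"
    have p: "?h x = ?w (- b) x * (f x - c)\<^sup>2" for x by (simp add: power2_eq_square algebra_simps)
    have "(\<integral>\<^sup>+x. ennreal ((f x - c)\<^sup>2 / \<phi> x) \<partial>?\<mu>)
       = ennreal (1 / Z) * (\<integral>\<^sup>+x. ennreal (?w (- \<beta>) x * ((f x - c)\<^sup>2 / \<phi> x)) \<partial>lborel)"
    proof (rule mu_nn)
      show "(\<lambda>x. indicator \<Omega> x * ((f x - c)\<^sup>2 / \<phi> x)) \<in> borel_measurable borel"
        using fc \<phi> by (intro cm continuous_intros) (auto simp: less_imp_neq[symmetric])
    qed (use \<phi>(2) in \<open>auto simp: less_imp_le\<close>)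
    also have "(\<integral>\<^sup>+x. ennreal (?w (- \<beta>) x * ((f x - c)\<^sup>2 / \<phi> x)) \<partial>lborel) = (\<integral>\<^sup>+x. ennreal (?h x) \<partial>lborel)"
    proof (rule nn_integral_cong)
      fix x
      have "\<phi> x powr (- b) = \<phi> x powr (- \<beta>) / \<phi> x" if "x \<in> \<Omega>"
        using \<phi>(2)[OF that] powr_diff[of "\<phi> x" "- \<beta>" 1] by (simp add: b_def)
      then show "ennreal (?w (- \<beta>) x * ((f x - c)\<^sup>2 / \<phi> x)) = ennreal (?h x)"
        unfolding p by (cases "x \<in> \<Omega>") simp_all
    qed
    also have "\<dots> = ennreal (\<integral>x. ?h x \<partial>lborel)"
    proof (rule nn_integral_eq_integral)
      show "integrable lborel ?h"
        using intW int1 int2 by (intro Bochner_Integration.integrable_add Bochner_Integration.integrable_diff integrable_mult_right)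
      show "AE x in lborel. 0 \<le> ?h x" unfolding p by (intro AE_I2) simp
    qed
    also have "(\<integral>x. ?h x \<partial>lborel) = ?J (- b) (\<lambda>x. (f x)\<^sup>2) - 2 * c * ?J (- b) f + c\<^sup>2 * W"
    proof -
      have "(\<integral>x. p x - k * q x + l * r x \<partial>lborel) = (\<integral>x. p x \<partial>lborel) - k * (\<integral>x. q x \<partial>lborel) + l * (\<integral>x. r x \<partial>lborel)"
        if "integrable lborel p" "integrable lborel q" "integrable lborel r" for p q r :: "'a \<Rightarrow> real" and k l
        using that by simp
      from this[OF int2 int1 intW] show ?thesis unfolding W_def weighted_integral_def by simp
    qed
    also have "\<dots> = 1 / W * (W * ?J (- b) (\<lambda>x. (f x)\<^sup>2) - (?J (- b) f)\<^sup>2)"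
      using W by (simp add: c_def field_simps power2_eq_square)
    finally have "(\<integral>\<^sup>+x. ennreal ((f x - c)\<^sup>2 / \<phi> x) \<partial>?\<mu>)
      = ennreal (1 / Z * (1 / W) * (W * ?J (- b) (\<lambda>x. (f x)\<^sup>2) - (?J (- b) f)\<^sup>2))"
      using Z by (simp add: mult.assoc flip: ennreal_mult')
    also have "\<dots> \<le> ennreal (1 / (C * \<beta>)) * (ennreal (1 / Z) * T)"
    proof (rule scale[OF _ W])
      show "ennreal (W * ?J (- b) (\<lambda>x. (f x)\<^sup>2) - (?J (- b) f)\<^sup>2) \<le> ennreal (W * (1 / (C * \<beta>))) * T"
        using poincare_convex_domain[OF \<open>open \<Omega>\<close> \<open>convex \<Omega>\<close> \<phi> sc b \<open>C > 0\<close> lip ae intW int1 int2]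
        by (simp add: W_def T_def) (simp add: b_def)
    qed
    finally have "(\<integral>\<^sup>+x. ennreal ((f x - c)\<^sup>2 / \<phi> x) \<partial>?\<mu>) \<le> ennreal (1 / (C * \<beta>)) * (ennreal (1 / Z) * T)" .
    then show "(INF c. \<integral>\<^sup>+x. ennreal ((f x - c)\<^sup>2 / \<phi> x) \<partial>?\<mu>)
       \<le> ennreal (1 / (C * \<beta>)) * (\<integral>\<^sup>+x. ennreal ((norm (grad f x))\<^sup>2) \<partial>?\<mu>)"
      unfolding rhs by (rule INF_lower2[OF UNIV_I])
  qed
qed

end
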